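(* Let $k$ be a field, let $K$ be a $k$-bialgebra, and let $L$ and $H$ be $k$-algebras with unit that are also $k$-coalgebras with counit (not necessarily bialgebras). The following statements are equivalent. 1) There exist $k$-linear maps $R: H\otimes L\to L\otimes H$ and $W: L\otimes H\to H\otimes L$ such that $L\,{}_W\!\bowtie_R H$ is a smash biproduct of $L$ and $H$ and there is a bialgebra isomorphism $K\cong L\,{}_W\!\bowtie_R H$. 2) $K$ factorises as a bialgebra as $K=LH$.
   Context: All tensor products are over the field $k$. Algebras are associative with unit and coalgebras are coassociative with counit; algebra maps preserve units and coalgebra maps preserve counits. For an algebra $A$, $m_A$ is the multiplication and $I_A$ the identity map; for a coalgebra $C$, $\Delta_C$ is the comultiplication and $\varepsilon_C$ the counit. Let $L$ and $H$ be algebras that are also coalgebras, and let $R: H\otimes L\to L\otimes H$ and $W: L\otimes H\to H\otimes L$ be $k$-linear. - $L\#_R H$ is the vector space $L\otimes H$ with multiplication $(m_L\otimes m_H)\circ(I_L\otimes R\otimes I_H)$. It is called a smash product if this multiplication is associative with unit $1_L\otimes 1_H$. - The vector space $L\otimes H$ with comultiplication $(I_L\otimes W\otimes I_H)\circ(\Delta_L\otimes\Delta_H)$ is called a smash coproduct if this comultiplication is coassociative with counit $\varepsilon_L\otimes\varepsilon_H$. - $L\,{}_W\!\bowtie_R H$ is the vector space $L\otimes H$ with both of these structures (the multiplication defined by $R$ and the comultiplication defined by $W$). It is called a smash biproduct of $L$ and $H$ if the first structure is a smash product, the second is a smash coproduct, and together they make $L\otimes H$ a bialgebra. Bialgebra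 factorisation: $K$ factorises as $K=LH$ if there are $k$-linear maps $i_L: L\to K$, $p_L: K\to L$, $i_H: H\to K$, $p_H: K\to H$ such that (i) $i_L$ and $i_H$ are algebra maps; (ii) $p_L$ and $p_H$ are coalgebra maps; (iii) the $k$-linear map $\zeta=m_K\circ(i_L\otimes i_H): L\otimes H\to K$ is bijective with inverse $\zeta^{-1}=(p_L\otimes p_H)\circ\Delta_K: K\to L\otimes H$. *)

theory Defs
  imports HOL.Hull "HOL-Algebra.QuotRing" "HOL-Algebra.Module"
begin

section \<open>Linear maps and tensor products of vector spaces\<close>

text \<open>
  Vector spaces over the field \<open>k\<close> are \<^const>\<open>module\<close>s over \<open>k\<close>. When a \<open>module\<close> record
  is used only as a vector space, its fields \<open>mult\<close> and \<open>one\<close> are irrelevant, and they are left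
  \<^const>\<open>undefined\<close> in the constructions of this section.
\<close>

definition linear_maps ::
  "('k, 'r) ring_scheme \<Rightarrow> ('k, 'a, 'm) module_scheme \<Rightarrow> ('k, 'b, 'n) module_scheme \<Rightarrow> ('a \<Rightarrow> 'b) set"
  where "linear_maps k M N = {f. f \<in> carrier M \<rightarrow> carrier N \<and>
    (\<forall>x\<in>carrier M. \<forall>y\<in>carrier M. f (x \<oplus>\<^bsub>M\<^esub> y) = f x \<oplus>\<^bsub>N\<^esub> f y) \<and>
    (\<forall>c\<in>carrier k. \<forall>x\<in>carrier M. f (c \<odot>\<^bsub>M\<^esub> x) = c \<odot>\<^bsub>N\<^esub> f x)}"

text \<open>The free module on a set \<open>S\<close>: finitely supported functions, zero outside \<open>S\<close>.\<close>

definition free_module :: "('k, 'r) ring_scheme \<Rightarrow> 'p set \<Rightarrow> ('k, 'p \<Rightarrow> 'k) module"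
  where "free_module k S =
    \<lparr>carrier = {f. (\<forall>p\<in>S. f p \<in> carrier k) \<and> (\<forall>p. p \<notin> S \<longrightarrow> f p = \<zero>\<^bsub>k\<^esub>) \<and> finite {p. f p \<noteq> \<zero>\<^bsub>k\<^esub>}},
     mult = undefined, one = undefined,
     zero = (\<lambda>p. \<zero>\<^bsub>k\<^esub>),
     add = (\<lambda>f g p. f p \<oplus>\<^bsub>k\<^esub> g p),
     smult = (\<lambda>c f p. c \<otimes>\<^bsub>k\<^esub> f p)\<rparr>"

definition free_gen :: "('k, 'r) ring_scheme \<Rightarrow> 'p \<Rightarrow> 'p \<Rightarrow> 'k"
  where "free_gen k p = (\<lambda>q. if q = p then \<one>\<^bsub>k\<^esub> else \<zero>\<^bsub>k\<^esub>)"

definition quotient_module :: "('k, 'a, 'm) module_scheme \<Rightarrow> 'a set \<Rightarrow> ('k, 'a set) module"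
  where "quotient_module M U =
    \<lparr>carrier = a_rcosets\<^bsub>M\<^esub> U,
     mult = undefined, one = undefined,
     zero = U,
     add = set_add M,
     smult = (\<lambda>c X. \<Union>x\<in>X. U +>\<^bsub>M\<^esub> (c \<odot>\<^bsub>M\<^esub> x))\<rparr>"

text \<open>\<open>M \<otimes> N\<close> is the free module on \<open>M \<times> N\<close> modulo the submodule generated by the
  bilinearity relations.\<close>

type_synonym ('k, 'a, 'b) tensor = "('a \<times> 'b \<Rightarrow> 'k) set"

definition tensor_relations ::
  "('k, 'r) ring_scheme \<Rightarrow> ('k, 'a, 'm) module_scheme \<Rightarrow> ('k, 'b, 'n) module_scheme
     \<Rightarrow> ('a \<times> 'b \<Rightarrow> 'k) set"
  where "tensor_relations k M N = (let F = free_module k (carrier M \<times> carrier N); g = free_gen k in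
    {g (x \<oplus>\<^bsub>M\<^esub> x', y) \<ominus>\<^bsub>F\<^esub> (g (x, y) \<oplus>\<^bsub>F\<^esub> g (x', y)) | x x' y.
       x \<in> carrier M \<and> x' \<in> carrier M \<and> y \<in> carrier N} \<union>
    {g (x, y \<oplus>\<^bsub>N\<^esub> y') \<ominus>\<^bsub>F\<^esub> (g (x, y) \<oplus>\<^bsub>F\<^esub> g (x, y')) | x y y'.
       x \<in> carrier M \<and> y \<in> carrier N \<and> y' \<in> carrier N} \<union>
    {g (c \<odot>\<^bsub>M\<^esub> x, y) \<ominus>\<^bsub>F\<^esub> (c \<odot>\<^bsub>F\<^esub> g (x, y)) | c x y.
       c \<in> carrier k \<and> x \<in> carrier M \<and> y \<in> carrier N} \<union>
    {g (x, c \<odot>\<^bsub>N\<^esub> y) \<ominus>\<^bsub>F\<^esub> (c \<odot>\<^bsub>F\<^esub> g (x, y)) | c x y.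
       c \<in> carrier k \<and> x \<in> carrier M \<and> y \<in> carrier N})"

definition tensor_kernel ::
  "('k, 'r) ring_scheme \<Rightarrow> ('k, 'a, 'm) module_scheme \<Rightarrow> ('k, 'b, 'n) module_scheme
     \<Rightarrow> ('a \<times> 'b \<Rightarrow> 'k) set"
  where "tensor_kernel k M N =
    (\<lambda>U. submodule U k (free_module k (carrier M \<times> carrier N))) hull tensor_relations k M N"

definition tensor ::
  "('k, 'r) ring_scheme \<Rightarrow> ('k, 'a, 'm) module_scheme \<Rightarrow> ('k, 'b, 'n) module_scheme
     \<Rightarrow> ('k, ('k, 'a, 'b) tensor) module"
  where "tensor k M N =
    quotient_module (free_module k (carrier M \<times> carrier N)) (tensor_kernel k M N)"

text \<open>The element \<open>x \<otimes> y\<close> of \<open>M \<otimes> N\<close>.\<close>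

definition pure_tensor ::
  "('k, 'r) ring_scheme \<Rightarrow> ('k, 'a, 'm) module_scheme \<Rightarrow> ('k, 'b, 'n) module_scheme
     \<Rightarrow> 'a \<Rightarrow> 'b \<Rightarrow> ('k, 'a, 'b) tensor"
  where "pure_tensor k M N x y =
    tensor_kernel k M N +>\<^bsub>free_module k (carrier M \<times> carrier N)\<^esub> free_gen k (x, y)"

text \<open>The linear map into \<open>P\<close> sending \<open>x \<otimes> y\<close> to \<open>B x y\<close>. If \<open>B\<close> is bilinear, the sum below
  does not depend on the representative \<open>f\<close> of the coset \<open>t\<close>, so its image is a singleton.\<close>

definition tensor_lift ::
  "('k, 'r) ring_scheme \<Rightarrow> ('k, 'c, 'm) module_scheme \<Rightarrow> ('a \<Rightarrow> 'b \<Rightarrow> 'c) \<Rightarrow> ('k, 'a, 'b) tensor \<Rightarrow> 'c"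
  where "tensor_lift k P B t =
    the_elem ((\<lambda>f. \<Oplus>\<^bsub>P\<^esub>p\<in>{p. f p \<noteq> \<zero>\<^bsub>k\<^esub>}. f p \<odot>\<^bsub>P\<^esub> B (fst p) (snd p)) ` t)"

text \<open>\<open>f \<otimes> g\<close>; the vector spaces \<open>M\<close> and \<open>N\<close> are the codomains of \<open>f\<close> and \<open>g\<close>.\<close>

definition tensor_map ::
  "('k, 'r) ring_scheme \<Rightarrow> ('k, 'c, 'm) module_scheme \<Rightarrow> ('k, 'd, 'n) module_scheme
     \<Rightarrow> ('a \<Rightarrow> 'c) \<Rightarrow> ('b \<Rightarrow> 'd) \<Rightarrow> ('k, 'a, 'b) tensor \<Rightarrow> ('k, 'c, 'd) tensor"
  where "tensor_map k M N f g = tensor_lift k (tensor k M N) (\<lambda>x y. pure_tensor k M N (f x) (g y))"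

text \<open>The canonical isomorphisms \<open>(A \<otimes> B) \<otimes> C \<rightarrow> A \<otimes> (B \<otimes> C)\<close>, its inverse,
  \<open>A \<otimes> B \<rightarrow> B \<otimes> A\<close>, \<open>k \<otimes> A \<rightarrow> A\<close> and \<open>A \<otimes> k \<rightarrow> A\<close>, which are suppressed in informal
  notation.\<close>

definition tensor_assoc ::
  "('k, 'r) ring_scheme \<Rightarrow> ('k, 'a, 'm) module_scheme \<Rightarrow> ('k, 'b, 'n) module_scheme
     \<Rightarrow> ('k, 'c, 'p) module_scheme
     \<Rightarrow> ('k, ('k, 'a, 'b) tensor, 'c) tensor \<Rightarrow> ('k, 'a, ('k, 'b, 'c) tensor) tensor"
  where "tensor_assoc k A B C = (let T = tensor k A (tensor k B C) in
    tensor_lift k T (\<lambda>t c. tensor_lift k T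
      (\<lambda>a b. pure_tensor k A (tensor k B C) a (pure_tensor k B C b c)) t))"

definition tensor_assoc_inv ::
  "('k, 'r) ring_scheme \<Rightarrow> ('k, 'a, 'm) module_scheme \<Rightarrow> ('k, 'b, 'n) module_scheme
     \<Rightarrow> ('k, 'c, 'p) module_scheme
     \<Rightarrow> ('k, 'a, ('k, 'b, 'c) tensor) tensor \<Rightarrow> ('k, ('k, 'a, 'b) tensor, 'c) tensor"
  where "tensor_assoc_inv k A B C = (let T = tensor k (tensor k A B) C in
    tensor_lift k T (\<lambda>a t. tensor_lift k T
      (\<lambda>b c. pure_tensor k (tensor k A B) C (pure_tensor k A B a b) c) t))"

definition tensor_flip ::
  "('k, 'r) ring_scheme \<Rightarrow> ('k, 'a, 'm) module_scheme \<Rightarrow> ('k, 'b, 'n) module_scheme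
     \<Rightarrow> ('k, 'a, 'b) tensor \<Rightarrow> ('k, 'b, 'a) tensor"
  where "tensor_flip k A B = tensor_lift k (tensor k B A) (\<lambda>a b. pure_tensor k B A b a)"

definition scalars :: "('k, 'r) ring_scheme \<Rightarrow> ('k, 'k) module"
  where "scalars k =
    \<lparr>carrier = carrier k, mult = mult k, one = one k, zero = zero k, add = add k, smult = mult k\<rparr>"

definition tensor_lunit ::
  "('k, 'r) ring_scheme \<Rightarrow> ('k, 'a, 'm) module_scheme \<Rightarrow> ('k, 'k, 'a) tensor \<Rightarrow> 'a"
  where "tensor_lunit k A = tensor_lift k A (\<lambda>c a. c \<odot>\<^bsub>A\<^esub> a)"

definition tensor_runit ::
  "('k, 'r) ring_scheme \<Rightarrow> ('k, 'a, 'm) module_scheme \<Rightarrow> ('k, 'a, 'k) tensor \<Rightarrow> 'a"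
  where "tensor_runit k A = tensor_lift k A (\<lambda>a c. c \<odot>\<^bsub>A\<^esub> a)"

text \<open>For \<open>T : B \<otimes> C \<rightarrow> C \<otimes> B\<close>, the map
  \<open>I \<otimes> T \<otimes> I : (A \<otimes> B) \<otimes> (C \<otimes> D) \<rightarrow> (A \<otimes> C) \<otimes> (B \<otimes> D)\<close>.\<close>

definition tensor_middle ::
  "('k, 'r) ring_scheme \<Rightarrow> ('k, 'a, 'm) module_scheme \<Rightarrow> ('k, 'b, 'n) module_scheme
     \<Rightarrow> ('k, 'c, 'p) module_scheme \<Rightarrow> ('k, 'd, 'q) module_scheme
     \<Rightarrow> (('k, 'b, 'c) tensor \<Rightarrow> ('k, 'c, 'b) tensor)
     \<Rightarrow> ('k, ('k, 'a, 'b) tensor, ('k, 'c, 'd) tensor) tensor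
     \<Rightarrow> ('k, ('k, 'a, 'c) tensor, ('k, 'b, 'd) tensor) tensor"
  where "tensor_middle k A B C D T =
    tensor_assoc_inv k A C (tensor k B D) \<circ>
    tensor_map k A (tensor k C (tensor k B D)) id (tensor_assoc k C B D) \<circ>
    tensor_map k A (tensor k (tensor k C B) D) id (tensor_map k (tensor k C B) D T id) \<circ>
    tensor_map k A (tensor k (tensor k B C) D) id (tensor_assoc_inv k B C D) \<circ>
    tensor_assoc k A B (tensor k C D)"


section \<open>Algebras, coalgebras and bialgebras\<close>

record ('k, 'a) alg_coalg = "('k, 'a) module" +
  comult :: "'a \<Rightarrow> ('k, 'a, 'a) tensor"
  counit :: "'a \<Rightarrow> 'k"

text \<open>The library's locale \<^locale>\<open>algebra\<close> is for commutative algebras only.\<close>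

locale assoc_algebra = module k A + ring A for k and A (structure) +
  assumes smult_mult_left:
      "\<lbrakk>c \<in> carrier k; x \<in> carrier A; y \<in> carrier A\<rbrakk> \<Longrightarrow> (c \<odot> x) \<otimes> y = c \<odot> (x \<otimes> y)"
    and smult_mult_right:
      "\<lbrakk>c \<in> carrier k; x \<in> carrier A; y \<in> carrier A\<rbrakk> \<Longrightarrow> x \<otimes> (c \<odot> y) = c \<odot> (x \<otimes> y)"

definition algebra_maps ::
  "('k, 'r) ring_scheme \<Rightarrow> ('k, 'a, 'm) module_scheme \<Rightarrow> ('k, 'b, 'n) module_scheme \<Rightarrow> ('a \<Rightarrow> 'b) set"
  where "algebra_maps k A B = linear_maps k A B \<inter> ring_hom A B"

definition mult_map ::
  "('k, 'r) ring_scheme \<Rightarrow> ('k, 'a, 'm) module_scheme \<Rightarrow> ('k, 'a, 'a) tensor \<Rightarrow> 'a"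
  where "mult_map k A = tensor_lift k A (mult A)"

definition coassociative ::
  "('k, 'r) ring_scheme \<Rightarrow> ('k, 'a, 'm) module_scheme \<Rightarrow> ('a \<Rightarrow> ('k, 'a, 'a) tensor) \<Rightarrow> bool"
  where "coassociative k C \<Delta> \<longleftrightarrow> (\<forall>c\<in>carrier C.
    tensor_assoc k C C C (tensor_map k (tensor k C C) C \<Delta> id (\<Delta> c)) =
    tensor_map k C (tensor k C C) id \<Delta> (\<Delta> c))"

definition counital ::
  "('k, 'r) ring_scheme \<Rightarrow> ('k, 'a, 'm) module_scheme \<Rightarrow> ('a \<Rightarrow> ('k, 'a, 'a) tensor) \<Rightarrow> ('a \<Rightarrow> 'k) \<Rightarrow> bool"
  where "counital k C \<Delta> \<epsilon> \<longleftrightarrow> (\<forall>c\<in>carrier C.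
    tensor_lunit k C (tensor_map k (scalars k) C \<epsilon> id (\<Delta> c)) = c \<and>
    tensor_runit k C (tensor_map k C (scalars k) id \<epsilon> (\<Delta> c)) = c)"

locale coalgebra = module k C for k and C (structure) +
  assumes comult_linear: "comult C \<in> linear_maps k C (tensor k C C)"
    and counit_linear: "counit C \<in> linear_maps k C (scalars k)"
    and coassociative: "coassociative k C (comult C)"
    and counital: "counital k C (comult C) (counit C)"

definition coalgebra_maps ::
  "('k, 'r) ring_scheme \<Rightarrow> ('k, 'a, 'm) alg_coalg_scheme \<Rightarrow> ('k, 'b, 'n) alg_coalg_scheme
     \<Rightarrow> ('a \<Rightarrow> 'b) set"
  where "coalgebra_maps k C D = {f \<in> linear_maps k C D. \<forall>c\<in>carrier C.
    tensor_map k D D f f (comult C c) = comult D (f c) \<and> counit D (f c) = counit C c}"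

text \<open>The tensor product \<open>L \<otimes> H\<close> with multiplication
  \<open>(m\<^sub>L \<otimes> m\<^sub>H) \<circ> (I \<otimes> R \<otimes> I)\<close> and distinguished element \<open>1 \<otimes> 1\<close>. For \<open>R\<close> the flip this is
  the usual tensor product algebra.\<close>

definition smash_prod ::
  "('k, 'r) ring_scheme \<Rightarrow> ('k, 'l, 'm) module_scheme \<Rightarrow> ('k, 'h, 'n) module_scheme
     \<Rightarrow> (('k, 'h, 'l) tensor \<Rightarrow> ('k, 'l, 'h) tensor) \<Rightarrow> ('k, ('k, 'l, 'h) tensor) module"
  where "smash_prod k L H R = (let T = tensor k L H in T
    \<lparr>mult := (\<lambda>x y. tensor_map k L H (mult_map k L) (mult_map k H)
                (tensor_middle k L H L H R (pure_tensor k T T x y))),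
     one := pure_tensor k L H \<one>\<^bsub>L\<^esub> \<one>\<^bsub>H\<^esub>\<rparr>)"

locale bialgebra = assoc_algebra k K + coalgebra k K for k and K (structure) +
  assumes comult_algebra_map: "comult K \<in> algebra_maps k K (smash_prod k K K (tensor_flip k K K))"
    and counit_algebra_map: "counit K \<in> algebra_maps k K (scalars k)"

definition bialgebra_isos ::
  "('k, 'r) ring_scheme \<Rightarrow> ('k, 'a, 'm) alg_coalg_scheme \<Rightarrow> ('k, 'b, 'n) alg_coalg_scheme
     \<Rightarrow> ('a \<Rightarrow> 'b) set"
  where "bialgebra_isos k A B =
    {f \<in> algebra_maps k A B \<inter> coalgebra_maps k A B. bij_betw f (carrier A) (carrier B)}"


section \<open>Smash biproducts and factorisations\<close>

text \<open>The comultiplication \<open>(I \<otimes> W \<otimes> I) \<circ> (\<Delta>\<^sub>L \<otimes> \<Delta>\<^sub>H)\<close> and counit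
  \<open>\<epsilon>\<^sub>L \<otimes> \<epsilon>\<^sub>H\<close> on \<open>L \<otimes> H\<close>.\<close>

definition smash_comult ::
  "('k, 'r) ring_scheme \<Rightarrow> ('k, 'l, 'm) alg_coalg_scheme \<Rightarrow> ('k, 'h, 'n) alg_coalg_scheme
     \<Rightarrow> (('k, 'l, 'h) tensor \<Rightarrow> ('k, 'h, 'l) tensor)
     \<Rightarrow> ('k, 'l, 'h) tensor \<Rightarrow> ('k, ('k, 'l, 'h) tensor, ('k, 'l, 'h) tensor) tensor"
  where "smash_comult k L H W =
    tensor_middle k L L H H W \<circ> tensor_map k (tensor k L L) (tensor k H H) (comult L) (comult H)"

definition tensor_counit ::
  "('k, 'r) ring_scheme \<Rightarrow> ('k, 'l, 'm) alg_coalg_scheme \<Rightarrow> ('k, 'h, 'n) alg_coalg_scheme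
     \<Rightarrow> ('k, 'l, 'h) tensor \<Rightarrow> 'k"
  where "tensor_counit k L H =
    tensor_lunit k (scalars k) \<circ> tensor_map k (scalars k) (scalars k) (counit L) (counit H)"

definition smash_biprod ::
  "('k, 'r) ring_scheme \<Rightarrow> ('k, 'l, 'm) alg_coalg_scheme \<Rightarrow> ('k, 'h, 'n) alg_coalg_scheme
     \<Rightarrow> (('k, 'l, 'h) tensor \<Rightarrow> ('k, 'h, 'l) tensor) \<Rightarrow> (('k, 'h, 'l) tensor \<Rightarrow> ('k, 'l, 'h) tensor)
     \<Rightarrow> ('k, ('k, 'l, 'h) tensor) alg_coalg"
  where "smash_biprod k L H W R = (let P = smash_prod k L H R in
    \<lparr>carrier = carrier P, mult = mult P, one = one P, zero = zero P, add = add P, smult = smult P,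
     comult = smash_comult k L H W, counit = tensor_counit k L H\<rparr>)"

definition is_smash_product ::
  "('k, 'r) ring_scheme \<Rightarrow> ('k, 'l, 'm) module_scheme \<Rightarrow> ('k, 'h, 'n) module_scheme
     \<Rightarrow> (('k, 'h, 'l) tensor \<Rightarrow> ('k, 'l, 'h) tensor) \<Rightarrow> bool"
  where "is_smash_product k L H R \<longleftrightarrow> monoid (smash_prod k L H R)"

definition is_smash_coproduct ::
  "('k, 'r) ring_scheme \<Rightarrow> ('k, 'l, 'm) alg_coalg_scheme \<Rightarrow> ('k, 'h, 'n) alg_coalg_scheme
     \<Rightarrow> (('k, 'l, 'h) tensor \<Rightarrow> ('k, 'h, 'l) tensor) \<Rightarrow> bool"
  where "is_smash_coproduct k L H W \<longleftrightarrow>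
    coassociative k (tensor k L H) (smash_comult k L H W) \<and>
    counital k (tensor k L H) (smash_comult k L H W) (tensor_counit k L H)"

definition is_smash_biproduct ::
  "('k, 'r) ring_scheme \<Rightarrow> ('k, 'l, 'm) alg_coalg_scheme \<Rightarrow> ('k, 'h, 'n) alg_coalg_scheme
     \<Rightarrow> (('k, 'l, 'h) tensor \<Rightarrow> ('k, 'h, 'l) tensor) \<Rightarrow> (('k, 'h, 'l) tensor \<Rightarrow> ('k, 'l, 'h) tensor)
     \<Rightarrow> bool"
  where "is_smash_biproduct k L H W R \<longleftrightarrow>
    is_smash_product k L H R \<and> is_smash_coproduct k L H W \<and> bialgebra k (smash_biprod k L H W R)"

definition factorises ::
  "('k, 'r) ring_scheme \<Rightarrow> ('k, 'a, 'p) alg_coalg_scheme \<Rightarrow> ('k, 'l, 'm) alg_coalg_scheme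
     \<Rightarrow> ('k, 'h, 'n) alg_coalg_scheme \<Rightarrow> bool"
  where "factorises k K L H \<longleftrightarrow>
    (\<exists>i\<^sub>L \<in> algebra_maps k L K. \<exists>p\<^sub>L \<in> coalgebra_maps k K L.
     \<exists>i\<^sub>H \<in> algebra_maps k H K. \<exists>p\<^sub>H \<in> coalgebra_maps k K H.
       let \<zeta> = mult_map k K \<circ> tensor_map k K K i\<^sub>L i\<^sub>H;
           \<zeta>' = tensor_map k L H p\<^sub>L p\<^sub>H \<circ> comult K
       in bij_betw \<zeta> (carrier (tensor k L H)) (carrier K) \<and>
          (\<forall>t\<in>carrier (tensor k L H). \<zeta>' (\<zeta> t) = t) \<and>
          (\<forall>x\<in>carrier K. \<zeta> (\<zeta>' x) = x))"

end

(*
  Given a factorisation, put R = zeta^-1 m_K (i_H (x) i_L) and W = (p_H (x) p_L) Delta_K zeta. Then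
  zeta^-1 : K -> L (x) H respects multiplication and comultiplication for the structures defined by
  R and W, and all axioms of a bialgebra pass from K to its surjective image L (x) H.

  Given a smash biproduct B isomorphic to K, transport the maps l |-> l (x) 1, h |-> 1 (x) h,
  I (x) eps_H and eps_L (x) I along the isomorphism. The unit laws of B yield R(1 (x) l) = l (x) 1
  and R(h (x) 1) = 1 (x) h; dually, the counit laws yield (eps_H (x) I) W = I (x) eps_H and
  (I (x) eps_L) W = eps_L (x) I. Hence zeta becomes the inverse of the given isomorphism K -> B.
*)
theory Submission
  imports Defs
begin

section \<open>Linear maps and modules\<close>

text \<open>Tensor products are concrete sets of cosets, so Sweedler calculations cannot be carried
  out directly. Each identity is read as an equality of two linear or bilinear maps and tested on
  pure tensors, and maps are compared on carriers only.

  The obstacle is that coproducts and the values of \<open>R\<close> and \<open>W\<close> are not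
  pure. Two devices deal with it. \<open>tensor_sandwich\<close> puts an arbitrary middle tensor
  between two vectors and is linear in it. And an identity wanted only at an iterated coproduct is
  proved on the whole three-fold or four-fold tensor product first.

  For the comultiplication of the biproduct, \<open>W\<close> must meet a coproduct in the middle
  position, so \<open>(\<Delta> \<otimes> \<Delta>) \<Delta>\<close> is rewritten as a three-fold
  coproduct whose middle factor is split. In the converse direction \<open>W\<close> enters only
  through its two contractions: projecting both legs of the smash coproduct to \<open>L\<close>, to
  \<open>H\<close>, or to \<open>L\<close> and \<open>H\<close> evaluates at least one factor of
  each value of \<open>W\<close>.\<close>

lemma linear_mapsI:
  assumes "\<And>x. x \<in> carrier M \<Longrightarrow> f x \<in> carrier N"
    and "\<And>x y. x \<in> carrier M \<Longrightarrow> y \<in> carrier M \<Longrightarrow> f (x \<oplus>\<^bsub>M\<^esub> y) = f x \<oplus>\<^bsub>N\<^esub> f y"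
    and "\<And>c x. c \<in> carrier k \<Longrightarrow> x \<in> carrier M \<Longrightarrow> f (c \<odot>\<^bsub>M\<^esub> x) = c \<odot>\<^bsub>N\<^esub> f x"
  shows "f \<in> linear_maps k M N"
  using assms by (auto simp: linear_maps_def)

lemma linear_closed: "f \<in> linear_maps k M N \<Longrightarrow> x \<in> carrier M \<Longrightarrow> f x \<in> carrier N"
  by (auto simp: linear_maps_def)

lemma linear_add:
  "f \<in> linear_maps k M N \<Longrightarrow> x \<in> carrier M \<Longrightarrow> y \<in> carrier M \<Longrightarrow> f (x \<oplus>\<^bsub>M\<^esub> y) = f x \<oplus>\<^bsub>N\<^esub> f y"
  by (auto simp: linear_maps_def)

lemma linear_smult:
  "f \<in> linear_maps k M N \<Longrightarrow> c \<in> carrier k \<Longrightarrow> x \<in> carrier M \<Longrightarrow> f (c \<odot>\<^bsub>M\<^esub> x) = c \<odot>\<^bsub>N\<^esub> f x"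
  by (auto simp: linear_maps_def)

lemma linear_zero:
  assumes "module k M" "module k N" "f \<in> linear_maps k M N"
  shows "f \<zero>\<^bsub>M\<^esub> = \<zero>\<^bsub>N\<^esub>"
proof -
  interpret M: module k M by fact
  interpret N: module k N by fact
  have "f (\<zero>\<^bsub>k\<^esub> \<odot>\<^bsub>M\<^esub> \<zero>\<^bsub>M\<^esub>) = \<zero>\<^bsub>k\<^esub> \<odot>\<^bsub>N\<^esub> f \<zero>\<^bsub>M\<^esub>"
    using assms(3) by (intro linear_smult) auto
  then show ?thesis using linear_closed[OF assms(3)] by simp
qed

lemma linear_id: "id \<in> linear_maps k M M"
  by (rule linear_mapsI) auto

lemma linear_comp: "f \<in> linear_maps k N P \<Longrightarrow> g \<in> linear_maps k M N \<Longrightarrow> f \<circ> g \<in> linear_maps k M P"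
  by (rule linear_mapsI) (auto simp: linear_closed linear_add linear_smult)

lemma linear_cong:
  assumes "module k M" "f \<in> linear_maps k M N" "\<And>x. x \<in> carrier M \<Longrightarrow> g x = f x"
  shows "g \<in> linear_maps k M N"
proof -
  interpret M: module k M by fact
  show ?thesis using assms(2,3) by (intro linear_mapsI) (auto simp: linear_maps_def)
qed

lemma linear_inverse:
  assumes M: "module k M" and N: "module k N" and f: "f \<in> linear_maps k M N"
    and bij: "bij_betw f (carrier M) (carrier N)"
  shows "inv_into (carrier M) f \<in> linear_maps k N M"
proof -
  interpret M: module k M by fact
  interpret N: module k N by fact
  let ?g = "inv_into (carrier M) f"
  have g: "?g y \<in> carrier M" "f (?g y) = y" if "y \<in> carrier N" for y
    using bij that by (auto simp: bij_betw_def inv_into_into f_inv_into_f)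
  have gf: "?g (f x) = x" if "x \<in> carrier M" for x
    using bij that by (auto simp: bij_betw_def)
  show ?thesis
  proof (rule linear_mapsI)
    show "?g y \<in> carrier M" if "y \<in> carrier N" for y by (fact g[OF that])
    show "?g (x \<oplus>\<^bsub>N\<^esub> y) = ?g x \<oplus>\<^bsub>M\<^esub> ?g y" if "x \<in> carrier N" "y \<in> carrier N" for x y
      using gf[of "?g x \<oplus>\<^bsub>M\<^esub> ?g y"] that by (simp add: g linear_add[OF f])
    show "?g (c \<odot>\<^bsub>N\<^esub> x) = c \<odot>\<^bsub>M\<^esub> ?g x" if "c \<in> carrier k" "x \<in> carrier N" for c x
      using gf[of "c \<odot>\<^bsub>M\<^esub> ?g x"] that by (simp add: g linear_smult[OF f])
  qed
qed

lemma module_scalars: "cring k \<Longrightarrow> module k (scalars k)"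
proof -
  assume "cring k"
  then interpret cring k .
  show ?thesis
    by (intro moduleI abelian_groupI cring_axioms)
      (auto simp: scalars_def m_assoc l_distr r_distr a_ac intro: l_neg)
qed

text \<open>\<open>N\<close> is merely a record of operations, so the preservation of zero cannot be
  deduced from linearity and is assumed. Every module axiom for \<open>N\<close> is then the image
  of the same equation in \<open>M\<close>. Quotient modules, and later \<open>L \<otimes> H\<close>
  with its transported structure, are handled this way.\<close>

lemma module_surjective_image:
  assumes "module k M" and f: "f \<in> linear_maps k M N" and surj: "carrier N = f ` carrier M"
    and zero: "\<zero>\<^bsub>N\<^esub> = f \<zero>\<^bsub>M\<^esub>"
  shows "module k N"
proof -
  interpret M: module k M by fact
  note s = zero linear_add[OF f, symmetric] linear_smult[OF f, symmetric]
  show ?thesis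
  proof (intro moduleI abelian_groupI M.R.cring_axioms)
    fix x assume "x \<in> carrier N"
    then obtain x' where x': "x' \<in> carrier M" "x = f x'" using surj by auto
    then show "\<exists>y\<in>carrier N. y \<oplus>\<^bsub>N\<^esub> x = \<zero>\<^bsub>N\<^esub>"
      using surj by (auto simp: s M.M.l_neg intro!: bexI[of _ "\<ominus>\<^bsub>M\<^esub> x'"])
  qed (auto simp: surj s M.smult_l_distr M.smult_r_distr M.smult_assoc1 M.M.a_ac)
qed

lemma quotient_projection:
  assumes "module k M" and "submodule U k M"
  shows "(\<lambda>x. U +>\<^bsub>M\<^esub> x) \<in> linear_maps k M (quotient_module M U)" (is "?q \<in> _")
    and "module k (quotient_module M U)"
proof -
  interpret M: module k M by fact
  interpret U: submodule U k M by fact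
  interpret abelian_subgroup U M
    by (rule abelian_subgroupI3) (use U.subgroup_axioms M.M.abelian_group_axioms in \<open>auto simp: additive_subgroup_def\<close>)
  show q: "?q \<in> linear_maps k M (quotient_module M U)"
  proof (rule linear_mapsI)
    fix c x assume c: "c \<in> carrier k" "x \<in> carrier M"
    \<comment> \<open>Scalar multiplication of a coset is a union over its elements. All members of
      the union are this one coset, because \<open>c\<close> times an element of \<open>U\<close>
      stays in \<open>U\<close>.\<close>
    have "U +>\<^bsub>M\<^esub> (c \<odot>\<^bsub>M\<^esub> y) = U +>\<^bsub>M\<^esub> (c \<odot>\<^bsub>M\<^esub> x)" if y: "y \<in> U +>\<^bsub>M\<^esub> x" for y
    proof -
      obtain u where u: "u \<in> U" "y = u \<oplus>\<^bsub>M\<^esub> x"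
        using y by (auto simp: a_r_coset_def')
      have "c \<odot>\<^bsub>M\<^esub> y = c \<odot>\<^bsub>M\<^esub> u \<oplus>\<^bsub>M\<^esub> c \<odot>\<^bsub>M\<^esub> x" using u c by (simp add: M.smult_r_distr)
      then have "c \<odot>\<^bsub>M\<^esub> y \<in> U +>\<^bsub>M\<^esub> (c \<odot>\<^bsub>M\<^esub> x)" using u c by (auto simp: a_r_coset_def')
      then show ?thesis using c a_repr_independence'[of "c \<odot>\<^bsub>M\<^esub> y" "c \<odot>\<^bsub>M\<^esub> x"] by simp
    qed
    moreover have "x \<in> U +>\<^bsub>M\<^esub> x" using c by (simp add: a_rcos_self)
    ultimately have "(\<Union>y\<in>U +>\<^bsub>M\<^esub> x. U +>\<^bsub>M\<^esub> (c \<odot>\<^bsub>M\<^esub> y)) = U +>\<^bsub>M\<^esub> (c \<odot>\<^bsub>M\<^esub> x)"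
      by (intro SUP_eq_const) blast+
    then show "U +>\<^bsub>M\<^esub> (c \<odot>\<^bsub>M\<^esub> x) = c \<odot>\<^bsub>quotient_module M U\<^esub> (U +>\<^bsub>M\<^esub> x)"
      by (simp add: quotient_module_def)
  qed (auto simp: quotient_module_def A_RCOSETS_def' a_rcos_sum)
  show "module k (quotient_module M U)"
    by (rule module_surjective_image[OF assms(1) q])
      (auto simp: quotient_module_def A_RCOSETS_def' M.M.a_coset_add_zero[OF a_subset])
qed

lemma module_free_module:
  fixes S :: "'b set" and k :: "('a, 'r) ring_scheme"
  assumes "cring k" shows "module k (free_module k S)"
proof -
  interpret cring k by fact
  have fin: "finite {p. f p \<oplus>\<^bsub>k\<^esub> g p \<noteq> \<zero>\<^bsub>k\<^esub>}"
    if "finite {p. f p \<noteq> \<zero>\<^bsub>k\<^esub>}" "finite {p. g p \<noteq> \<zero>\<^bsub>k\<^esub>}" for f g :: "'b \<Rightarrow> 'a"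
    by (rule finite_subset[OF _ finite_UnI[OF that]]) auto
  have fin2: "finite {p. c \<otimes>\<^bsub>k\<^esub> f p \<noteq> \<zero>\<^bsub>k\<^esub>}"
    if "finite {p. f p \<noteq> \<zero>\<^bsub>k\<^esub>}" "c \<in> carrier k" for c and f :: "'b \<Rightarrow> 'a"
    by (rule finite_subset[OF _ that(1)]) (use that in auto)
  \<comment> \<open>Values outside \<open>S\<close> are zero, hence scalars too. With membership in
    \<open>carrier k\<close> at every point, the axioms can be checked pointwise.\<close>
  have F: "carrier (free_module k S) =
      {f. (\<forall>p. f p \<in> carrier k) \<and> (\<forall>p. p \<notin> S \<longrightarrow> f p = \<zero>\<^bsub>k\<^esub>) \<and> finite {p. f p \<noteq> \<zero>\<^bsub>k\<^esub>}}"
    unfolding free_module_def by auto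
  have ops: "f \<oplus>\<^bsub>free_module k S\<^esub> g = (\<lambda>p. f p \<oplus>\<^bsub>k\<^esub> g p)"
      "c \<odot>\<^bsub>free_module k S\<^esub> f = (\<lambda>p. c \<otimes>\<^bsub>k\<^esub> f p)" "\<zero>\<^bsub>free_module k S\<^esub> = (\<lambda>p. \<zero>\<^bsub>k\<^esub>)" for f g c
    by (simp_all add: free_module_def)
  show ?thesis
  proof (intro moduleI abelian_groupI cring_axioms)
    fix f assume "f \<in> carrier (free_module k S)"
    then have f: "\<forall>p. f p \<in> carrier k" "\<forall>p. p \<notin> S \<longrightarrow> f p = \<zero>\<^bsub>k\<^esub>" "finite {p. f p \<noteq> \<zero>\<^bsub>k\<^esub>}"
      by (auto simp: F)
    have "finite {p. \<ominus>\<^bsub>k\<^esub> f p \<noteq> \<zero>\<^bsub>k\<^esub>}" by (rule finite_subset[OF _ f(3)]) auto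
    then show "\<exists>g\<in>carrier (free_module k S). g \<oplus>\<^bsub>free_module k S\<^esub> f = \<zero>\<^bsub>free_module k S\<^esub>"
      using f by (intro bexI[of _ "\<lambda>p. \<ominus>\<^bsub>k\<^esub> f p"]) (simp_all add: F ops l_neg)
  qed (simp_all add: F ops fin fin2 m_assoc l_distr r_distr a_assoc a_comm a_lcomm)
qed

section \<open>Free modules\<close>

lemma free_gen_closed: "cring k \<Longrightarrow> p \<in> S \<Longrightarrow> free_gen k p \<in> carrier (free_module k S)"
proof -
  assume "cring k" "p \<in> S"
  interpret cring k by fact
  have "finite {q. free_gen k p q \<noteq> \<zero>\<^bsub>k\<^esub>}"
    by (rule finite_subset[of _ "{p}"]) (auto simp: free_gen_def split: if_splits)
  then show ?thesis using \<open>p \<in> S\<close> by (auto simp: free_module_def free_gen_def)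
qed

text \<open>Induction on a finite set containing the support: removing a point \<open>p\<close>
  subtracts a multiple of the generator at \<open>p\<close>. The finite set may contain points
  outside \<open>S\<close>, where \<open>f\<close> already vanishes.\<close>

lemma free_module_induct [consumes 2, case_names zero gen add smult]:
  assumes k: "cring k" and f: "f \<in> carrier (free_module k S)"
    and zero: "Q \<zero>\<^bsub>free_module k S\<^esub>"
    and gen: "\<And>p. p \<in> S \<Longrightarrow> Q (free_gen k p)"
    and add: "\<And>f g. f \<in> carrier (free_module k S) \<Longrightarrow> g \<in> carrier (free_module k S) \<Longrightarrow> Q f \<Longrightarrow> Q g
      \<Longrightarrow> Q (f \<oplus>\<^bsub>free_module k S\<^esub> g)"
    and smult: "\<And>c f. c \<in> carrier k \<Longrightarrow> f \<in> carrier (free_module k S) \<Longrightarrow> Q f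
      \<Longrightarrow> Q (c \<odot>\<^bsub>free_module k S\<^esub> f)"
  shows "Q f"
proof -
  interpret cring k by fact
  interpret F: module k "free_module k S" by (rule module_free_module) fact
  have "\<forall>f\<in>carrier (free_module k S). {p. f p \<noteq> \<zero>\<^bsub>k\<^esub>} \<subseteq> A \<longrightarrow> Q f" if "finite A" for A
    using that
  proof induction
    case empty
    then show ?case using zero by (auto simp: free_module_def simp flip: fun_eq_iff)
  next
    case (insert p A)
    show ?case
    proof (intro ballI impI)
      fix f assume f: "f \<in> carrier (free_module k S)" and sub: "{q. f q \<noteq> \<zero>\<^bsub>k\<^esub>} \<subseteq> insert p A"
      let ?g = "f(p := \<zero>\<^bsub>k\<^esub>)"
      have fc: "f q \<in> carrier k" for q
        using f by (cases "q \<in> S") (auto simp: free_module_def)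
      have "finite {q. ?g q \<noteq> \<zero>\<^bsub>k\<^esub>}"
        by (rule finite_subset[of _ "{q. f q \<noteq> \<zero>\<^bsub>k\<^esub>}"]) (use f in \<open>auto simp: free_module_def split: if_splits\<close>)
      then have g: "?g \<in> carrier (free_module k S)" using f by (auto simp: free_module_def)
      have "{q. ?g q \<noteq> \<zero>\<^bsub>k\<^esub>} \<subseteq> A" using sub by auto
      then have Qg: "Q ?g" using insert.IH g by blast
      show "Q f"
      proof (cases "p \<in> S")
        case True
        have "f = ?g \<oplus>\<^bsub>free_module k S\<^esub> f p \<odot>\<^bsub>free_module k S\<^esub> free_gen k p"
          using fc by (auto simp: free_module_def free_gen_def fun_eq_iff)
        then show ?thesis
          using add[OF g _ Qg smult[OF fc _ gen[OF True]]] free_gen_closed[OF k True] fc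
          by (metis F.smult_closed)
      next
        case False
        then have "?g = f" using f by (auto simp: free_module_def fun_eq_iff)
        then show ?thesis using Qg by simp
      qed
    qed
  qed
  then show ?thesis using f by (auto simp: free_module_def)
qed

text \<open>The sum inside \<open>tensor_lift\<close>, taken at a single representative before
  passing to cosets.\<close>

definition free_lift ::
  "('k, 'r) ring_scheme \<Rightarrow> ('k, 'c, 'm) module_scheme \<Rightarrow> ('p \<Rightarrow> 'c) \<Rightarrow> ('p \<Rightarrow> 'k) \<Rightarrow> 'c"
  where "free_lift k P b f = (\<Oplus>\<^bsub>P\<^esub>p\<in>{p. f p \<noteq> \<zero>\<^bsub>k\<^esub>}. f p \<odot>\<^bsub>P\<^esub> b p)"

text \<open>The supports of \<open>f\<close>, \<open>g\<close>, their sum and a scalar multiple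
  differ because of cancellation. Linearity needs all these sums over one common finite index
  set.\<close>

lemma free_lift_superset:
  assumes "module k P" and b: "b \<in> S \<rightarrow> carrier P" and f: "f \<in> carrier (free_module k S)"
    and A: "finite A" "{p. f p \<noteq> \<zero>\<^bsub>k\<^esub>} \<subseteq> A" "A \<subseteq> S"
  shows "free_lift k P b f = (\<Oplus>\<^bsub>P\<^esub>p\<in>A. f p \<odot>\<^bsub>P\<^esub> b p)"
proof -
  interpret P: module k P by fact
  have c: "(\<lambda>p. f p \<odot>\<^bsub>P\<^esub> b p) \<in> A \<rightarrow> carrier P"
    using f b A(3) by (auto simp: free_module_def intro!: P.smult_closed)
  show ?thesis unfolding free_lift_def
    by (rule P.M.add.finprod_mono_neutral_cong_left)
      (use A c b in \<open>auto simp: Pi_iff subset_iff intro!: P.smult_l_null\<close>)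
qed

lemma free_lift_linear:
  assumes "module k P" and b: "b \<in> S \<rightarrow> carrier P"
  shows "free_lift k P b \<in> linear_maps k (free_module k S) P"
proof -
  interpret P: module k P by fact
  interpret F: module k "free_module k S" by (rule module_free_module) (rule P.R.cring_axioms)
  let ?F = "free_module k S"
  let ?supp = "\<lambda>f. {p. f p \<noteq> \<zero>\<^bsub>k\<^esub>}"
  have supp: "finite (?supp f)" "?supp f \<subseteq> S" if "f \<in> carrier ?F" for f
    using that by (auto simp: free_module_def)
  have fc: "f p \<in> carrier k" if "f \<in> carrier ?F" for f p
    using that by (cases "p \<in> S") (auto simp: free_module_def)
  have bc: "b p \<in> carrier P" if "f \<in> carrier ?F" "p \<in> ?supp f" for f p
    using that b supp by auto
  show ?thesis
  proof (rule linear_mapsI)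
    fix f assume f: "f \<in> carrier ?F"
    note ff = fc[OF f] bc[OF f]
    show "free_lift k P b f \<in> carrier P"
      unfolding free_lift_def by (rule P.M.finsum_closed) (use ff in auto)
    show "free_lift k P b (c \<odot>\<^bsub>?F\<^esub> f) = c \<odot>\<^bsub>P\<^esub> free_lift k P b f" if c: "c \<in> carrier k" for c
    proof -
      have "free_lift k P b (c \<odot>\<^bsub>?F\<^esub> f) = (\<Oplus>\<^bsub>P\<^esub>p\<in>?supp f. (c \<odot>\<^bsub>?F\<^esub> f) p \<odot>\<^bsub>P\<^esub> b p)"
        by (rule free_lift_superset[OF assms F.smult_closed[OF c f]])
          (use c supp[OF f] in \<open>auto simp: free_module_def\<close>)
      also have "\<dots> = (\<Oplus>\<^bsub>P\<^esub>p\<in>?supp f. c \<odot>\<^bsub>P\<^esub> (f p \<odot>\<^bsub>P\<^esub> b p))"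
        by (rule P.M.finsum_cong')
          (use c ff in \<open>auto simp: free_module_def P.smult_assoc1 intro!: P.smult_closed\<close>)
      also have "\<dots> = c \<odot>\<^bsub>P\<^esub> free_lift k P b f"
        unfolding free_lift_def
        by (rule P.finsum_smult_ldistr[symmetric]) (use c ff supp[OF f] in auto)
      finally show ?thesis .
    qed
    fix g assume g: "g \<in> carrier ?F"
    let ?A = "?supp f \<union> ?supp g"
    have bA: "b p \<in> carrier P" if "p \<in> ?A" for p using that bc[OF f] bc[OF g] by auto
    have A: "finite ?A" "?A \<subseteq> S" using supp[OF f] supp[OF g] by auto
    have "free_lift k P b (f \<oplus>\<^bsub>?F\<^esub> g) = (\<Oplus>\<^bsub>P\<^esub>p\<in>?A. (f \<oplus>\<^bsub>?F\<^esub> g) p \<odot>\<^bsub>P\<^esub> b p)"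
      by (rule free_lift_superset[OF assms F.M.a_closed[OF f g] A(1) _ A(2)])
        (auto simp: free_module_def)
    also have "\<dots> = (\<Oplus>\<^bsub>P\<^esub>p\<in>?A. f p \<odot>\<^bsub>P\<^esub> b p \<oplus>\<^bsub>P\<^esub> g p \<odot>\<^bsub>P\<^esub> b p)"
      by (rule P.M.finsum_cong') (use fc[OF f] fc[OF g] bA in \<open>auto simp: free_module_def P.smult_l_distr\<close>)
    also have "\<dots> = (\<Oplus>\<^bsub>P\<^esub>p\<in>?A. f p \<odot>\<^bsub>P\<^esub> b p) \<oplus>\<^bsub>P\<^esub> (\<Oplus>\<^bsub>P\<^esub>p\<in>?A. g p \<odot>\<^bsub>P\<^esub> b p)"
      by (rule P.M.finsum_addf) (use fc[OF f] fc[OF g] bA in auto)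
    also have "(\<Oplus>\<^bsub>P\<^esub>p\<in>?A. f p \<odot>\<^bsub>P\<^esub> b p) = free_lift k P b f"
      by (rule free_lift_superset[OF assms f A(1) _ A(2), symmetric]) auto
    also have "(\<Oplus>\<^bsub>P\<^esub>p\<in>?A. g p \<odot>\<^bsub>P\<^esub> b p) = free_lift k P b g"
      by (rule free_lift_superset[OF assms g A(1) _ A(2), symmetric]) auto
    finally show "free_lift k P b (f \<oplus>\<^bsub>?F\<^esub> g) = free_lift k P b f \<oplus>\<^bsub>P\<^esub> free_lift k P b g" .
  qed
qed

lemma free_lift_gen:
  assumes "module k P" and b: "b \<in> S \<rightarrow> carrier P" and p: "p \<in> S"
  shows "free_lift k P b (free_gen k p) = b p"
proof -
  interpret P: module k P by fact
  have bp: "b p \<in> carrier P" using b p by auto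
  have "free_lift k P b (free_gen k p) = (\<Oplus>\<^bsub>P\<^esub>q\<in>{p}. free_gen k p q \<odot>\<^bsub>P\<^esub> b q)"
    by (rule free_lift_superset[OF assms(1) b free_gen_closed[OF P.R.cring_axioms p]])
      (use p in \<open>auto simp: free_gen_def split: if_splits\<close>)
  also have "\<dots> = b p" using bp by (simp add: free_gen_def)
  finally show ?thesis .
qed

section \<open>Tensor products\<close>

text \<open>Separate linearity is phrased with \<open>linear_maps\<close>, so that every fact about
  linear maps applies to either argument.\<close>

definition bilinear_maps ::
  "('k, 'r) ring_scheme \<Rightarrow> ('k, 'a, 'm) module_scheme \<Rightarrow> ('k, 'b, 'n) module_scheme
     \<Rightarrow> ('k, 'c, 'p) module_scheme \<Rightarrow> ('a \<Rightarrow> 'b \<Rightarrow> 'c) set"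
  where "bilinear_maps k M N P = {B. (\<forall>y\<in>carrier N. (\<lambda>x. B x y) \<in> linear_maps k M P) \<and>
    (\<forall>x\<in>carrier M. B x \<in> linear_maps k N P)}"

lemma bilinear_mapsI:
  assumes "\<And>y. y \<in> carrier N \<Longrightarrow> (\<lambda>x. B x y) \<in> linear_maps k M P"
    and "\<And>x. x \<in> carrier M \<Longrightarrow> B x \<in> linear_maps k N P"
  shows "B \<in> bilinear_maps k M N P"
  using assms by (auto simp: bilinear_maps_def)

lemma bilinear_left: "B \<in> bilinear_maps k M N P \<Longrightarrow> y \<in> carrier N \<Longrightarrow> (\<lambda>x. B x y) \<in> linear_maps k M P"
  by (auto simp: bilinear_maps_def)

lemma bilinear_right: "B \<in> bilinear_maps k M N P \<Longrightarrow> x \<in> carrier M \<Longrightarrow> B x \<in> linear_maps k N P"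
  by (auto simp: bilinear_maps_def)

lemma bilinear_closed:
  "B \<in> bilinear_maps k M N P \<Longrightarrow> x \<in> carrier M \<Longrightarrow> y \<in> carrier N \<Longrightarrow> B x y \<in> carrier P"
  by (blast dest: bilinear_right linear_closed)

lemma tensor_relations_closed:
  assumes "module k M" "module k N"
  shows "tensor_relations k M N \<subseteq> carrier (free_module k (carrier M \<times> carrier N))"
proof -
  interpret M: module k M by fact
  interpret N: module k N by fact
  interpret F: module k "free_module k (carrier M \<times> carrier N)"
    by (rule module_free_module) (rule M.R.cring_axioms)
  have g: "free_gen k p \<in> carrier (free_module k (carrier M \<times> carrier N))"
    if "p \<in> carrier M \<times> carrier N" for p
    using free_gen_closed[OF M.R.cring_axioms that] .
  show ?thesis
    unfolding tensor_relations_def Let_def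
    by (safe; intro F.M.minus_closed F.M.a_closed F.smult_closed g; simp)
qed

lemma tensor_relations_subset_kernel: "tensor_relations k M N \<subseteq> tensor_kernel k M N"
  unfolding tensor_kernel_def by (rule hull_subset)

lemma tensor_kernel_minimal:
  "submodule U k (free_module k (carrier M \<times> carrier N)) \<Longrightarrow> tensor_relations k M N \<subseteq> U
    \<Longrightarrow> tensor_kernel k M N \<subseteq> U"
  unfolding tensor_kernel_def by (rule hull_minimal)

text \<open>The \<open>hull\<close> is the intersection of all submodules containing the relations.
  The family is not empty, since the whole free module belongs to it, and submodules are stable
  under such intersections.\<close>

lemma submodule_tensor_kernel:
  assumes "module k M" "module k N"
  shows "submodule (tensor_kernel k M N) k (free_module k (carrier M \<times> carrier N))" (is "submodule _ k ?F")
proof -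
  interpret M: module k M by fact
  interpret F: module k ?F by (rule module_free_module) (rule M.R.cring_axioms)
  let ?C = "{U. submodule U k ?F \<and> tensor_relations k M N \<subseteq> U}"
  have C: "carrier ?F \<in> ?C"
    using F.carrier_is_submodule tensor_relations_closed[OF assms] by auto
  have "submodule (\<Inter>?C) k ?F"
  proof (rule F.submoduleI)
    show "\<Inter>?C \<subseteq> carrier ?F" using C by (rule Inter_lower)
    show "\<zero>\<^bsub>?F\<^esub> \<in> \<Inter>?C"
      by (auto dest!: submodule.axioms(1) dest: subgroup.one_closed)
  qed (blast dest: F.submoduleE)+
  then show ?thesis by (simp add: tensor_kernel_def hull_def)
qed

lemma module_tensor: "module k M \<Longrightarrow> module k N \<Longrightarrow> module k (tensor k M N)"
  unfolding tensor_def
  by (rule quotient_projection(2)) (auto intro: module_free_module submodule_tensor_kernel module.axioms)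

lemma tensor_projection:
  assumes "module k M" "module k N"
  shows "(\<lambda>f. tensor_kernel k M N +>\<^bsub>free_module k (carrier M \<times> carrier N)\<^esub> f)
    \<in> linear_maps k (free_module k (carrier M \<times> carrier N)) (tensor k M N)"
  unfolding tensor_def
  by (rule quotient_projection(1)) (use assms in \<open>auto intro: module_free_module submodule_tensor_kernel module.axioms\<close>)

lemma pure_tensor_bilinear:
  assumes M: "module k M" and N: "module k N"
  shows "pure_tensor k M N \<in> bilinear_maps k M N (tensor k M N)"
proof -
  interpret M: module k M by fact
  interpret N: module k N by fact
  let ?F = "free_module k (carrier M \<times> carrier N)" and ?U = "tensor_kernel k M N"
  let ?T = "tensor k M N" and ?g = "\<lambda>x y. free_gen k (x, y)"
  interpret F: module k ?F by (rule module_free_module) (rule M.R.cring_axioms)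
  interpret U: submodule ?U k ?F using M N by (rule submodule_tensor_kernel)
  interpret U: abelian_subgroup ?U ?F
    by (rule abelian_subgroupI3)
      (use U.subgroup_axioms F.M.abelian_group_axioms in \<open>auto simp: additive_subgroup_def\<close>)
  note q = tensor_projection[OF M N]
  have g: "?g x y \<in> carrier ?F" if "x \<in> carrier M" "y \<in> carrier N" for x y
    using that by (intro free_gen_closed[OF M.R.cring_axioms]) simp
  have p: "pure_tensor k M N x y = ?U +>\<^bsub>?F\<^esub> ?g x y" for x y by (simp add: pure_tensor_def)
  \<comment> \<open>Two elements of the free module have the same coset as soon as their difference
    is one of the listed relations. Each of the four bilinearity laws below is one such
    relation.\<close>
  have eq: "?U +>\<^bsub>?F\<^esub> f = ?U +>\<^bsub>?F\<^esub> h"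
    if "f \<ominus>\<^bsub>?F\<^esub> h \<in> tensor_relations k M N" "f \<in> carrier ?F" "h \<in> carrier ?F" for f h
  proof -
    have "f \<ominus>\<^bsub>?F\<^esub> h \<in> ?U" using that(1) tensor_relations_subset_kernel by blast
    moreover have "f = (f \<ominus>\<^bsub>?F\<^esub> h) \<oplus>\<^bsub>?F\<^esub> h"
      using that by (simp add: F.M.minus_eq F.M.a_assoc F.M.l_neg)
    ultimately have "f \<in> ?U +>\<^bsub>?F\<^esub> h" by (auto simp: a_r_coset_def')
    then show ?thesis using U.a_repr_independence'[of f h] that by simp
  qed
  have p_closed: "pure_tensor k M N x y \<in> carrier ?T" if "x \<in> carrier M" "y \<in> carrier N" for x y
    using linear_closed[OF q] g that by (simp add: p)
  show ?thesis
  proof (intro bilinear_mapsI linear_mapsI p_closed)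
    fix x x' y assume x: "x \<in> carrier M" "x' \<in> carrier M" "y \<in> carrier N"
    have "?g (x \<oplus>\<^bsub>M\<^esub> x') y \<ominus>\<^bsub>?F\<^esub> (?g x y \<oplus>\<^bsub>?F\<^esub> ?g x' y) \<in> tensor_relations k M N"
      unfolding tensor_relations_def Let_def using x by blast
    from eq[OF this] show "pure_tensor k M N (x \<oplus>\<^bsub>M\<^esub> x') y
        = pure_tensor k M N x y \<oplus>\<^bsub>?T\<^esub> pure_tensor k M N x' y"
      using x by (simp add: p g linear_add[OF q, symmetric])
  next
    fix x y y' assume x: "x \<in> carrier M" "y \<in> carrier N" "y' \<in> carrier N"
    have "?g x (y \<oplus>\<^bsub>N\<^esub> y') \<ominus>\<^bsub>?F\<^esub> (?g x y \<oplus>\<^bsub>?F\<^esub> ?g x y') \<in> tensor_relations k M N"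
      unfolding tensor_relations_def Let_def using x by blast
    from eq[OF this] show "pure_tensor k M N x (y \<oplus>\<^bsub>N\<^esub> y')
        = pure_tensor k M N x y \<oplus>\<^bsub>?T\<^esub> pure_tensor k M N x y'"
      using x by (simp add: p g linear_add[OF q, symmetric])
  next
    fix c x y assume x: "c \<in> carrier k" "x \<in> carrier M" "y \<in> carrier N"
    have "?g (c \<odot>\<^bsub>M\<^esub> x) y \<ominus>\<^bsub>?F\<^esub> (c \<odot>\<^bsub>?F\<^esub> ?g x y) \<in> tensor_relations k M N"
      unfolding tensor_relations_def Let_def using x by blast
    from eq[OF this] show "pure_tensor k M N (c \<odot>\<^bsub>M\<^esub> x) y = c \<odot>\<^bsub>?T\<^esub> pure_tensor k M N x y"
      using x by (simp add: p g linear_smult[OF q, symmetric])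
    have "?g x (c \<odot>\<^bsub>N\<^esub> y) \<ominus>\<^bsub>?F\<^esub> (c \<odot>\<^bsub>?F\<^esub> ?g x y) \<in> tensor_relations k M N"
      unfolding tensor_relations_def Let_def using x by blast
    from eq[OF this] show "pure_tensor k M N x (c \<odot>\<^bsub>N\<^esub> y) = c \<odot>\<^bsub>?T\<^esub> pure_tensor k M N x y"
      using x by (simp add: p g linear_smult[OF q, symmetric])
  qed
qed

lemma pure_tensor_closed:
  "module k M \<Longrightarrow> module k N \<Longrightarrow> x \<in> carrier M \<Longrightarrow> y \<in> carrier N
    \<Longrightarrow> pure_tensor k M N x y \<in> carrier (tensor k M N)"
  using bilinear_closed[OF pure_tensor_bilinear] .

text \<open>The pure case absorbs scalars and zero: \<open>c\<close> times
  \<open>x \<otimes> y\<close> is \<open>(c x) \<otimes> y\<close>, and zero is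
  \<open>\<zero> \<otimes> \<zero>\<close>. Hence finite sums of pure tensors already exhaust the
  tensor product.\<close>

lemma tensor_induct [consumes 3, case_names pure add]:
  assumes M: "module k M" and N: "module k N" and t: "t \<in> carrier (tensor k M N)"
    and pure: "\<And>x y. x \<in> carrier M \<Longrightarrow> y \<in> carrier N \<Longrightarrow> Q (pure_tensor k M N x y)"
    and add: "\<And>s t. s \<in> carrier (tensor k M N) \<Longrightarrow> t \<in> carrier (tensor k M N) \<Longrightarrow> Q s \<Longrightarrow> Q t
      \<Longrightarrow> Q (s \<oplus>\<^bsub>tensor k M N\<^esub> t)"
  shows "Q t"
proof -
  interpret M: module k M by fact
  interpret N: module k N by fact
  let ?F = "free_module k (carrier M \<times> carrier N)"
  let ?q = "\<lambda>f. tensor_kernel k M N +>\<^bsub>?F\<^esub> f"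
  let ?T = "tensor k M N"
  interpret F: module k ?F by (rule module_free_module) (rule M.R.cring_axioms)
  interpret T: module k ?T using M N by (rule module_tensor)
  note q = tensor_projection[OF M N]
  have p: "?q (free_gen k (x, y)) = pure_tensor k M N x y" for x y by (simp add: pure_tensor_def)
  have zero: "pure_tensor k M N \<zero>\<^bsub>M\<^esub> \<zero>\<^bsub>N\<^esub> = \<zero>\<^bsub>?T\<^esub>"
    using linear_zero[OF N T.module_axioms bilinear_right[OF pure_tensor_bilinear[OF M N]]] by simp
  have Q0: "Q \<zero>\<^bsub>?T\<^esub>" using pure[of "\<zero>\<^bsub>M\<^esub>" "\<zero>\<^bsub>N\<^esub>"] zero by simp
  have sm: "pure_tensor k M N (c \<odot>\<^bsub>M\<^esub> x) y = c \<odot>\<^bsub>?T\<^esub> pure_tensor k M N x y"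
    if "c \<in> carrier k" "x \<in> carrier M" "y \<in> carrier N" for c x y
    using linear_smult[OF bilinear_left[OF pure_tensor_bilinear[OF M N]]] that by simp
  \<comment> \<open>The claim is strengthened to all scalar multiples, so that it survives the
    scalar step of the induction on the free module. The scalar one gives back the original
    claim.\<close>
  have "\<forall>c\<in>carrier k. Q (c \<odot>\<^bsub>?T\<^esub> ?q f)" if "f \<in> carrier ?F" for f
    using M.R.cring_axioms that
  proof (induction rule: free_module_induct)
    case zero
    show ?case using linear_zero[OF F.module_axioms T.module_axioms q] Q0 by simp
  next
    case (gen p)
    then show ?case using pure by (cases p) (auto simp: p simp flip: sm)
  next
    case (add f g)
    then show ?case using linear_closed[OF q]
      by (auto simp: linear_add[OF q] T.smult_r_distr intro!: assms(5))
  next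
    case (smult d f)
    then show ?case using linear_closed[OF q]
      by (auto simp: linear_smult[OF q] simp flip: T.smult_assoc1)
  qed
  moreover obtain f where "f \<in> carrier ?F" "t = ?q f"
    using t by (auto simp: tensor_def quotient_module_def A_RCOSETS_def')
  ultimately have "Q (\<one>\<^bsub>k\<^esub> \<odot>\<^bsub>?T\<^esub> t)" by blast
  then show ?thesis using t by simp
qed

section \<open>The universal property of the tensor product\<close>

lemma tensor_ext:
  assumes "module k M" "module k N" "module k P"
    and f: "f \<in> linear_maps k (tensor k M N) P" and g: "g \<in> linear_maps k (tensor k M N) P"
    and "\<And>x y. x \<in> carrier M \<Longrightarrow> y \<in> carrier N \<Longrightarrow> f (pure_tensor k M N x y) = g (pure_tensor k M N x y)"
    and "t \<in> carrier (tensor k M N)"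
  shows "f t = g t"
  using assms(1,2,7)
proof (induction rule: tensor_induct)
  case (pure x y) then show ?case by (fact assms(6))
next
  case (add s t) then show ?case by (simp add: linear_add[OF f] linear_add[OF g])
qed

text \<open>Well-definedness of \<open>tensor_lift\<close>: the linear extension of \<open>B\<close>
  to the free module vanishes on the relations, hence on the submodule they generate. It is
  therefore constant on each coset, and \<open>the_elem\<close> returns that constant.\<close>

lemma tensor_lift_projection:
  assumes M: "module k M" and N: "module k N" and P: "module k P" and B: "B \<in> bilinear_maps k M N P"
    and f: "f \<in> carrier (free_module k (carrier M \<times> carrier N))"
  shows "tensor_lift k P B (tensor_kernel k M N +>\<^bsub>free_module k (carrier M \<times> carrier N)\<^esub> f)
    = free_lift k P (\<lambda>p. B (fst p) (snd p)) f"
proof -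
  interpret M: module k M by fact
  interpret N: module k N by fact
  interpret P: module k P by fact
  let ?F = "free_module k (carrier M \<times> carrier N)" and ?U = "tensor_kernel k M N"
  let ?l = "free_lift k P (\<lambda>p. B (fst p) (snd p))"
  interpret F: module k ?F by (rule module_free_module) (rule M.R.cring_axioms)
  interpret U: submodule ?U k ?F using M N by (rule submodule_tensor_kernel)
  have b: "(\<lambda>p. B (fst p) (snd p)) \<in> carrier M \<times> carrier N \<rightarrow> carrier P"
    using bilinear_closed[OF B] by auto
  note l = free_lift_linear[OF P b]
  have lg: "?l (free_gen k (x, y)) = B x y" if "x \<in> carrier M" "y \<in> carrier N" for x y
    using free_lift_gen[OF P b] that by auto
  have g: "free_gen k (x, y) \<in> carrier ?F" if "x \<in> carrier M" "y \<in> carrier N" for x y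
    using that by (intro free_gen_closed[OF M.R.cring_axioms]) simp
  let ?K = "{f \<in> carrier ?F. ?l f = \<zero>\<^bsub>P\<^esub>}"
  have neg: "?l (\<ominus>\<^bsub>?F\<^esub> f) = \<ominus>\<^bsub>P\<^esub> ?l f" if "f \<in> carrier ?F" for f
  proof -
    have "\<ominus>\<^bsub>?F\<^esub> f = (\<ominus>\<^bsub>k\<^esub> \<one>\<^bsub>k\<^esub>) \<odot>\<^bsub>?F\<^esub> f" using that by (simp add: F.smult_l_minus)
    then show ?thesis using that linear_closed[OF l that]
      by (simp add: linear_smult[OF l] P.smult_l_minus)
  qed
  have K: "submodule ?K k ?F"
    using linear_zero[OF F.module_axioms P l]
    by (intro F.submoduleI) (auto simp: neg linear_add[OF l] linear_smult[OF l])
  have diff: "f \<ominus>\<^bsub>?F\<^esub> h \<in> ?K" if "f \<in> carrier ?F" "h \<in> carrier ?F" "?l f = ?l h" for f h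
    using that linear_closed[OF l] by (simp add: F.M.minus_eq linear_add[OF l] neg P.M.r_neg)
  have "tensor_relations k M N \<subseteq> ?K"
    unfolding tensor_relations_def Let_def
    apply safe
       apply (rule diff[THEN CollectD, THEN conjunct1] diff[THEN CollectD, THEN conjunct2]; simp add: g lg linear_add[OF l] linear_smult[OF l] linear_add[OF bilinear_left[OF B]] linear_add[OF bilinear_right[OF B]] linear_smult[OF bilinear_left[OF B]] linear_smult[OF bilinear_right[OF B]])+
    done
  then have U: "?U \<subseteq> ?K" by (rule tensor_kernel_minimal[OF K])
  have "?l h = ?l f" if h: "h \<in> ?U +>\<^bsub>?F\<^esub> f" for h
  proof -
    obtain u where "u \<in> ?U" "h = u \<oplus>\<^bsub>?F\<^esub> f" using h by (auto simp: a_r_coset_def')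
    then show ?thesis using U f linear_closed[OF l f] by (auto simp: linear_add[OF l])
  qed
  moreover have "f \<in> ?U +>\<^bsub>?F\<^esub> f"
    using f U.one_closed by (auto simp: a_r_coset_def' intro!: bexI[of _ "\<zero>\<^bsub>?F\<^esub>"])
  ultimately have "?l ` (?U +>\<^bsub>?F\<^esub> f) = {?l f}" by blast
  then show ?thesis by (simp add: tensor_lift_def free_lift_def)
qed

lemma tensor_lift_linear:
  assumes M: "module k M" and N: "module k N" and P: "module k P" and B: "B \<in> bilinear_maps k M N P"
  shows "tensor_lift k P B \<in> linear_maps k (tensor k M N) P"
proof -
  interpret M: module k M by fact
  let ?F = "free_module k (carrier M \<times> carrier N)" and ?U = "tensor_kernel k M N"
  let ?l = "free_lift k P (\<lambda>p. B (fst p) (snd p))"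
  interpret F: module k ?F by (rule module_free_module) (rule M.R.cring_axioms)
  have b: "(\<lambda>p. B (fst p) (snd p)) \<in> carrier M \<times> carrier N \<rightarrow> carrier P"
    using bilinear_closed[OF B] by auto
  note l = free_lift_linear[OF P b] and q = tensor_projection[OF M N]
  note lift = tensor_lift_projection[OF M N P B]
  have surj: "\<exists>f\<in>carrier ?F. t = ?U +>\<^bsub>?F\<^esub> f" if "t \<in> carrier (tensor k M N)" for t
    using that by (auto simp: tensor_def quotient_module_def A_RCOSETS_def')
  show ?thesis
  proof (rule linear_mapsI)
    fix t assume "t \<in> carrier (tensor k M N)"
    then obtain f where f: "f \<in> carrier ?F" "t = ?U +>\<^bsub>?F\<^esub> f" using surj by blast
    show "tensor_lift k P B t \<in> carrier P" using f linear_closed[OF l] by (simp add: lift)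
    show "tensor_lift k P B (c \<odot>\<^bsub>tensor k M N\<^esub> t) = c \<odot>\<^bsub>P\<^esub> tensor_lift k P B t" if "c \<in> carrier k" for c
      using f that by (simp add: lift linear_smult[OF l] flip: linear_smult[OF q])
    fix s assume "s \<in> carrier (tensor k M N)"
    then obtain h where h: "h \<in> carrier ?F" "s = ?U +>\<^bsub>?F\<^esub> h" using surj by blast
    show "tensor_lift k P B (t \<oplus>\<^bsub>tensor k M N\<^esub> s) = tensor_lift k P B t \<oplus>\<^bsub>P\<^esub> tensor_lift k P B s"
      using f h by (simp add: lift linear_add[OF l] flip: linear_add[OF q])
  qed
qed

lemma tensor_lift_pure:
  assumes M: "module k M" and N: "module k N" and P: "module k P" and B: "B \<in> bilinear_maps k M N P"
    and x: "x \<in> carrier M" "y \<in> carrier N"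
  shows "tensor_lift k P B (pure_tensor k M N x y) = B x y"
proof -
  interpret M: module k M by fact
  have b: "(\<lambda>p. B (fst p) (snd p)) \<in> carrier M \<times> carrier N \<rightarrow> carrier P"
    using bilinear_closed[OF B] by auto
  show ?thesis
    using tensor_lift_projection[OF M N P B free_gen_closed[OF M.R.cring_axioms]]
      free_lift_gen[OF P b] x by (simp add: pure_tensor_def)
qed

text \<open>For fixed \<open>c\<close> both maps are linear on \<open>A \<otimes> B\<close>, so the
  test on pure tensors can be iterated.\<close>

lemma tensor_ext_left:
  assumes "module k A" "module k B" "module k C" "module k P"
    and f: "f \<in> linear_maps k (tensor k (tensor k A B) C) P" and g: "g \<in> linear_maps k (tensor k (tensor k A B) C) P"
    and eq: "\<And>a b c. a \<in> carrier A \<Longrightarrow> b \<in> carrier B \<Longrightarrow> c \<in> carrier C \<Longrightarrow>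
      f (pure_tensor k (tensor k A B) C (pure_tensor k A B a b) c)
      = g (pure_tensor k (tensor k A B) C (pure_tensor k A B a b) c)"
    and t: "t \<in> carrier (tensor k (tensor k A B) C)"
  shows "f t = g t"
proof (rule tensor_ext[OF module_tensor[OF assms(1,2)] assms(3,4) f g _ t])
  fix s c assume s: "s \<in> carrier (tensor k A B)" and c: "c \<in> carrier C"
  note p = bilinear_left[OF pure_tensor_bilinear[OF module_tensor[OF assms(1,2)] assms(3)] c]
  show "f (pure_tensor k (tensor k A B) C s c) = g (pure_tensor k (tensor k A B) C s c)"
    using tensor_ext[OF assms(1,2,4) linear_comp[OF f p] linear_comp[OF g p] _ s] eq c
    by simp
qed

lemma tensor_ext_right:
  assumes "module k A" "module k B" "module k C" "module k P"
    and f: "f \<in> linear_maps k (tensor k A (tensor k B C)) P" and g: "g \<in> linear_maps k (tensor k A (tensor k B C)) P"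
    and eq: "\<And>a b c. a \<in> carrier A \<Longrightarrow> b \<in> carrier B \<Longrightarrow> c \<in> carrier C \<Longrightarrow>
      f (pure_tensor k A (tensor k B C) a (pure_tensor k B C b c))
      = g (pure_tensor k A (tensor k B C) a (pure_tensor k B C b c))"
    and t: "t \<in> carrier (tensor k A (tensor k B C))"
  shows "f t = g t"
proof (rule tensor_ext[OF assms(1) module_tensor[OF assms(2,3)] assms(4) f g _ t])
  fix s a assume s: "s \<in> carrier (tensor k B C)" and a: "a \<in> carrier A"
  note p = bilinear_right[OF pure_tensor_bilinear[OF assms(1) module_tensor[OF assms(2,3)]] a]
  show "f (pure_tensor k A (tensor k B C) a s) = g (pure_tensor k A (tensor k B C) a s)"
    using tensor_ext[OF assms(2,3,4) linear_comp[OF f p] linear_comp[OF g p] _ s] eq a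
    by simp
qed

lemma linear_comp_bilinear:
  "h \<in> linear_maps k P Q \<Longrightarrow> B \<in> bilinear_maps k M N P \<Longrightarrow> (\<lambda>x y. h (B x y)) \<in> bilinear_maps k M N Q"
  unfolding bilinear_maps_def using linear_comp[of h k P Q _ M] linear_comp[of h k P Q _ N] by (auto simp: comp_def)

lemma bilinear_comp:
  assumes B: "B \<in> bilinear_maps k P Q Z" and f: "f \<in> linear_maps k M P" and g: "g \<in> linear_maps k N Q"
  shows "(\<lambda>x y. B (f x) (g y)) \<in> bilinear_maps k M N Z"
proof (rule bilinear_mapsI)
  show "(\<lambda>x. B (f x) (g y)) \<in> linear_maps k M Z" if "y \<in> carrier N" for y
    using linear_comp[OF bilinear_left[OF B linear_closed[OF g that]] f] by (simp add: comp_def)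
  show "(\<lambda>y. B (f x) (g y)) \<in> linear_maps k N Z" if "x \<in> carrier M" for x
    using linear_comp[OF bilinear_right[OF B linear_closed[OF f that]] g] by (simp add: comp_def)
qed

lemma bilinear_swap: "B \<in> bilinear_maps k M N P \<Longrightarrow> (\<lambda>y x. B x y) \<in> bilinear_maps k N M P"
  by (auto simp: bilinear_maps_def)

lemma bilinear_scalar: "module k A \<Longrightarrow> (\<odot>\<^bsub>A\<^esub>) \<in> bilinear_maps k (scalars k) A A"
proof -
  assume "module k A"
  then interpret A: module k A .
  show ?thesis
    by (intro bilinear_mapsI linear_mapsI)
      (auto simp: scalars_def A.smult_l_distr A.smult_r_distr A.R.m_comm simp flip: A.smult_assoc1)
qed

text \<open>The associativity maps nest two lifts, and the outer variable enters the inner lift as a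
  parameter of its bilinear map. Linearity in that parameter is not visible from the lift itself;
  induction on \<open>t\<close> reduces it to pure tensors and sums.\<close>

lemma tensor_lift_linear_parameter:
  assumes M: "module k M" and N: "module k N" and P: "module k P" and C: "module k C"
    and B: "\<And>c. c \<in> carrier C \<Longrightarrow> B c \<in> bilinear_maps k M N P"
    and lin: "\<And>x y. x \<in> carrier M \<Longrightarrow> y \<in> carrier N \<Longrightarrow> (\<lambda>c. B c x y) \<in> linear_maps k C P"
    and t: "t \<in> carrier (tensor k M N)"
  shows "(\<lambda>c. tensor_lift k P (B c) t) \<in> linear_maps k C P"
proof -
  interpret P: module k P by fact
  interpret C: module k C by fact
  show ?thesis
    using M N t
  proof (induction rule: tensor_induct)
    case (pure x y)
    show ?case
      by (rule linear_cong[OF C lin[OF pure]]) (simp add: tensor_lift_pure[OF M N P B] pure)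
  next
    case (add s t)
    let ?l = "\<lambda>c. tensor_lift k P (B c)"
    have "(\<lambda>c. ?l c s \<oplus>\<^bsub>P\<^esub> ?l c t) \<in> linear_maps k C P"
      using linear_closed[OF add.IH(1)] linear_closed[OF add.IH(2)]
      by (intro linear_mapsI)
        (simp_all add: linear_add[OF add.IH(1)] linear_add[OF add.IH(2)]
          linear_smult[OF add.IH(1)] linear_smult[OF add.IH(2)] P.smult_r_distr P.M.a_ac)
    then show ?case
      by (rule linear_cong[OF C]) (simp add: linear_add[OF tensor_lift_linear[OF M N P B]] add)
  qed
qed

section \<open>Tensor products of linear maps and the canonical isomorphisms\<close>

lemma tensor_map_bilinear:
  "f \<in> linear_maps k M P \<Longrightarrow> g \<in> linear_maps k N Q \<Longrightarrow> module k P \<Longrightarrow> module k Q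
    \<Longrightarrow> (\<lambda>x y. pure_tensor k P Q (f x) (g y)) \<in> bilinear_maps k M N (tensor k P Q)"
  by (rule bilinear_comp[OF pure_tensor_bilinear])

lemma tensor_map_linear:
  "f \<in> linear_maps k M P \<Longrightarrow> g \<in> linear_maps k N Q
    \<Longrightarrow> module k M \<Longrightarrow> module k N \<Longrightarrow> module k P \<Longrightarrow> module k Q
    \<Longrightarrow> tensor_map k P Q f g \<in> linear_maps k (tensor k M N) (tensor k P Q)"
  unfolding tensor_map_def by (intro tensor_lift_linear tensor_map_bilinear module_tensor)

lemma tensor_map_pure:
  "f \<in> linear_maps k M P \<Longrightarrow> g \<in> linear_maps k N Q
    \<Longrightarrow> module k M \<Longrightarrow> module k N \<Longrightarrow> module k P \<Longrightarrow> module k Q \<Longrightarrow> x \<in> carrier M \<Longrightarrow> y \<in> carrier N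
    \<Longrightarrow> tensor_map k P Q f g (pure_tensor k M N x y) = pure_tensor k P Q (f x) (g y)"
  unfolding tensor_map_def
  by (subst tensor_lift_pure) (auto intro: tensor_map_bilinear module_tensor)

lemma tensor_map_comp:
  assumes "f \<in> linear_maps k M P" "g \<in> linear_maps k N Q"
    and "f' \<in> linear_maps k P P'" "g' \<in> linear_maps k Q Q'"
    and "module k M" "module k N" "module k P" "module k Q" "module k P'" "module k Q'"
    and "t \<in> carrier (tensor k M N)"
  shows "tensor_map k P' Q' f' g' (tensor_map k P Q f g t) = tensor_map k P' Q' (f' \<circ> f) (g' \<circ> g) t"
proof -
  have "(tensor_map k P' Q' f' g' \<circ> tensor_map k P Q f g) t = tensor_map k P' Q' (f' \<circ> f) (g' \<circ> g) t"
  proof (rule tensor_ext[of k M N "tensor k P' Q'"])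
    fix x y assume "x \<in> carrier M" "y \<in> carrier N"
    then show "(tensor_map k P' Q' f' g' \<circ> tensor_map k P Q f g) (pure_tensor k M N x y)
        = tensor_map k P' Q' (f' \<circ> f) (g' \<circ> g) (pure_tensor k M N x y)"
      by (simp add: assms tensor_map_pure[OF assms(1,2)] tensor_map_pure[OF assms(3,4)]
          tensor_map_pure[OF linear_comp[OF assms(3,1)] linear_comp[OF assms(4,2)]]
          linear_closed[OF assms(1)] linear_closed[OF assms(2)])
  qed (rule linear_comp tensor_map_linear module_tensor assms)+
  then show ?thesis by simp
qed

lemma tensor_map_id:
  assumes "module k M" "module k N" "t \<in> carrier (tensor k M N)"
  shows "tensor_map k M N id id t = t"
proof -
  have "tensor_map k M N id id t = id t"
  proof (rule tensor_ext[of k M N "tensor k M N" "tensor_map k M N id id" id])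
    fix x y assume "x \<in> carrier M" "y \<in> carrier N"
    then show "tensor_map k M N id id (pure_tensor k M N x y) = id (pure_tensor k M N x y)"
      by (simp add: assms tensor_map_pure[OF linear_id linear_id])
  qed (rule linear_id tensor_map_linear module_tensor assms)+
  then show ?thesis by simp
qed

text \<open>Maps such as \<open>comult B \<circ> f\<close> and
  \<open>tensor_map k B B f f \<circ> comult A\<close> agree on a carrier without being equal as
  functions. Replacing one by the other inside a tensor product goes through this rule.\<close>

lemma tensor_map_cong:
  assumes "f \<in> linear_maps k M P" "g \<in> linear_maps k N Q"
    and "module k M" "module k N" "module k P" "module k Q"
    and "\<And>x. x \<in> carrier M \<Longrightarrow> f' x = f x" "\<And>y. y \<in> carrier N \<Longrightarrow> g' y = g y"
    and "t \<in> carrier (tensor k M N)"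
  shows "tensor_map k P Q f' g' t = tensor_map k P Q f g t"
proof -
  have lin: "f' \<in> linear_maps k M P" "g' \<in> linear_maps k N Q"
    using assms linear_cong by blast+
  show ?thesis
  proof (rule tensor_ext[of k M N "tensor k P Q"])
    fix x y assume "x \<in> carrier M" "y \<in> carrier N"
    then show "tensor_map k P Q f' g' (pure_tensor k M N x y) = tensor_map k P Q f g (pure_tensor k M N x y)"
      by (simp add: assms tensor_map_pure[OF assms(1,2)] tensor_map_pure[OF lin])
  qed (rule tensor_map_linear module_tensor assms lin)+
qed

lemma tensor_assoc_lift_bilinear:
  assumes "module k A" "module k B" "module k C" "c \<in> carrier C"
  shows "(\<lambda>a b. pure_tensor k A (tensor k B C) a (pure_tensor k B C b c))
    \<in> bilinear_maps k A B (tensor k A (tensor k B C))"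
  using bilinear_comp[OF pure_tensor_bilinear[OF assms(1) module_tensor[OF assms(2,3)]] linear_id
    bilinear_left[OF pure_tensor_bilinear[OF assms(2,3)] assms(4)]] by simp

lemma tensor_assoc_bilinear:
  assumes A: "module k A" and B: "module k B" and C: "module k C"
  shows "(\<lambda>t c. tensor_lift k (tensor k A (tensor k B C))
      (\<lambda>a b. pure_tensor k A (tensor k B C) a (pure_tensor k B C b c)) t)
    \<in> bilinear_maps k (tensor k A B) C (tensor k A (tensor k B C))"
proof (rule bilinear_mapsI)
  note BC = module_tensor[OF B C]
  note T = module_tensor[OF A BC] and lift = tensor_assoc_lift_bilinear[OF A B C]
  show "(\<lambda>t. tensor_lift k (tensor k A (tensor k B C))
      (\<lambda>a b. pure_tensor k A (tensor k B C) a (pure_tensor k B C b c)) t)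
    \<in> linear_maps k (tensor k A B) (tensor k A (tensor k B C))" if "c \<in> carrier C" for c
    by (rule tensor_lift_linear[OF A B T lift[OF that]])
  show "(\<lambda>c. tensor_lift k (tensor k A (tensor k B C))
      (\<lambda>a b. pure_tensor k A (tensor k B C) a (pure_tensor k B C b c)) t)
    \<in> linear_maps k C (tensor k A (tensor k B C))" if "t \<in> carrier (tensor k A B)" for t
  proof (rule tensor_lift_linear_parameter[OF A B T C lift _ that])
    show "(\<lambda>c. pure_tensor k A (tensor k B C) a (pure_tensor k B C b c))
      \<in> linear_maps k C (tensor k A (tensor k B C))" if "a \<in> carrier A" "b \<in> carrier B" for a b
      using linear_comp[OF bilinear_right[OF pure_tensor_bilinear[OF A BC] that(1)]
          bilinear_right[OF pure_tensor_bilinear[OF B C] that(2)]] by (simp add: comp_def)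
  qed
qed

lemma tensor_assoc_linear:
  "module k A \<Longrightarrow> module k B \<Longrightarrow> module k C \<Longrightarrow>
    tensor_assoc k A B C \<in> linear_maps k (tensor k (tensor k A B) C) (tensor k A (tensor k B C))"
  unfolding tensor_assoc_def Let_def
  by (intro tensor_lift_linear tensor_assoc_bilinear module_tensor)

lemma tensor_assoc_pure:
  assumes A: "module k A" and B: "module k B" and C: "module k C"
    and "a \<in> carrier A" "b \<in> carrier B" "c \<in> carrier C"
  shows "tensor_assoc k A B C (pure_tensor k (tensor k A B) C (pure_tensor k A B a b) c)
    = pure_tensor k A (tensor k B C) a (pure_tensor k B C b c)"
proof -
  note T = module_tensor[OF A module_tensor[OF B C]]
  show ?thesis
    using assms pure_tensor_closed[OF A B]
    by (simp add: tensor_assoc_def Let_def tensor_lift_pure[OF module_tensor[OF A B] C T tensor_assoc_bilinear[OF A B C]]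
        tensor_lift_pure[OF A B T tensor_assoc_lift_bilinear[OF A B C]])
qed

lemma tensor_assoc_inv_lift_bilinear:
  assumes "module k A" "module k B" "module k C" "a \<in> carrier A"
  shows "(\<lambda>b c. pure_tensor k (tensor k A B) C (pure_tensor k A B a b) c)
    \<in> bilinear_maps k B C (tensor k (tensor k A B) C)"
  using bilinear_comp[OF pure_tensor_bilinear[OF module_tensor[OF assms(1,2)] assms(3)]
      bilinear_right[OF pure_tensor_bilinear[OF assms(1,2)] assms(4)] linear_id] by simp

lemma tensor_assoc_inv_bilinear:
  assumes A: "module k A" and B: "module k B" and C: "module k C"
  shows "(\<lambda>a t. tensor_lift k (tensor k (tensor k A B) C)
      (\<lambda>b c. pure_tensor k (tensor k A B) C (pure_tensor k A B a b) c) t)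
    \<in> bilinear_maps k A (tensor k B C) (tensor k (tensor k A B) C)"
proof (rule bilinear_mapsI)
  note AB = module_tensor[OF A B]
  note T = module_tensor[OF AB C] and lift = tensor_assoc_inv_lift_bilinear[OF A B C]
  show "(\<lambda>t. tensor_lift k (tensor k (tensor k A B) C)
      (\<lambda>b c. pure_tensor k (tensor k A B) C (pure_tensor k A B a b) c) t)
    \<in> linear_maps k (tensor k B C) (tensor k (tensor k A B) C)" if "a \<in> carrier A" for a
    by (rule tensor_lift_linear[OF B C T lift[OF that]])
  show "(\<lambda>a. tensor_lift k (tensor k (tensor k A B) C)
      (\<lambda>b c. pure_tensor k (tensor k A B) C (pure_tensor k A B a b) c) t)
    \<in> linear_maps k A (tensor k (tensor k A B) C)" if "t \<in> carrier (tensor k B C)" for t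
  proof (rule tensor_lift_linear_parameter[OF B C T A lift _ that])
    show "(\<lambda>a. pure_tensor k (tensor k A B) C (pure_tensor k A B a b) c)
      \<in> linear_maps k A (tensor k (tensor k A B) C)" if "b \<in> carrier B" "c \<in> carrier C" for b c
      using linear_comp[OF bilinear_left[OF pure_tensor_bilinear[OF AB C] that(2)]
          bilinear_left[OF pure_tensor_bilinear[OF A B] that(1)]] by (simp add: comp_def)
  qed
qed

lemma tensor_assoc_inv_linear:
  "module k A \<Longrightarrow> module k B \<Longrightarrow> module k C \<Longrightarrow>
    tensor_assoc_inv k A B C \<in> linear_maps k (tensor k A (tensor k B C)) (tensor k (tensor k A B) C)"
  unfolding tensor_assoc_inv_def Let_def
  by (intro tensor_lift_linear tensor_assoc_inv_bilinear module_tensor)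

lemma tensor_assoc_inv_pure:
  assumes A: "module k A" and B: "module k B" and C: "module k C"
    and "a \<in> carrier A" "b \<in> carrier B" "c \<in> carrier C"
  shows "tensor_assoc_inv k A B C (pure_tensor k A (tensor k B C) a (pure_tensor k B C b c))
    = pure_tensor k (tensor k A B) C (pure_tensor k A B a b) c"
proof -
  note T = module_tensor[OF module_tensor[OF A B] C]
  show ?thesis
    using assms pure_tensor_closed[OF B C]
    by (simp add: tensor_assoc_inv_def Let_def
        tensor_lift_pure[OF A module_tensor[OF B C] T tensor_assoc_inv_bilinear[OF A B C]]
        tensor_lift_pure[OF B C T tensor_assoc_inv_lift_bilinear[OF A B C]])
qed

lemma tensor_flip_linear:
  "module k A \<Longrightarrow> module k B \<Longrightarrow> tensor_flip k A B \<in> linear_maps k (tensor k A B) (tensor k B A)"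
  unfolding tensor_flip_def
  by (intro tensor_lift_linear bilinear_swap[OF pure_tensor_bilinear] module_tensor)

lemma tensor_flip_pure:
  "module k A \<Longrightarrow> module k B \<Longrightarrow> a \<in> carrier A \<Longrightarrow> b \<in> carrier B
    \<Longrightarrow> tensor_flip k A B (pure_tensor k A B a b) = pure_tensor k B A b a"
  unfolding tensor_flip_def
  by (subst tensor_lift_pure) (auto intro: bilinear_swap[OF pure_tensor_bilinear] module_tensor)

lemma tensor_lunit_linear:
  "module k A \<Longrightarrow> tensor_lunit k A \<in> linear_maps k (tensor k (scalars k) A) A"
  unfolding tensor_lunit_def
  by (intro tensor_lift_linear bilinear_scalar module_scalars) (auto dest: module.axioms)

lemma tensor_lunit_pure:
  assumes A: "module k A" and "c \<in> carrier k" "a \<in> carrier A"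
  shows "tensor_lunit k A (pure_tensor k (scalars k) A c a) = c \<odot>\<^bsub>A\<^esub> a"
proof -
  interpret A: module k A by fact
  have "c \<in> carrier (scalars k)" using assms by (simp add: scalars_def)
  then show ?thesis unfolding tensor_lunit_def
    using assms by (simp add: tensor_lift_pure[OF module_scalars[OF A.R.cring_axioms] A A bilinear_scalar[OF A]])
qed

lemma tensor_runit_linear:
  "module k A \<Longrightarrow> tensor_runit k A \<in> linear_maps k (tensor k A (scalars k)) A"
  unfolding tensor_runit_def
  by (intro tensor_lift_linear bilinear_swap[OF bilinear_scalar] module_scalars) (auto dest: module.axioms)

lemma tensor_runit_pure:
  assumes A: "module k A" and "c \<in> carrier k" "a \<in> carrier A"
  shows "tensor_runit k A (pure_tensor k A (scalars k) a c) = c \<odot>\<^bsub>A\<^esub> a"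
proof -
  interpret A: module k A by fact
  have "c \<in> carrier (scalars k)" using assms by (simp add: scalars_def)
  then show ?thesis unfolding tensor_runit_def
    using assms by (simp add: tensor_lift_pure[OF A module_scalars[OF A.R.cring_axioms] A bilinear_swap[OF bilinear_scalar[OF A]]])
qed

lemma tensor_assoc_natural:
  assumes lin: "f \<in> linear_maps k A A'" "g \<in> linear_maps k B B'" "h \<in> linear_maps k C C'"
    and mods: "module k A" "module k B" "module k C" "module k A'" "module k B'" "module k C'"
    and t: "t \<in> carrier (tensor k (tensor k A B) C)"
  shows "tensor_assoc k A' B' C' (tensor_map k (tensor k A' B') C' (tensor_map k A' B' f g) h t)
    = tensor_map k A' (tensor k B' C') f (tensor_map k B' C' g h) (tensor_assoc k A B C t)"
proof -
  note AB = tensor_map_linear[OF lin(1,2) mods(1,2,4,5)] and BC = tensor_map_linear[OF lin(2,3) mods(2,3,5,6)]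
  let ?F = "tensor_assoc k A' B' C' \<circ> tensor_map k (tensor k A' B') C' (tensor_map k A' B' f g) h"
  let ?G = "tensor_map k A' (tensor k B' C') f (tensor_map k B' C' g h) \<circ> tensor_assoc k A B C"
  have "?F t = ?G t"
  proof (rule tensor_ext_left[OF mods(1-3) _ _ _ _ t])
    show "?F \<in> linear_maps k (tensor k (tensor k A B) C) (tensor k A' (tensor k B' C'))"
      by (rule linear_comp tensor_map_linear tensor_assoc_linear module_tensor lin mods)+
    show "?G \<in> linear_maps k (tensor k (tensor k A B) C) (tensor k A' (tensor k B' C'))"
      by (rule linear_comp tensor_map_linear tensor_assoc_linear module_tensor lin mods)+
    fix a b c assume "a \<in> carrier A" "b \<in> carrier B" "c \<in> carrier C"
    then show "?F (pure_tensor k (tensor k A B) C (pure_tensor k A B a b) c)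
        = ?G (pure_tensor k (tensor k A B) C (pure_tensor k A B a b) c)"
      by (simp add: tensor_map_pure[OF AB lin(3)] tensor_map_pure[OF lin(1,2)] tensor_map_pure[OF lin(2,3)]
          tensor_map_pure[OF lin(1) BC] tensor_assoc_pure mods module_tensor pure_tensor_closed
          linear_closed[OF lin(1)] linear_closed[OF lin(2)] linear_closed[OF lin(3)])
  qed (rule module_tensor mods)+
  then show ?thesis by simp
qed

lemma tensor_assoc_inv_natural:
  assumes lin: "f \<in> linear_maps k A A'" "g \<in> linear_maps k B B'" "h \<in> linear_maps k C C'"
    and mods: "module k A" "module k B" "module k C" "module k A'" "module k B'" "module k C'"
    and t: "t \<in> carrier (tensor k A (tensor k B C))"
  shows "tensor_assoc_inv k A' B' C' (tensor_map k A' (tensor k B' C') f (tensor_map k B' C' g h) t)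
    = tensor_map k (tensor k A' B') C' (tensor_map k A' B' f g) h (tensor_assoc_inv k A B C t)"
proof -
  note AB = tensor_map_linear[OF lin(1,2) mods(1,2,4,5)] and BC = tensor_map_linear[OF lin(2,3) mods(2,3,5,6)]
  let ?F = "tensor_assoc_inv k A' B' C' \<circ> tensor_map k A' (tensor k B' C') f (tensor_map k B' C' g h)"
  let ?G = "tensor_map k (tensor k A' B') C' (tensor_map k A' B' f g) h \<circ> tensor_assoc_inv k A B C"
  have "?F t = ?G t"
  proof (rule tensor_ext_right[OF mods(1-3) _ _ _ _ t])
    show "?F \<in> linear_maps k (tensor k A (tensor k B C)) (tensor k (tensor k A' B') C')"
      by (rule linear_comp tensor_map_linear tensor_assoc_inv_linear module_tensor lin mods)+
    show "?G \<in> linear_maps k (tensor k A (tensor k B C)) (tensor k (tensor k A' B') C')"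
      by (rule linear_comp tensor_map_linear tensor_assoc_inv_linear module_tensor lin mods)+
    fix a b c assume "a \<in> carrier A" "b \<in> carrier B" "c \<in> carrier C"
    then show "?F (pure_tensor k A (tensor k B C) a (pure_tensor k B C b c))
        = ?G (pure_tensor k A (tensor k B C) a (pure_tensor k B C b c))"
      by (simp add: tensor_map_pure[OF AB lin(3)] tensor_map_pure[OF lin(1,2)] tensor_map_pure[OF lin(2,3)]
          tensor_map_pure[OF lin(1) BC] tensor_assoc_inv_pure mods module_tensor pure_tensor_closed
          linear_closed[OF lin(1)] linear_closed[OF lin(2)] linear_closed[OF lin(3)])
  qed (rule module_tensor mods)+
  then show ?thesis by simp
qed

lemma tensor_assoc_inv_assoc:
  assumes mods: "module k A" "module k B" "module k C" and t: "t \<in> carrier (tensor k (tensor k A B) C)"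
  shows "tensor_assoc_inv k A B C (tensor_assoc k A B C t) = t"
proof -
  let ?T = "tensor k (tensor k A B) C"
  have "(tensor_assoc_inv k A B C \<circ> tensor_assoc k A B C) t = id t"
  proof (rule tensor_ext_left[OF mods _ _ _ _ t])
    show "tensor_assoc_inv k A B C \<circ> tensor_assoc k A B C \<in> linear_maps k ?T ?T"
      by (rule linear_comp tensor_assoc_inv_linear tensor_assoc_linear mods)+
    show "id \<in> linear_maps k ?T ?T" by (rule linear_id)
  qed (simp_all add: module_tensor tensor_assoc_pure tensor_assoc_inv_pure mods)
  then show ?thesis by simp
qed

text \<open>The form of \<open>tensor_ext\<close> suited to multiplications on tensor products,
  which are operations of two arguments rather than maps on a four-fold tensor product.\<close>

lemma bilinear_ext:
  assumes mods: "module k A" "module k B" "module k C" "module k D" "module k P"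
    and F: "F \<in> bilinear_maps k (tensor k A B) (tensor k C D) P"
    and G: "G \<in> bilinear_maps k (tensor k A B) (tensor k C D) P"
    and eq: "\<And>a b c d. a \<in> carrier A \<Longrightarrow> b \<in> carrier B \<Longrightarrow> c \<in> carrier C \<Longrightarrow> d \<in> carrier D \<Longrightarrow>
      F (pure_tensor k A B a b) (pure_tensor k C D c d) = G (pure_tensor k A B a b) (pure_tensor k C D c d)"
    and s: "s \<in> carrier (tensor k A B)" and t: "t \<in> carrier (tensor k C D)"
  shows "F s t = G s t"
proof (rule tensor_ext[OF mods(1,2,5) bilinear_left[OF F t] bilinear_left[OF G t] _ s])
  fix a b assume ab: "a \<in> carrier A" "b \<in> carrier B"
  note p = pure_tensor_closed[OF mods(1,2) ab]
  show "F (pure_tensor k A B a b) t = G (pure_tensor k A B a b) t"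
    by (rule tensor_ext[OF mods(3,4,5) bilinear_right[OF F p] bilinear_right[OF G p] eq[OF ab] t])
qed

lemma scalars_carrier: "carrier (scalars k) = carrier k"
  by (simp add: scalars_def)

lemma tensor_lunit_natural:
  assumes "module k A" "module k B" "f \<in> linear_maps k A B" "t \<in> carrier (tensor k (scalars k) A)"
  shows "tensor_lunit k B (tensor_map k (scalars k) B id f t) = f (tensor_lunit k A t)"
proof -
  have S: "module k (scalars k)" using assms(1) by (intro module_scalars) (rule module.axioms)
  have "(tensor_lunit k B \<circ> tensor_map k (scalars k) B id f) t = (f \<circ> tensor_lunit k A) t"
  proof (rule tensor_ext[OF S assms(1,2) _ _ _ assms(4)])
    show "tensor_lunit k B \<circ> tensor_map k (scalars k) B id f \<in> linear_maps k (tensor k (scalars k) A) B"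
      by (rule linear_comp tensor_lunit_linear tensor_map_linear linear_id assms S)+
    show "f \<circ> tensor_lunit k A \<in> linear_maps k (tensor k (scalars k) A) B"
      by (rule linear_comp tensor_lunit_linear assms)+
    fix c a assume "c \<in> carrier (scalars k)" "a \<in> carrier A"
    then show "(tensor_lunit k B \<circ> tensor_map k (scalars k) B id f) (pure_tensor k (scalars k) A c a)
        = (f \<circ> tensor_lunit k A) (pure_tensor k (scalars k) A c a)"
      using linear_smult[OF assms(3), of c a] linear_closed[OF assms(3), of a]
      by (simp add: tensor_map_pure[OF linear_id assms(3)] tensor_lunit_pure assms S scalars_carrier)
  qed
  then show ?thesis by simp
qed

lemma tensor_runit_natural:
  assumes "module k A" "module k B" "f \<in> linear_maps k A B" "t \<in> carrier (tensor k A (scalars k))"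
  shows "tensor_runit k B (tensor_map k B (scalars k) f id t) = f (tensor_runit k A t)"
proof -
  have S: "module k (scalars k)" using assms(1) by (intro module_scalars) (rule module.axioms)
  have "(tensor_runit k B \<circ> tensor_map k B (scalars k) f id) t = (f \<circ> tensor_runit k A) t"
  proof (rule tensor_ext[OF assms(1) S assms(2) _ _ _ assms(4)])
    show "tensor_runit k B \<circ> tensor_map k B (scalars k) f id \<in> linear_maps k (tensor k A (scalars k)) B"
      by (rule linear_comp tensor_runit_linear tensor_map_linear linear_id assms S)+
    show "f \<circ> tensor_runit k A \<in> linear_maps k (tensor k A (scalars k)) B"
      by (rule linear_comp tensor_runit_linear assms)+
    fix a c assume "a \<in> carrier A" "c \<in> carrier (scalars k)"
    then show "(tensor_runit k B \<circ> tensor_map k B (scalars k) f id) (pure_tensor k A (scalars k) a c)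
        = (f \<circ> tensor_runit k A) (pure_tensor k A (scalars k) a c)"
      using linear_smult[OF assms(3), of c a] linear_closed[OF assms(3), of a]
      by (simp add: tensor_map_pure[OF assms(3) linear_id] tensor_runit_pure assms S scalars_carrier)
  qed
  then show ?thesis by simp
qed

section \<open>Four-fold tensor products\<close>

text \<open>The canonical isomorphism \<open>A \<otimes> ((B \<otimes> C) \<otimes> D) \<rightarrow> (A \<otimes> B) \<otimes> (C \<otimes> D)\<close>, and its value at
  \<open>a \<otimes> (u \<otimes> d)\<close>. The latter expresses \<open>I \<otimes> T \<otimes> I\<close> on pure tensors, where \<open>T (b \<otimes> c)\<close> need not be pure.\<close>

definition tensor_regroup ::
  "('k, 'r) ring_scheme \<Rightarrow> ('k, 'a, 'm) module_scheme \<Rightarrow> ('k, 'b, 'n) module_scheme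
     \<Rightarrow> ('k, 'c, 'p) module_scheme \<Rightarrow> ('k, 'd, 'q) module_scheme
     \<Rightarrow> ('k, 'a, ('k, ('k, 'b, 'c) tensor, 'd) tensor) tensor
     \<Rightarrow> ('k, ('k, 'a, 'b) tensor, ('k, 'c, 'd) tensor) tensor"
  where "tensor_regroup k A B C D =
    tensor_assoc_inv k A B (tensor k C D) \<circ> tensor_map k A (tensor k B (tensor k C D)) id (tensor_assoc k B C D)"

definition tensor_sandwich ::
  "('k, 'r) ring_scheme \<Rightarrow> ('k, 'a, 'm) module_scheme \<Rightarrow> ('k, 'b, 'n) module_scheme
     \<Rightarrow> ('k, 'c, 'p) module_scheme \<Rightarrow> ('k, 'd, 'q) module_scheme
     \<Rightarrow> 'a \<Rightarrow> ('k, 'b, 'c) tensor \<Rightarrow> 'd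
     \<Rightarrow> ('k, ('k, 'a, 'b) tensor, ('k, 'c, 'd) tensor) tensor"
  where "tensor_sandwich k A B C D a u d =
    tensor_regroup k A B C D (pure_tensor k A (tensor k (tensor k B C) D) a (pure_tensor k (tensor k B C) D u d))"

lemma tensor_regroup_linear:
  assumes "module k A" "module k B" "module k C" "module k D"
  shows "tensor_regroup k A B C D
    \<in> linear_maps k (tensor k A (tensor k (tensor k B C) D)) (tensor k (tensor k A B) (tensor k C D))"
  unfolding tensor_regroup_def
  by (rule linear_comp tensor_assoc_inv_linear tensor_assoc_linear tensor_map_linear linear_id module_tensor assms)+

lemma tensor_sandwich_linear:
  assumes mods: "module k A" "module k B" "module k C" "module k D" and "a \<in> carrier A" "d \<in> carrier D"
  shows "(\<lambda>u. tensor_sandwich k A B C D a u d)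
    \<in> linear_maps k (tensor k B C) (tensor k (tensor k A B) (tensor k C D))"
proof -
  note BC = module_tensor[OF mods(2,3)]
  show ?thesis
    using linear_comp[OF tensor_regroup_linear[OF mods] linear_comp[OF
        bilinear_right[OF pure_tensor_bilinear[OF mods(1) module_tensor[OF BC mods(4)]] assms(5)]
        bilinear_left[OF pure_tensor_bilinear[OF BC mods(4)] assms(6)]]]
    by (simp add: tensor_sandwich_def comp_def)
qed

lemma tensor_sandwich_pure:
  assumes "module k A" "module k B" "module k C" "module k D"
    and "a \<in> carrier A" "b \<in> carrier B" "c \<in> carrier C" "d \<in> carrier D"
  shows "tensor_sandwich k A B C D a (pure_tensor k B C b c) d
    = pure_tensor k (tensor k A B) (tensor k C D) (pure_tensor k A B a b) (pure_tensor k C D c d)"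
  using assms
  by (simp add: tensor_sandwich_def tensor_regroup_def tensor_map_pure[OF linear_id tensor_assoc_linear]
      tensor_assoc_pure tensor_assoc_inv_pure module_tensor pure_tensor_closed)

lemma tensor_middle_linear:
  assumes mods: "module k A" "module k B" "module k C" "module k D"
    and T: "T \<in> linear_maps k (tensor k B C) (tensor k C B)"
  shows "tensor_middle k A B C D T
    \<in> linear_maps k (tensor k (tensor k A B) (tensor k C D)) (tensor k (tensor k A C) (tensor k B D))"
  unfolding tensor_middle_def
  by (rule linear_comp tensor_assoc_inv_linear tensor_assoc_linear tensor_map_linear linear_id module_tensor mods T)+

lemma tensor_middle_pure:
  assumes mods: "module k A" "module k B" "module k C" "module k D"
    and T: "T \<in> linear_maps k (tensor k B C) (tensor k C B)"
    and "a \<in> carrier A" "b \<in> carrier B" "c \<in> carrier C" "d \<in> carrier D"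
  shows "tensor_middle k A B C D T
      (pure_tensor k (tensor k A B) (tensor k C D) (pure_tensor k A B a b) (pure_tensor k C D c d))
    = tensor_sandwich k A C B D a (T (pure_tensor k B C b c)) d"
proof -
  note BC = module_tensor[OF mods(2,3)] and CB = module_tensor[OF mods(3,2)]
  note Tid = tensor_map_linear[OF T linear_id BC mods(4) CB mods(4)]
  show ?thesis
    using assms linear_closed[OF T]
    by (simp add: tensor_middle_def tensor_sandwich_def tensor_regroup_def module_tensor pure_tensor_closed
        tensor_assoc_pure tensor_map_pure[OF linear_id tensor_assoc_inv_linear] tensor_assoc_inv_pure
        tensor_map_pure[OF linear_id Tid] tensor_map_pure[OF T linear_id])
qed

text \<open>Here the middle tensor \<open>u\<close> is arbitrary. Both sides are linear in
  \<open>u\<close>, and for pure \<open>u\<close> the sandwich is a pure four-fold tensor, on which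
  \<open>tensor_middle\<close> is already known.\<close>

lemma tensor_middle_sandwich:
  assumes mods: "module k A" "module k B" "module k C" "module k D"
    and T: "T \<in> linear_maps k (tensor k B C) (tensor k C B)"
    and ad: "a \<in> carrier A" "d \<in> carrier D" and u: "u \<in> carrier (tensor k B C)"
  shows "tensor_middle k A B C D T (tensor_sandwich k A B C D a u d) = tensor_sandwich k A C B D a (T u) d"
proof -
  let ?F = "tensor_middle k A B C D T \<circ> (\<lambda>u. tensor_sandwich k A B C D a u d)"
  let ?G = "(\<lambda>u. tensor_sandwich k A C B D a u d) \<circ> T"
  have "?F u = ?G u"
  proof (rule tensor_ext[OF mods(2,3) _ _ _ _ u])
    show "?F \<in> linear_maps k (tensor k B C) (tensor k (tensor k A C) (tensor k B D))"
      by (rule linear_comp tensor_middle_linear tensor_sandwich_linear mods T ad)+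
    show "?G \<in> linear_maps k (tensor k B C) (tensor k (tensor k A C) (tensor k B D))"
      by (rule linear_comp tensor_sandwich_linear mods T ad)+
  qed (simp_all add: mods ad T module_tensor tensor_sandwich_pure tensor_middle_pure)
  then show ?thesis by simp
qed

text \<open>Regrouping is natural: the four maps act on separate factors, so the two inner ones can
  be collected on the middle tensor. It is applied with \<open>u\<close> a coproduct.\<close>

lemma tensor_map_sandwich:
  assumes mods: "module k A" "module k B" "module k C" "module k D"
    and mods': "module k A'" "module k B'" "module k C'" "module k D'"
    and lin: "f \<in> linear_maps k A A'" "g \<in> linear_maps k B B'" "h \<in> linear_maps k C C'" "j \<in> linear_maps k D D'"
    and ad: "a \<in> carrier A" "d \<in> carrier D" and u: "u \<in> carrier (tensor k B C)"
  shows "tensor_map k (tensor k A' B') (tensor k C' D') (tensor_map k A' B' f g) (tensor_map k C' D' h j)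
      (tensor_sandwich k A B C D a u d)
    = tensor_sandwich k A' B' C' D' (f a) (tensor_map k B' C' g h u) (j d)"
proof -
  let ?m = "tensor_map k (tensor k A' B') (tensor k C' D') (tensor_map k A' B' f g) (tensor_map k C' D' h j)"
  let ?F = "?m \<circ> (\<lambda>u. tensor_sandwich k A B C D a u d)"
  let ?G = "(\<lambda>u. tensor_sandwich k A' B' C' D' (f a) u (j d)) \<circ> tensor_map k B' C' g h"
  note cl = linear_closed[OF lin(1)] linear_closed[OF lin(2)] linear_closed[OF lin(3)] linear_closed[OF lin(4)]
  note fg = tensor_map_linear[OF lin(1,2) mods(1,2) mods'(1,2)]
  note hj = tensor_map_linear[OF lin(3,4) mods(3,4) mods'(3,4)]
  have "?F u = ?G u"
  proof (rule tensor_ext[OF mods(2,3) _ _ _ _ u])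
    show "?F \<in> linear_maps k (tensor k B C) (tensor k (tensor k A' B') (tensor k C' D'))"
      by (rule linear_comp tensor_map_linear tensor_sandwich_linear module_tensor mods mods' lin ad)+
    show "?G \<in> linear_maps k (tensor k B C) (tensor k (tensor k A' B') (tensor k C' D'))"
      by (rule linear_comp tensor_map_linear tensor_sandwich_linear module_tensor mods mods' lin ad cl)+
  qed (simp_all add: mods mods' ad cl module_tensor pure_tensor_closed tensor_sandwich_pure
      tensor_map_pure[OF fg hj] tensor_map_pure[OF lin(1,2)] tensor_map_pure[OF lin(2,3)] tensor_map_pure[OF lin(3,4)])
  then show ?thesis by simp
qed

section \<open>Algebras\<close>

lemma assoc_algebra_module: "assoc_algebra k A \<Longrightarrow> module k A"
  by (rule assoc_algebra.axioms)

lemma mult_bilinear: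
  assumes "assoc_algebra k A" shows "mult A \<in> bilinear_maps k A A A"
proof -
  interpret AR: ring A using assms by (rule assoc_algebra.axioms)
  interpret A: assoc_algebra k A by fact
  show ?thesis
    by (intro bilinear_mapsI linear_mapsI)
      (auto simp: AR.l_distr AR.r_distr A.smult_mult_left A.smult_mult_right)
qed

lemma mult_map_linear:
  assumes "assoc_algebra k A" shows "mult_map k A \<in> linear_maps k (tensor k A A) A"
  unfolding mult_map_def using assms by (intro tensor_lift_linear mult_bilinear assoc_algebra_module)

lemma mult_map_pure:
  assumes "assoc_algebra k A" "x \<in> carrier A" "y \<in> carrier A"
  shows "mult_map k A (pure_tensor k A A x y) = x \<otimes>\<^bsub>A\<^esub> y"
  unfolding mult_map_def
  using assms by (simp add: tensor_lift_pure[OF _ _ _ mult_bilinear] assoc_algebra_module)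

lemma smash_prod_mult:
  "x \<otimes>\<^bsub>smash_prod k L H R\<^esub> y = tensor_map k L H (mult_map k L) (mult_map k H)
    (tensor_middle k L H L H R (pure_tensor k (tensor k L H) (tensor k L H) x y))"
  by (simp add: smash_prod_def Let_def)

lemma smash_prod_carrier [simp]:
  "carrier (smash_prod k L H R) = carrier (tensor k L H)"
  "add (smash_prod k L H R) = add (tensor k L H)"
  "zero (smash_prod k L H R) = zero (tensor k L H)"
  "smult (smash_prod k L H R) = smult (tensor k L H)"
  "one (smash_prod k L H R) = pure_tensor k L H \<one>\<^bsub>L\<^esub> \<one>\<^bsub>H\<^esub>"
  by (simp_all add: smash_prod_def Let_def)

lemma smash_prod_mult_bilinear:
  assumes L: "assoc_algebra k L" and H: "assoc_algebra k H"
    and R: "R \<in> linear_maps k (tensor k H L) (tensor k L H)"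
  shows "mult (smash_prod k L H R) \<in> bilinear_maps k (tensor k L H) (tensor k L H) (tensor k L H)"
proof -
  note mods = assoc_algebra_module[OF L] assoc_algebra_module[OF H]
  have "(\<lambda>x y. (tensor_map k L H (mult_map k L) (mult_map k H) \<circ> tensor_middle k L H L H R)
      (pure_tensor k (tensor k L H) (tensor k L H) x y))
    \<in> bilinear_maps k (tensor k L H) (tensor k L H) (tensor k L H)"
    by (rule linear_comp_bilinear, rule linear_comp)
      (rule tensor_map_linear mult_map_linear tensor_middle_linear pure_tensor_bilinear module_tensor L H mods R)+
  then show ?thesis by (simp add: smash_prod_mult[abs_def])
qed

lemma smash_prod_mult_pure:
  assumes L: "assoc_algebra k L" and H: "assoc_algebra k H"
    and R: "R \<in> linear_maps k (tensor k H L) (tensor k L H)"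
    and "l \<in> carrier L" "h \<in> carrier H" "l' \<in> carrier L" "h' \<in> carrier H"
  shows "pure_tensor k L H l h \<otimes>\<^bsub>smash_prod k L H R\<^esub> pure_tensor k L H l' h'
    = tensor_map k L H (mult_map k L) (mult_map k H)
        (tensor_sandwich k L L H H l (R (pure_tensor k H L h l')) h')"
  using assms by (simp add: smash_prod_mult tensor_middle_pure assoc_algebra_module)

lemma tensor_map_mult_sandwich_pure:
  assumes L: "assoc_algebra k L" and H: "assoc_algebra k H"
    and c: "l \<in> carrier L" "h \<in> carrier H" "l' \<in> carrier L" "h' \<in> carrier H"
  shows "tensor_map k L H (mult_map k L) (mult_map k H) (tensor_sandwich k L L H H l (pure_tensor k L H l' h) h')
    = pure_tensor k L H (l \<otimes>\<^bsub>L\<^esub> l') (h \<otimes>\<^bsub>H\<^esub> h')"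
  using c by (simp add: tensor_sandwich_pure tensor_map_pure[OF mult_map_linear[OF L] mult_map_linear[OF H]]
      assoc_algebra_module[OF L] assoc_algebra_module[OF H] module_tensor pure_tensor_closed
      mult_map_pure[OF L] mult_map_pure[OF H])

lemma tensor_algebra_mult_pure:
  assumes A: "assoc_algebra k A"
    and c: "a \<in> carrier A" "b \<in> carrier A" "c \<in> carrier A" "d \<in> carrier A"
  shows "pure_tensor k A A a b \<otimes>\<^bsub>smash_prod k A A (tensor_flip k A A)\<^esub> pure_tensor k A A c d
    = pure_tensor k A A (a \<otimes>\<^bsub>A\<^esub> c) (b \<otimes>\<^bsub>A\<^esub> d)"
  using c assoc_algebra_module[OF A]
  by (simp add: smash_prod_mult_pure[OF A A tensor_flip_linear] tensor_flip_pure tensor_map_mult_sandwich_pure[OF A A])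

text \<open>Functoriality of the tensor square of an algebra. It carries the multiplicativity of a
  comultiplication from \<open>A\<close> over to an image of \<open>A\<close>.\<close>

lemma tensor_map_mult:
  assumes A: "assoc_algebra k A" and B: "assoc_algebra k B" and f: "f \<in> linear_maps k A B"
    and hom: "\<And>x y. x \<in> carrier A \<Longrightarrow> y \<in> carrier A \<Longrightarrow> f (x \<otimes>\<^bsub>A\<^esub> y) = f x \<otimes>\<^bsub>B\<^esub> f y"
    and st: "s \<in> carrier (tensor k A A)" "t \<in> carrier (tensor k A A)"
  shows "tensor_map k B B f f (s \<otimes>\<^bsub>smash_prod k A A (tensor_flip k A A)\<^esub> t)
    = tensor_map k B B f f s \<otimes>\<^bsub>smash_prod k B B (tensor_flip k B B)\<^esub> tensor_map k B B f f t"
proof -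
  interpret A: assoc_algebra k A by fact
  note mA = assoc_algebra_module[OF A] and mB = assoc_algebra_module[OF B]
  note ff = tensor_map_linear[OF f f mA mA mB mB]
  show ?thesis
  proof (rule bilinear_ext[OF mA mA mA mA module_tensor[OF mB mB] _ _ _ st])
    show "(\<lambda>s t. tensor_map k B B f f (s \<otimes>\<^bsub>smash_prod k A A (tensor_flip k A A)\<^esub> t))
      \<in> bilinear_maps k (tensor k A A) (tensor k A A) (tensor k B B)"
      by (rule linear_comp_bilinear[OF ff smash_prod_mult_bilinear[OF A A tensor_flip_linear[OF mA mA]]])
    show "(\<lambda>s t. tensor_map k B B f f s \<otimes>\<^bsub>smash_prod k B B (tensor_flip k B B)\<^esub> tensor_map k B B f f t)
      \<in> bilinear_maps k (tensor k A A) (tensor k A A) (tensor k B B)"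
      by (rule bilinear_comp[OF smash_prod_mult_bilinear[OF B B tensor_flip_linear[OF mB mB]] ff ff])
  qed (simp_all add: tensor_algebra_mult_pure[OF A] tensor_algebra_mult_pure[OF B] tensor_map_pure[OF f f]
      mA mB hom linear_closed[OF f])
qed

section \<open>Images of bialgebras\<close>

lemma assoc_algebra_surjective_image:
  assumes A: "assoc_algebra k A" and f: "f \<in> linear_maps k A B" and surj: "carrier B = f ` carrier A"
    and zero: "\<zero>\<^bsub>B\<^esub> = f \<zero>\<^bsub>A\<^esub>" and one: "f \<one>\<^bsub>A\<^esub> = \<one>\<^bsub>B\<^esub>"
    and mult: "\<And>x y. x \<in> carrier A \<Longrightarrow> y \<in> carrier A \<Longrightarrow> f (x \<otimes>\<^bsub>A\<^esub> y) = f x \<otimes>\<^bsub>B\<^esub> f y"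
  shows "assoc_algebra k B"
proof -
  interpret AR: ring A using A by (rule assoc_algebra.axioms)
  interpret A: assoc_algebra k A by fact
  interpret B: module k B by (rule module_surjective_image[OF A.module_axioms f surj zero])
  note s = one[symmetric] mult[symmetric] linear_add[OF f, symmetric] linear_smult[OF f, symmetric]
  have "monoid B"
    by (rule monoidI) (auto simp: surj s AR.m_assoc)
  moreover have "ring_axioms B"
    by (rule ring_axioms.intro) (auto simp: surj s AR.l_distr AR.r_distr)
  moreover have "assoc_algebra_axioms k B"
    by (rule assoc_algebra_axioms.intro) (auto simp: surj s A.smult_mult_left A.smult_mult_right)
  ultimately show ?thesis
    by (intro assoc_algebra.intro ring.intro B.module_axioms B.M.abelian_group_axioms)
qed

text \<open>Each law of \<open>B\<close> at \<open>f x\<close> is the image, under a tensor power of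
  \<open>f\<close>, of the law of \<open>A\<close> at \<open>x\<close>, and by surjectivity every
  element of \<open>B\<close> has the form \<open>f x\<close>.\<close>

lemma coalgebra_surjective_image:
  assumes A: "coalgebra k A" and B: "module k B"
    and f: "f \<in> linear_maps k A B" and surj: "carrier B = f ` carrier A"
    and comult: "\<And>x. x \<in> carrier A \<Longrightarrow> tensor_map k B B f f (comult A x) = comult B (f x)"
    and counit: "\<And>x. x \<in> carrier A \<Longrightarrow> counit B (f x) = counit A x"
  shows "coalgebra k B"
proof -
  interpret A: coalgebra k A by fact
  have mA: "module k A" by (rule A.module_axioms)
  have S: "module k (scalars k)" by (rule module_scalars) (rule A.R.cring_axioms)
  note mods = mA B S module_tensor[OF mA mA] module_tensor[OF B B]
  note ff = tensor_map_linear[OF f f mA mA B B]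
  note \<Delta> = A.comult_linear and \<epsilon> = A.counit_linear
  have \<Delta>B: "comult B \<in> linear_maps k B (tensor k B B)"
    by (rule linear_mapsI)
      (auto simp: surj comult[symmetric] linear_add[OF ff, symmetric] linear_smult[OF ff, symmetric]
        linear_add[OF f, symmetric] linear_smult[OF f, symmetric] linear_closed[OF \<Delta>] linear_closed[OF ff]
        linear_add[OF \<Delta>] linear_smult[OF \<Delta>])
  have \<epsilon>B: "counit B \<in> linear_maps k B (scalars k)"
    by (rule linear_mapsI)
      (auto simp: surj counit linear_add[OF f, symmetric] linear_smult[OF f, symmetric]
        linear_add[OF \<epsilon>] linear_smult[OF \<epsilon>] linear_closed[OF \<epsilon>])
  have coassoc: "tensor_assoc k B B B (tensor_map k (tensor k B B) B (comult B) id (comult B (f x)))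
      = tensor_map k B (tensor k B B) id (comult B) (comult B (f x))" if x: "x \<in> carrier A" for x
  proof -
    note \<Delta>x = linear_closed[OF \<Delta> x]
    have "tensor_assoc k B B B (tensor_map k (tensor k B B) B (comult B) id (tensor_map k B B f f (comult A x)))
      = tensor_assoc k B B B (tensor_map k (tensor k B B) B (comult B \<circ> f) (id \<circ> f) (comult A x))"
      by (simp add: tensor_map_comp[OF f f \<Delta>B linear_id] mods \<Delta>x)
    \<comment> \<open>Compatibility of \<open>f\<close> with the comultiplications trades
      \<open>comult B\<close> for \<open>comult A\<close>. From here \<open>f\<close> is moved
      outwards until coassociativity of \<open>A\<close> applies, and then moved back in.\<close>
    also have "\<dots> = tensor_assoc k B B B (tensor_map k (tensor k B B) B (tensor_map k B B f f \<circ> comult A) (f \<circ> id) (comult A x))"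
      by (subst tensor_map_cong[OF linear_comp[OF ff \<Delta>] linear_comp[OF f linear_id]]) (simp_all add: mods comult \<Delta>x)
    also have "\<dots> = tensor_assoc k B B B (tensor_map k (tensor k B B) B (tensor_map k B B f f) f
        (tensor_map k (tensor k A A) A (comult A) id (comult A x)))"
      by (simp add: tensor_map_comp[OF \<Delta> linear_id ff f] mods \<Delta>x)
    also have "\<dots> = tensor_map k B (tensor k B B) f (tensor_map k B B f f)
        (tensor_assoc k A A A (tensor_map k (tensor k A A) A (comult A) id (comult A x)))"
      by (rule tensor_assoc_natural[OF f f f mA mA mA B B B])
        (rule linear_closed[OF tensor_map_linear[OF \<Delta> linear_id] \<Delta>x]; simp add: mods)
    also have "\<dots> = tensor_map k B (tensor k B B) f (tensor_map k B B f f)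
        (tensor_map k A (tensor k A A) id (comult A) (comult A x))"
      using A.coassociative x by (simp add: coassociative_def)
    also have "\<dots> = tensor_map k B (tensor k B B) (f \<circ> id) (tensor_map k B B f f \<circ> comult A) (comult A x)"
      by (simp add: tensor_map_comp[OF linear_id \<Delta> f ff] mods \<Delta>x)
    also have "\<dots> = tensor_map k B (tensor k B B) (id \<circ> f) (comult B \<circ> f) (comult A x)"
      by (rule tensor_map_cong[OF linear_comp[OF linear_id f] linear_comp[OF \<Delta>B f]]) (simp_all add: mods comult \<Delta>x)
    also have "\<dots> = tensor_map k B (tensor k B B) id (comult B) (tensor_map k B B f f (comult A x))"
      by (simp add: tensor_map_comp[OF f f linear_id \<Delta>B] mods \<Delta>x)
    finally show ?thesis
      by (simp add: comult x)
  qed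
  have counital: "tensor_lunit k B (tensor_map k (scalars k) B (counit B) id (comult B (f x))) = f x"
    "tensor_runit k B (tensor_map k B (scalars k) id (counit B) (comult B (f x))) = f x"
    if x: "x \<in> carrier A" for x
  proof -
    note \<Delta>x = linear_closed[OF \<Delta> x]
    have "tensor_map k (scalars k) B (counit B) id (tensor_map k B B f f (comult A x))
      = tensor_map k (scalars k) B (counit B \<circ> f) (id \<circ> f) (comult A x)"
      by (simp add: tensor_map_comp[OF f f \<epsilon>B linear_id] mods \<Delta>x)
    also have "\<dots> = tensor_map k (scalars k) B (id \<circ> counit A) (f \<circ> id) (comult A x)"
      by (rule tensor_map_cong[OF linear_comp[OF linear_id \<epsilon>] linear_comp[OF f linear_id]]) (simp_all add: mods counit \<Delta>x)
    also have "\<dots> = tensor_map k (scalars k) B id f (tensor_map k (scalars k) A (counit A) id (comult A x))"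
      by (simp add: tensor_map_comp[OF \<epsilon> linear_id linear_id f] mods \<Delta>x)
    finally show "tensor_lunit k B (tensor_map k (scalars k) B (counit B) id (comult B (f x))) = f x"
      using A.counital x linear_closed[OF tensor_map_linear[OF \<epsilon> linear_id] \<Delta>x]
      by (simp add: tensor_lunit_natural[OF mA B f] comult[symmetric] counital_def mods)
    have "tensor_map k B (scalars k) id (counit B) (tensor_map k B B f f (comult A x))
      = tensor_map k B (scalars k) (id \<circ> f) (counit B \<circ> f) (comult A x)"
      by (simp add: tensor_map_comp[OF f f linear_id \<epsilon>B] mods \<Delta>x)
    also have "\<dots> = tensor_map k B (scalars k) (f \<circ> id) (id \<circ> counit A) (comult A x)"
      by (rule tensor_map_cong[OF linear_comp[OF f linear_id] linear_comp[OF linear_id \<epsilon>]]) (simp_all add: mods counit \<Delta>x)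
    also have "\<dots> = tensor_map k B (scalars k) f id (tensor_map k A (scalars k) id (counit A) (comult A x))"
      by (simp add: tensor_map_comp[OF linear_id \<epsilon> f linear_id] mods \<Delta>x)
    finally show "tensor_runit k B (tensor_map k B (scalars k) id (counit B) (comult B (f x))) = f x"
      using A.counital x linear_closed[OF tensor_map_linear[OF linear_id \<epsilon>] \<Delta>x]
      by (simp add: tensor_runit_natural[OF mA B f] comult[symmetric] counital_def mods)
  qed
  have "coassociative k B (comult B)" "counital k B (comult B) (counit B)"
    using coassoc counital by (simp_all add: coassociative_def counital_def surj)
  then show ?thesis
    by (intro coalgebra.intro coalgebra_axioms.intro B \<Delta>B \<epsilon>B)
qed

text \<open>\<open>B\<close> is any record whose operations are respected by \<open>f\<close>.
  Applied to \<open>\<zeta>'\<close>, it lets the structure on \<open>L \<otimes> H\<close> built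
  from \<open>R\<close> and \<open>W\<close> inherit all its axioms from \<open>K\<close>.\<close>

lemma bialgebra_surjective_image:
  assumes A: "bialgebra k A" and f: "f \<in> linear_maps k A B" and surj: "carrier B = f ` carrier A"
    and zero: "\<zero>\<^bsub>B\<^esub> = f \<zero>\<^bsub>A\<^esub>" and one: "f \<one>\<^bsub>A\<^esub> = \<one>\<^bsub>B\<^esub>"
    and mult: "\<And>x y. x \<in> carrier A \<Longrightarrow> y \<in> carrier A \<Longrightarrow> f (x \<otimes>\<^bsub>A\<^esub> y) = f x \<otimes>\<^bsub>B\<^esub> f y"
    and comult: "\<And>x. x \<in> carrier A \<Longrightarrow> tensor_map k B B f f (comult A x) = comult B (f x)"
    and counit: "\<And>x. x \<in> carrier A \<Longrightarrow> counit B (f x) = counit A x"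
  shows "bialgebra k B"
proof -
  interpret A: bialgebra k A by fact
  have aA: "assoc_algebra k A" by (rule A.assoc_algebra_axioms)
  have cA: "coalgebra k A" by (rule A.coalgebra_axioms)
  have aB: "assoc_algebra k B" by (rule assoc_algebra_surjective_image[OF aA f surj zero one mult])
  interpret B: assoc_algebra k B by (rule aB)
  have cB: "coalgebra k B"
    by (rule coalgebra_surjective_image[OF cA B.module_axioms f surj comult counit])
  interpret B: coalgebra k B by (rule cB)
  let ?AA = "smash_prod k A A (tensor_flip k A A)" and ?BB = "smash_prod k B B (tensor_flip k B B)"
  have \<Delta>: "comult A \<in> ring_hom A ?AA" using A.comult_algebra_map by (simp add: algebra_maps_def)
  have \<epsilon>: "counit A \<in> ring_hom A (scalars k)" using A.counit_algebra_map by (simp add: algebra_maps_def)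
  have "comult B \<in> ring_hom B ?BB"
  proof (rule ring_hom_memI)
    show "comult B x \<in> carrier ?BB" if "x \<in> carrier B" for x
      using linear_closed[OF B.comult_linear that] by simp
    show "comult B (x \<oplus>\<^bsub>B\<^esub> y) = comult B x \<oplus>\<^bsub>?BB\<^esub> comult B y" if "x \<in> carrier B" "y \<in> carrier B" for x y
      using linear_add[OF B.comult_linear that] by simp
    show "comult B (x \<otimes>\<^bsub>B\<^esub> y) = comult B x \<otimes>\<^bsub>?BB\<^esub> comult B y" if xy: "x \<in> carrier B" "y \<in> carrier B" for x y
    proof -
      obtain a b where ab: "a \<in> carrier A" "x = f a" "b \<in> carrier A" "y = f b" using xy surj by auto
      have "comult B (x \<otimes>\<^bsub>B\<^esub> y) = tensor_map k B B f f (comult A a \<otimes>\<^bsub>?AA\<^esub> comult A b)"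
        using ab ring_hom_mult[OF \<Delta>] by (simp flip: mult comult)
      also have "\<dots> = comult B x \<otimes>\<^bsub>?BB\<^esub> comult B y"
        using ab linear_closed[OF A.comult_linear] by (simp add: tensor_map_mult[OF aA aB f mult] comult)
      finally show ?thesis .
    qed
    have "comult B \<one>\<^bsub>B\<^esub> = tensor_map k B B f f \<one>\<^bsub>?AA\<^esub>"
      using ring_hom_one[OF \<Delta>] comult[of "\<one>\<^bsub>A\<^esub>"] by (simp add: one)
    then show "comult B \<one>\<^bsub>B\<^esub> = \<one>\<^bsub>?BB\<^esub>"
      by (simp add: tensor_map_pure[OF f f] A.module_axioms B.module_axioms one)
  qed
  moreover have "comult B \<in> linear_maps k B ?BB"
    using B.comult_linear by (simp add: linear_maps_def)
  moreover have "counit B \<in> ring_hom B (scalars k)"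
  proof (rule ring_hom_memI)
    show "counit B x \<in> carrier (scalars k)" if "x \<in> carrier B" for x
      using linear_closed[OF B.counit_linear that] .
    show "counit B (x \<oplus>\<^bsub>B\<^esub> y) = counit B x \<oplus>\<^bsub>scalars k\<^esub> counit B y" if "x \<in> carrier B" "y \<in> carrier B" for x y
      using linear_add[OF B.counit_linear that] .
    show "counit B (x \<otimes>\<^bsub>B\<^esub> y) = counit B x \<otimes>\<^bsub>scalars k\<^esub> counit B y" if "x \<in> carrier B" "y \<in> carrier B" for x y
      using that ring_hom_mult[OF \<epsilon>] by (auto simp: surj counit simp flip: mult)
    show "counit B \<one>\<^bsub>B\<^esub> = \<one>\<^bsub>scalars k\<^esub>"
      using ring_hom_one[OF \<epsilon>] by (simp add: counit flip: one)
  qed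
  ultimately show ?thesis
    by (intro bialgebra.intro bialgebra_axioms.intro aB cB) (simp_all add: algebra_maps_def B.counit_linear)
qed

lemma pure_tensor_smult:
  assumes "module k M" "module k N" "c \<in> carrier k" "x \<in> carrier M" "y \<in> carrier N"
  shows "pure_tensor k M N (c \<odot>\<^bsub>M\<^esub> x) y = c \<odot>\<^bsub>tensor k M N\<^esub> pure_tensor k M N x y"
    and "pure_tensor k M N x (c \<odot>\<^bsub>N\<^esub> y) = c \<odot>\<^bsub>tensor k M N\<^esub> pure_tensor k M N x y"
  by (rule linear_smult[OF bilinear_left[OF pure_tensor_bilinear[OF assms(1,2)] assms(5)] assms(3,4)])
    (rule linear_smult[OF bilinear_right[OF pure_tensor_bilinear[OF assms(1,2)] assms(4)] assms(3,5)])

lemma tensor_ext_four: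
  assumes mods: "module k A" "module k B" "module k C" "module k D" "module k P"
    and F: "F \<in> linear_maps k (tensor k (tensor k A B) (tensor k C D)) P"
    and G: "G \<in> linear_maps k (tensor k (tensor k A B) (tensor k C D)) P"
    and eq: "\<And>a b c d. a \<in> carrier A \<Longrightarrow> b \<in> carrier B \<Longrightarrow> c \<in> carrier C \<Longrightarrow> d \<in> carrier D \<Longrightarrow>
      F (pure_tensor k (tensor k A B) (tensor k C D) (pure_tensor k A B a b) (pure_tensor k C D c d))
      = G (pure_tensor k (tensor k A B) (tensor k C D) (pure_tensor k A B a b) (pure_tensor k C D c d))"
    and t: "t \<in> carrier (tensor k (tensor k A B) (tensor k C D))"
  shows "F t = G t"
proof (rule tensor_ext[OF module_tensor[OF mods(1,2)] module_tensor[OF mods(3,4)] mods(5) F G _ t])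
  fix s t assume st: "s \<in> carrier (tensor k A B)" "t \<in> carrier (tensor k C D)"
  note p = pure_tensor_bilinear[OF module_tensor[OF mods(1,2)] module_tensor[OF mods(3,4)]]
  show "F (pure_tensor k (tensor k A B) (tensor k C D) s t) = G (pure_tensor k (tensor k A B) (tensor k C D) s t)"
    by (rule bilinear_ext[OF mods linear_comp_bilinear[OF F p] linear_comp_bilinear[OF G p] eq st])
qed

section \<open>Coalgebras\<close>

text \<open>\<open>\<epsilon> \<otimes> I\<close> followed by the identification of
  \<open>k \<otimes> A\<close> with \<open>A\<close>. "Left" and "right" name the factor that is
  evaluated; \<open>A\<close> is the factor that remains.\<close>

definition contract_left ::
  "('k, 'r) ring_scheme \<Rightarrow> ('k, 'a, 'm) module_scheme \<Rightarrow> ('c \<Rightarrow> 'k) \<Rightarrow> ('k, 'c, 'a) tensor \<Rightarrow> 'a"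
  where "contract_left k A \<epsilon> = tensor_lunit k A \<circ> tensor_map k (scalars k) A \<epsilon> id"

definition contract_right ::
  "('k, 'r) ring_scheme \<Rightarrow> ('k, 'a, 'm) module_scheme \<Rightarrow> ('c \<Rightarrow> 'k) \<Rightarrow> ('k, 'a, 'c) tensor \<Rightarrow> 'a"
  where "contract_right k A \<epsilon> = tensor_runit k A \<circ> tensor_map k A (scalars k) id \<epsilon>"

context
  fixes k :: "('k, 'r) ring_scheme" and A :: "('k, 'a, 'm) module_scheme" and C :: "('k, 'c, 'n) module_scheme"
    and \<epsilon> :: "'c \<Rightarrow> 'k"
  assumes A: "module k A" and C: "module k C" and \<epsilon>: "\<epsilon> \<in> linear_maps k C (scalars k)"
begin

private lemma S: "module k (scalars k)"
  using A by (intro module_scalars) (rule module.axioms)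

lemma contract_left_linear: "contract_left k A \<epsilon> \<in> linear_maps k (tensor k C A) A"
  unfolding contract_left_def
  by (rule linear_comp tensor_lunit_linear tensor_map_linear \<epsilon> linear_id S A C)+

lemma contract_right_linear: "contract_right k A \<epsilon> \<in> linear_maps k (tensor k A C) A"
  unfolding contract_right_def
  by (rule linear_comp tensor_runit_linear tensor_map_linear \<epsilon> linear_id S A C)+

lemma contract_left_pure:
  "c \<in> carrier C \<Longrightarrow> a \<in> carrier A \<Longrightarrow> contract_left k A \<epsilon> (pure_tensor k C A c a) = \<epsilon> c \<odot>\<^bsub>A\<^esub> a"
  using linear_closed[OF \<epsilon>]
  by (simp add: contract_left_def tensor_map_pure[OF \<epsilon> linear_id] S A C tensor_lunit_pure scalars_carrier)

lemma contract_right_pure: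
  "c \<in> carrier C \<Longrightarrow> a \<in> carrier A \<Longrightarrow> contract_right k A \<epsilon> (pure_tensor k A C a c) = \<epsilon> c \<odot>\<^bsub>A\<^esub> a"
  using linear_closed[OF \<epsilon>]
  by (simp add: contract_right_def tensor_map_pure[OF linear_id \<epsilon>] S A C tensor_runit_pure scalars_carrier)

end

context coalgebra
begin

lemma scalars_module: "module k (scalars k)"
  by (rule module_scalars) (rule R.cring_axioms)

lemma counit_closed: "c \<in> carrier C \<Longrightarrow> counit C c \<in> carrier k"
  using linear_closed[OF counit_linear] by (simp add: scalars_carrier)

lemma comult_closed: "c \<in> carrier C \<Longrightarrow> comult C c \<in> carrier (tensor k C C)"
  using linear_closed[OF comult_linear] .

lemma counit_left_comult: "c \<in> carrier C \<Longrightarrow> contract_left k C (counit C) (comult C c) = c"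
  using counital by (simp add: counital_def contract_left_def)

lemma counit_right_comult: "c \<in> carrier C \<Longrightarrow> contract_right k C (counit C) (comult C c) = c"
  using counital by (simp add: counital_def contract_right_def)

text \<open>Evaluate the two factors one after the other: the left counit law turns
  \<open>(\<epsilon> \<otimes> I) \<Delta> c\<close> into \<open>c\<close>, and the remaining counit
  acts on \<open>c\<close>.\<close>

lemma tensor_counit_comult:
  assumes c: "c \<in> carrier C" shows "tensor_counit k C C (comult C c) = counit C c"
proof -
  have "tensor_map k (scalars k) (scalars k) (counit C) (counit C) (comult C c)
    = tensor_map k (scalars k) (scalars k) id (counit C) (tensor_map k (scalars k) C (counit C) id (comult C c))"
    using c by (simp add: tensor_map_comp[OF counit_linear linear_id linear_id counit_linear]
        scalars_module module_axioms comult_closed)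
  then show ?thesis
    using counit_left_comult[OF c] linear_closed[OF tensor_map_linear[OF counit_linear linear_id] comult_closed[OF c]]
    by (simp add: tensor_counit_def tensor_lunit_natural[OF module_axioms scalars_module counit_linear]
        contract_left_def scalars_module module_axioms)
qed

text \<open>In Sweedler notation both sides are x1 \<otimes> x2 \<otimes> x3 \<otimes> x4. The left
  side splits both halves of a coproduct, the right side splits the middle factor of a three-fold
  one. The second form exposes a coproduct in the middle position, where \<open>W\<close>
  acts.\<close>

lemma comult_comult:
  assumes x: "x \<in> carrier C"
  shows "tensor_map k (tensor k C C) (tensor k C C) (comult C) (comult C) (comult C x)
    = tensor_regroup k C C C C (tensor_map k C (tensor k (tensor k C C) C) id
        (tensor_map k (tensor k C C) C (comult C) id) (tensor_map k C (tensor k C C) id (comult C) (comult C x)))"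
proof -
  let ?C2 = "tensor k C C"
  let ?\<Delta> = "comult C"
  let ?a = "tensor_assoc k C C C" and ?l = "tensor_map k ?C2 C ?\<Delta> id" and ?r = "tensor_map k C ?C2 id ?\<Delta>"
  note C = module_axioms
  note C2 = module_tensor[OF C C]
  note mods = C C2 module_tensor[OF C C2] module_tensor[OF C2 C]
  note \<Delta> = comult_linear and \<Delta>x = comult_closed[OF x]
  note l = tensor_map_linear[OF \<Delta> linear_id C C C2 C] and r = tensor_map_linear[OF linear_id \<Delta> C C C C2]
  note a = tensor_assoc_linear[OF C C C]
  note rr = tensor_map_linear[OF linear_id \<Delta> C C C C2]
  have coassoc: "?a (?l (?\<Delta> y)) = ?r (?\<Delta> y)" if "y \<in> carrier C" for y
    using coassociative that by (simp add: coassociative_def)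
  have "tensor_assoc_inv k C C ?C2 (tensor_map k C (tensor k C ?C2) id (tensor_assoc k C C C)
      (tensor_map k C (tensor k ?C2 C) id ?l (?r (?\<Delta> x))))
    = tensor_assoc_inv k C C ?C2 (tensor_map k C (tensor k C ?C2) id (?a \<circ> (?l \<circ> ?\<Delta>)) (?\<Delta> x))"
    by (simp add: tensor_map_comp[OF linear_id \<Delta> linear_id l] mods \<Delta>x
        tensor_map_comp[OF linear_comp[OF linear_id linear_id] linear_comp[OF l \<Delta>] linear_id a, simplified])
  \<comment> \<open>First use of coassociativity, inside the second tensor factor. The second use is
    at \<open>x\<close> itself, after naturality has moved the outer reassociation past the last
    comultiplication.\<close>
  also have "\<dots> = tensor_assoc_inv k C C ?C2 (tensor_map k C (tensor k C ?C2) id (?r \<circ> ?\<Delta>) (?\<Delta> x))"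
    by (subst tensor_map_cong[OF linear_id linear_comp[OF r \<Delta>]]) (simp_all add: mods coassoc \<Delta>x)
  also have "\<dots> = tensor_assoc_inv k C C ?C2 (tensor_map k C (tensor k C ?C2) id ?r (?r (?\<Delta> x)))"
    by (simp add: tensor_map_comp[OF linear_id \<Delta> linear_id r] mods \<Delta>x)
  also have "\<dots> = tensor_map k ?C2 ?C2 (tensor_map k C C id id) ?\<Delta> (tensor_assoc_inv k C C C (?r (?\<Delta> x)))"
    by (rule tensor_assoc_inv_natural[OF linear_id linear_id \<Delta>])
      (simp_all add: mods linear_closed[OF r \<Delta>x])
  also have "\<dots> = tensor_map k ?C2 ?C2 (tensor_map k C C id id) ?\<Delta> (?l (?\<Delta> x))"
    by (simp add: coassoc[OF x, symmetric] tensor_assoc_inv_assoc mods linear_closed[OF l \<Delta>x])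
  also have "\<dots> = tensor_map k ?C2 ?C2 id ?\<Delta> (?l (?\<Delta> x))"
    by (rule tensor_map_cong[OF linear_id \<Delta>]) (simp_all add: mods tensor_map_id linear_closed[OF l \<Delta>x])
  also have "\<dots> = tensor_map k ?C2 ?C2 ?\<Delta> ?\<Delta> (?\<Delta> x)"
    by (simp add: tensor_map_comp[OF \<Delta> linear_id linear_id \<Delta>] mods \<Delta>x)
  finally show ?thesis by (simp add: tensor_regroup_def)
qed

end

section \<open>Smash biproducts\<close>

lemma smash_biprod_simps [simp]:
  "carrier (smash_biprod k L H W R) = carrier (tensor k L H)"
  "mult (smash_biprod k L H W R) = mult (smash_prod k L H R)"
  "one (smash_biprod k L H W R) = pure_tensor k L H \<one>\<^bsub>L\<^esub> \<one>\<^bsub>H\<^esub>"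
  "add (smash_biprod k L H W R) = add (tensor k L H)"
  "zero (smash_biprod k L H W R) = zero (tensor k L H)"
  "smult (smash_biprod k L H W R) = smult (tensor k L H)"
  "comult (smash_biprod k L H W R) = smash_comult k L H W"
  "counit (smash_biprod k L H W R) = tensor_counit k L H"
  by (simp_all add: smash_biprod_def Let_def)

text \<open>Linear maps and tensor products see only the underlying vector space of a record, which
  the biproduct shares with \<open>L \<otimes> H\<close>. This and the next rules replace the
  biproduct by \<open>tensor k L H\<close> wherever it serves merely as a vector space.\<close>

lemma smash_biprod_linear_maps [simp]:
  "linear_maps k M (smash_biprod k L H W R) = linear_maps k M (tensor k L H)"
  by (simp add: linear_maps_def)

lemma smash_biprod_tensor [simp]:
  "tensor k (smash_biprod k L H W R) N = tensor k (tensor k L H) N"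
  "tensor k M (smash_biprod k L H W R) = tensor k M (tensor k L H)"
  by (simp_all add: tensor_def tensor_kernel_def tensor_relations_def)

lemma smash_biprod_pure_tensor [simp]:
  "pure_tensor k (smash_biprod k L H W R) N = pure_tensor k (tensor k L H) N"
  "pure_tensor k M (smash_biprod k L H W R) = pure_tensor k M (tensor k L H)"
  by (simp_all add: pure_tensor_def[abs_def] tensor_kernel_def tensor_relations_def)

lemma smash_biprod_tensor_map [simp]:
  "tensor_map k (smash_biprod k L H W R) N = tensor_map k (tensor k L H) N"
  "tensor_map k M (smash_biprod k L H W R) = tensor_map k M (tensor k L H)"
  by (simp_all add: tensor_map_def[abs_def])

lemma smash_biprod_coassociative:
  "coassociative k (smash_biprod k L H W R) \<Delta> = coassociative k (tensor k L H) \<Delta>"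
  by (simp add: coassociative_def tensor_assoc_def)

text \<open>The unit isomorphisms take their sums in the biproduct record itself, so the comparison
  goes down to the definition of a finite sum, which depends only on carrier, addition and
  zero.\<close>

lemma smash_biprod_counital:
  "counital k (smash_biprod k L H W R) \<Delta> \<epsilon> = counital k (tensor k L H) \<Delta> \<epsilon>"
  by (simp add: counital_def tensor_lunit_def tensor_runit_def tensor_lift_def[abs_def] finsum_def finprod_def)

lemma monoid_smash_biprod:
  "monoid (smash_biprod k L H W R) \<longleftrightarrow> monoid (smash_prod k L H R)"
  by (simp add: monoid_def)

section \<open>Standing data: two algebras that are also coalgebras\<close>

locale algebra_coalgebra_pair =
  fixes k :: "('k, 'r) ring_scheme"
    and L :: "('k, 'l, 'm) alg_coalg_scheme"
    and H :: "('k, 'h, 'n) alg_coalg_scheme"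
  assumes L_algebra: "assoc_algebra k L" and L_coalgebra: "coalgebra k L"
    and H_algebra: "assoc_algebra k H" and H_coalgebra: "coalgebra k H"
begin

sublocale L: coalgebra k L by (rule L_coalgebra)
sublocale H: coalgebra k H by (rule H_coalgebra)

lemmas module_L = assoc_algebra_module[OF L_algebra]
lemmas module_H = assoc_algebra_module[OF H_algebra]
lemmas module_LH = module_tensor[OF module_L module_H]
lemmas modules = module_L module_H module_LH L.scalars_module

lemma tensor_counit_linear: "tensor_counit k L H \<in> linear_maps k (tensor k L H) (scalars k)"
  unfolding tensor_counit_def
  by (rule linear_comp tensor_lunit_linear tensor_map_linear L.counit_linear H.counit_linear modules)+

lemma tensor_counit_pure:
  "l \<in> carrier L \<Longrightarrow> h \<in> carrier H
    \<Longrightarrow> tensor_counit k L H (pure_tensor k L H l h) = counit L l \<otimes>\<^bsub>k\<^esub> counit H h"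
  by (simp add: tensor_counit_def tensor_map_pure[OF L.counit_linear H.counit_linear] modules
      tensor_lunit_pure scalars_carrier L.counit_closed H.counit_closed)
    (simp add: scalars_def)

end

section \<open>From a factorisation to a smash biproduct\<close>

locale bialgebra_factorisation = algebra_coalgebra_pair k L H + K: bialgebra k K
  for k :: "('k, 'r) ring_scheme"
    and L :: "('k, 'l, 'm) alg_coalg_scheme"
    and H :: "('k, 'h, 'n) alg_coalg_scheme"
    and K :: "('k, 'a, 'p) alg_coalg_scheme" +
  fixes i\<^sub>L i\<^sub>H p\<^sub>L p\<^sub>H
  assumes i\<^sub>L: "i\<^sub>L \<in> algebra_maps k L K" and i\<^sub>H: "i\<^sub>H \<in> algebra_maps k H K"
    and p\<^sub>L: "p\<^sub>L \<in> coalgebra_maps k K L" and p\<^sub>H: "p\<^sub>H \<in> coalgebra_maps k K H"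
    and left_inverse: "\<forall>t\<in>carrier (tensor k L H).
      (tensor_map k L H p\<^sub>L p\<^sub>H \<circ> comult K) ((mult_map k K \<circ> tensor_map k K K i\<^sub>L i\<^sub>H) t) = t"
    and right_inverse: "\<forall>x\<in>carrier K.
      (mult_map k K \<circ> tensor_map k K K i\<^sub>L i\<^sub>H) ((tensor_map k L H p\<^sub>L p\<^sub>H \<circ> comult K) x) = x"
begin

definition \<zeta> where "\<zeta> = mult_map k K \<circ> tensor_map k K K i\<^sub>L i\<^sub>H"

definition \<zeta>' where "\<zeta>' = tensor_map k L H p\<^sub>L p\<^sub>H \<circ> comult K"

lemma \<zeta>'_\<zeta>: "t \<in> carrier (tensor k L H) \<Longrightarrow> \<zeta>' (\<zeta> t) = t"
  using left_inverse unfolding \<zeta>_def \<zeta>'_def by (rule bspec)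

lemma \<zeta>_\<zeta>': "x \<in> carrier K \<Longrightarrow> \<zeta> (\<zeta>' x) = x"
  using right_inverse unfolding \<zeta>_def \<zeta>'_def by (rule bspec)

definition R where "R = \<zeta>' \<circ> mult_map k K \<circ> tensor_map k K K i\<^sub>H i\<^sub>L"

definition W where "W = tensor_map k H L p\<^sub>H p\<^sub>L \<circ> comult K \<circ> \<zeta>"

lemma K_algebra: "assoc_algebra k K" by (rule K.assoc_algebra_axioms)

lemma module_K: "module k K" by (rule K.module_axioms)

lemma i_linear: "i\<^sub>L \<in> linear_maps k L K" "i\<^sub>H \<in> linear_maps k H K"
  using i\<^sub>L i\<^sub>H by (simp_all add: algebra_maps_def)

lemma p_linear: "p\<^sub>L \<in> linear_maps k K L" "p\<^sub>H \<in> linear_maps k K H"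
  using p\<^sub>L p\<^sub>H by (simp_all add: coalgebra_maps_def)

lemma i_mult:
  "l \<in> carrier L \<Longrightarrow> l' \<in> carrier L \<Longrightarrow> i\<^sub>L (l \<otimes>\<^bsub>L\<^esub> l') = i\<^sub>L l \<otimes>\<^bsub>K\<^esub> i\<^sub>L l'"
  "h \<in> carrier H \<Longrightarrow> h' \<in> carrier H \<Longrightarrow> i\<^sub>H (h \<otimes>\<^bsub>H\<^esub> h') = i\<^sub>H h \<otimes>\<^bsub>K\<^esub> i\<^sub>H h'"
  using i\<^sub>L i\<^sub>H by (auto simp: algebra_maps_def ring_hom_mult)

lemma i_one: "i\<^sub>L \<one>\<^bsub>L\<^esub> = \<one>\<^bsub>K\<^esub>" "i\<^sub>H \<one>\<^bsub>H\<^esub> = \<one>\<^bsub>K\<^esub>"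
  using i\<^sub>L i\<^sub>H by (auto simp: algebra_maps_def ring_hom_one)

lemma p_comult:
  "x \<in> carrier K \<Longrightarrow> comult L (p\<^sub>L x) = tensor_map k L L p\<^sub>L p\<^sub>L (comult K x)"
  "x \<in> carrier K \<Longrightarrow> comult H (p\<^sub>H x) = tensor_map k H H p\<^sub>H p\<^sub>H (comult K x)"
  using p\<^sub>L p\<^sub>H by (auto simp: coalgebra_maps_def)

lemma p_counit:
  "x \<in> carrier K \<Longrightarrow> counit L (p\<^sub>L x) = counit K x"
  "x \<in> carrier K \<Longrightarrow> counit H (p\<^sub>H x) = counit K x"
  using p\<^sub>L p\<^sub>H by (auto simp: coalgebra_maps_def)

lemmas i_closed = linear_closed[OF i_linear(1)] linear_closed[OF i_linear(2)]
lemmas p_closed = linear_closed[OF p_linear(1)] linear_closed[OF p_linear(2)]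

lemma \<zeta>_linear: "\<zeta> \<in> linear_maps k (tensor k L H) K"
  unfolding \<zeta>_def
  by (rule linear_comp mult_map_linear tensor_map_linear K_algebra i_linear modules module_K)+

lemma \<zeta>'_linear: "\<zeta>' \<in> linear_maps k K (tensor k L H)"
  unfolding \<zeta>'_def
  by (rule linear_comp tensor_map_linear K.comult_linear p_linear modules module_K)+

lemma R_linear: "R \<in> linear_maps k (tensor k H L) (tensor k L H)"
  unfolding R_def
  by (rule linear_comp mult_map_linear tensor_map_linear \<zeta>'_linear K_algebra i_linear modules module_K)+

lemma W_linear: "W \<in> linear_maps k (tensor k L H) (tensor k H L)"
  unfolding W_def
  by (rule linear_comp tensor_map_linear \<zeta>_linear K.comult_linear p_linear modules module_K)+

section \<open>Transport of the multiplication of \<open>K\<close> to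
  \<open>L \<otimes> H\<close>\<close>

lemma \<zeta>_pure: "l \<in> carrier L \<Longrightarrow> h \<in> carrier H \<Longrightarrow> \<zeta> (pure_tensor k L H l h) = i\<^sub>L l \<otimes>\<^bsub>K\<^esub> i\<^sub>H h"
  by (simp add: \<zeta>_def tensor_map_pure[OF i_linear] modules module_K mult_map_pure[OF K_algebra] i_closed)

text \<open>The reason for the choice of \<open>R\<close>: it records how a product in
  \<open>K\<close> with the \<open>H\<close> factor in front is rewritten by products with the
  \<open>L\<close> factor in front.\<close>

lemma \<zeta>_R: "h \<in> carrier H \<Longrightarrow> l \<in> carrier L \<Longrightarrow> \<zeta> (R (pure_tensor k H L h l)) = i\<^sub>H h \<otimes>\<^bsub>K\<^esub> i\<^sub>L l"
  by (simp add: R_def tensor_map_pure[OF i_linear(2,1)] modules module_K mult_map_pure[OF K_algebra] i_closed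
      \<zeta>_\<zeta>' bilinear_closed[OF mult_bilinear[OF K_algebra]])

lemma K_mult_closed: "x \<in> carrier K \<Longrightarrow> y \<in> carrier K \<Longrightarrow> x \<otimes>\<^bsub>K\<^esub> y \<in> carrier K"
  using bilinear_closed[OF mult_bilinear[OF K_algebra]] .

lemma K_mult_assoc:
  "x \<in> carrier K \<Longrightarrow> y \<in> carrier K \<Longrightarrow> z \<in> carrier K \<Longrightarrow> (x \<otimes>\<^bsub>K\<^esub> y) \<otimes>\<^bsub>K\<^esub> z = x \<otimes>\<^bsub>K\<^esub> (y \<otimes>\<^bsub>K\<^esub> z)"
  using monoid.m_assoc[OF ring.is_monoid[OF assoc_algebra.axioms(2)[OF K_algebra]]] .

text \<open>Multiplying \<open>u\<close> by \<open>l\<close> from the left and by \<open>h\<close>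
  from the right corresponds under \<open>\<zeta>\<close> to multiplying in \<open>K\<close>, since
  \<open>i\<^sub>L\<close> and \<open>i\<^sub>H\<close> are multiplicative. An arbitrary
  \<open>u\<close> is allowed because it will be a value of \<open>R\<close>.\<close>

lemma \<zeta>_sandwich:
  assumes l: "l \<in> carrier L" and h: "h \<in> carrier H" and u: "u \<in> carrier (tensor k L H)"
  shows "\<zeta> (tensor_map k L H (mult_map k L) (mult_map k H) (tensor_sandwich k L L H H l u h))
    = (i\<^sub>L l \<otimes>\<^bsub>K\<^esub> \<zeta> u) \<otimes>\<^bsub>K\<^esub> i\<^sub>H h"
proof -
  let ?F = "\<zeta> \<circ> (tensor_map k L H (mult_map k L) (mult_map k H) \<circ> (\<lambda>u. tensor_sandwich k L L H H l u h))"
  let ?G = "(\<lambda>x. x \<otimes>\<^bsub>K\<^esub> i\<^sub>H h) \<circ> ((\<otimes>\<^bsub>K\<^esub>) (i\<^sub>L l) \<circ> \<zeta>)"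
  have "?F u = ?G u"
  proof (rule tensor_ext[OF module_L module_H module_K _ _ _ u])
    show "?F \<in> linear_maps k (tensor k L H) K"
      by (rule linear_comp tensor_map_linear mult_map_linear tensor_sandwich_linear \<zeta>_linear
          L_algebra H_algebra module_tensor module_L module_H l h)+
    show "?G \<in> linear_maps k (tensor k L H) K"
      by (rule linear_comp \<zeta>_linear bilinear_left[OF mult_bilinear[OF K_algebra]]
          bilinear_right[OF mult_bilinear[OF K_algebra]] i_closed l h)+
    fix l' h' assume c: "l' \<in> carrier L" "h' \<in> carrier H"
    have "\<zeta> (pure_tensor k L H (l \<otimes>\<^bsub>L\<^esub> l') (h' \<otimes>\<^bsub>H\<^esub> h)) = i\<^sub>L (l \<otimes>\<^bsub>L\<^esub> l') \<otimes>\<^bsub>K\<^esub> i\<^sub>H (h' \<otimes>\<^bsub>H\<^esub> h)"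
      using c l h by (intro \<zeta>_pure bilinear_closed[OF mult_bilinear[OF L_algebra]] bilinear_closed[OF mult_bilinear[OF H_algebra]])
    then show "?F (pure_tensor k L H l' h') = ?G (pure_tensor k L H l' h')"
      using c l h by (simp add: tensor_map_mult_sandwich_pure L_algebra H_algebra \<zeta>_pure i_mult
          K_mult_assoc K_mult_closed i_closed)
  qed
  then show ?thesis by simp
qed

text \<open>On pure tensors this is (l h)(l' h') = l (h l') h' in \<open>K\<close>: the inner
  product h l' is \<open>\<zeta>\<close> of \<open>R\<close> by \<open>\<zeta>_R\<close>, and
  \<open>\<zeta>_sandwich\<close> adds the outer factors.\<close>

lemma \<zeta>_mult:
  assumes "s \<in> carrier (tensor k L H)" "t \<in> carrier (tensor k L H)"
  shows "\<zeta> (s \<otimes>\<^bsub>smash_prod k L H R\<^esub> t) = \<zeta> s \<otimes>\<^bsub>K\<^esub> \<zeta> t"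
proof (rule bilinear_ext[OF module_L module_H module_L module_H module_K _ _ _ assms])
  show "(\<lambda>s t. \<zeta> (s \<otimes>\<^bsub>smash_prod k L H R\<^esub> t)) \<in> bilinear_maps k (tensor k L H) (tensor k L H) K"
    by (rule linear_comp_bilinear[OF \<zeta>_linear smash_prod_mult_bilinear[OF L_algebra H_algebra R_linear]])
  show "(\<lambda>s t. \<zeta> s \<otimes>\<^bsub>K\<^esub> \<zeta> t) \<in> bilinear_maps k (tensor k L H) (tensor k L H) K"
    by (rule bilinear_comp[OF mult_bilinear[OF K_algebra] \<zeta>_linear \<zeta>_linear])
  fix l h l' h' assume c: "l \<in> carrier L" "h \<in> carrier H" "l' \<in> carrier L" "h' \<in> carrier H"
  have "R (pure_tensor k H L h l') \<in> carrier (tensor k L H)"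
    using c linear_closed[OF R_linear] by (simp add: pure_tensor_closed modules)
  then show "\<zeta> (pure_tensor k L H l h \<otimes>\<^bsub>smash_prod k L H R\<^esub> pure_tensor k L H l' h')
      = \<zeta> (pure_tensor k L H l h) \<otimes>\<^bsub>K\<^esub> \<zeta> (pure_tensor k L H l' h')"
    using c by (simp add: smash_prod_mult_pure[OF L_algebra H_algebra R_linear] \<zeta>_sandwich \<zeta>_R \<zeta>_pure
        K_mult_assoc K_mult_closed i_closed)
qed

lemma \<zeta>'_mult:
  assumes "x \<in> carrier K" "y \<in> carrier K"
  shows "\<zeta>' (x \<otimes>\<^bsub>K\<^esub> y) = \<zeta>' x \<otimes>\<^bsub>smash_prod k L H R\<^esub> \<zeta>' y"
proof -
  note c = linear_closed[OF \<zeta>'_linear assms(1)] linear_closed[OF \<zeta>'_linear assms(2)]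
  have "\<zeta>' x \<otimes>\<^bsub>smash_prod k L H R\<^esub> \<zeta>' y \<in> carrier (tensor k L H)"
    using bilinear_closed[OF smash_prod_mult_bilinear[OF L_algebra H_algebra R_linear] c] .
  then have "\<zeta>' (\<zeta> (\<zeta>' x \<otimes>\<^bsub>smash_prod k L H R\<^esub> \<zeta>' y)) = \<zeta>' x \<otimes>\<^bsub>smash_prod k L H R\<^esub> \<zeta>' y"
    by (rule \<zeta>'_\<zeta>)
  then show ?thesis by (simp add: \<zeta>_mult c \<zeta>_\<zeta>' assms)
qed

lemma \<zeta>'_one: "\<zeta>' \<one>\<^bsub>K\<^esub> = pure_tensor k L H \<one>\<^bsub>L\<^esub> \<one>\<^bsub>H\<^esub>"
proof -
  interpret L: ring L by (rule assoc_algebra.axioms(2)[OF L_algebra])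
  interpret H: ring H by (rule assoc_algebra.axioms(2)[OF H_algebra])
  interpret KR: ring K by (rule assoc_algebra.axioms(2)[OF K_algebra])
  have "\<zeta> (pure_tensor k L H \<one>\<^bsub>L\<^esub> \<one>\<^bsub>H\<^esub>) = \<one>\<^bsub>K\<^esub>"
    by (simp add: \<zeta>_pure i_one)
  then show ?thesis
    using \<zeta>'_\<zeta>[of "pure_tensor k L H \<one>\<^bsub>L\<^esub> \<one>\<^bsub>H\<^esub>"] by (simp add: pure_tensor_closed modules)
qed

text \<open>Every element of \<open>L \<otimes> H\<close> has the form \<open>\<zeta>' x\<close>,
  with coordinates \<open>p\<^sub>L\<close> x1 and \<open>p\<^sub>H\<close> x2. On it
  \<open>W\<close> interchanges the roles of the two projections while keeping the order x1,
  x2.\<close>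

lemma W_\<zeta>': "x \<in> carrier K \<Longrightarrow> W (\<zeta>' x) = tensor_map k H L p\<^sub>H p\<^sub>L (comult K x)"
  by (simp add: W_def \<zeta>_\<zeta>')

text \<open>In Sweedler notation both sides are \<open>p\<^sub>L x\<^sub>1 \<otimes> p\<^sub>H x\<^sub>2 \<otimes> p\<^sub>L x\<^sub>3 \<otimes> p\<^sub>H x\<^sub>4\<close>: \<open>W\<close> undoes the
  exchange of the two middle factors.\<close>

lemma \<zeta>'_comult:
  assumes x: "x \<in> carrier K"
  shows "tensor_map k (tensor k L H) (tensor k L H) \<zeta>' \<zeta>' (comult K x) = smash_comult k L H W (\<zeta>' x)"
proof -
  let ?T = "tensor k L H" and ?K2 = "tensor k K K"
  let ?L = "tensor_map k L L p\<^sub>L p\<^sub>L" and ?H = "tensor_map k H H p\<^sub>H p\<^sub>H" and ?p = "tensor_map k L H p\<^sub>L p\<^sub>H"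
  let ?LH = "tensor_map k (tensor k L L) (tensor k H H) ?L ?H" and ?pp = "tensor_map k ?T ?T ?p ?p"
  \<comment> \<open>\<open>?S\<close> splits the middle factor of a three-fold tensor and groups the
    four factors in pairs. At the three-fold coproduct \<open>?y\<close> it yields the four-fold
    coproduct, by \<open>comult_comult\<close>.\<close>
  let ?S = "tensor_regroup k K K K K \<circ> tensor_map k K (tensor k ?K2 K) id (tensor_map k ?K2 K (comult K) id)"
  let ?F = "tensor_middle k L L H H W \<circ> (?LH \<circ> ?S)" and ?G = "?pp \<circ> ?S"
  let ?y = "tensor_map k K ?K2 id (comult K) (comult K x)"
  note \<Delta> = K.comult_linear and \<Delta>x = K.comult_closed[OF x]
  note mods = module_L module_H module_K module_tensor
  note L = tensor_map_linear[OF p_linear(1) p_linear(1) module_K module_K module_L module_L]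
  note H = tensor_map_linear[OF p_linear(2) p_linear(2) module_K module_K module_H module_H]
  note p = tensor_map_linear[OF p_linear module_K module_K module_L module_H]
  note \<Delta>1 = tensor_map_linear[OF \<Delta> linear_id module_K module_K module_tensor[OF module_K module_K] module_K]
  have y: "?y \<in> carrier (tensor k K ?K2)"
    by (rule linear_closed[OF _ \<Delta>x]) (rule tensor_map_linear linear_id \<Delta> mods)+
  \<comment> \<open>Both maps are compared on all of \<open>K \<otimes> (K \<otimes> K)\<close>,
    where pure a \<otimes> (b \<otimes> d) suffice. The outer factors become
    \<open>p\<^sub>L a\<close> and \<open>p\<^sub>H d\<close> on both sides; the middle is
    \<open>W (\<zeta>' b)\<close> for \<open>?F\<close> and
    \<open>(p\<^sub>H \<otimes> p\<^sub>L) \<Delta> b\<close> for \<open>?G\<close>, which agree by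
    \<open>W_\<zeta>'\<close>.\<close>
  have FG: "?F ?y = ?G ?y"
  proof (rule tensor_ext_right[OF module_K module_K module_K _ _ _ _ y])
    show "?F \<in> linear_maps k (tensor k K ?K2) (tensor k ?T ?T)"
      by (rule linear_comp tensor_middle_linear tensor_regroup_linear tensor_map_linear linear_id \<Delta> W_linear p_linear mods)+
    show "?G \<in> linear_maps k (tensor k K ?K2) (tensor k ?T ?T)"
      by (rule linear_comp tensor_regroup_linear tensor_map_linear linear_id \<Delta> p_linear mods)+
    fix a b d assume c: "a \<in> carrier K" "b \<in> carrier K" "d \<in> carrier K"
    have S: "?S (pure_tensor k K ?K2 a (pure_tensor k K K b d)) = tensor_sandwich k K K K K a (comult K b) d"
      using c by (simp add: tensor_map_pure[OF linear_id \<Delta>1] tensor_map_pure[OF \<Delta> linear_id] mods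
          pure_tensor_closed tensor_sandwich_def)
    have u: "?p (comult K b) = \<zeta>' b" by (simp add: \<zeta>'_def)
    have "?LH (tensor_sandwich k K K K K a (comult K b) d) = tensor_sandwich k L L H H (p\<^sub>L a) (\<zeta>' b) (p\<^sub>H d)"
      using c by (simp add: tensor_map_sandwich[where u = "comult K b" and B = K and C = K] p_linear mods K.comult_closed u)
    moreover have "?pp (tensor_sandwich k K K K K a (comult K b) d)
        = tensor_sandwich k L H L H (p\<^sub>L a) (W (\<zeta>' b)) (p\<^sub>H d)"
      using c by (simp add: tensor_map_sandwich[where u = "comult K b" and B = K and C = K] p_linear mods K.comult_closed W_\<zeta>')
    moreover have "tensor_middle k L L H H W (tensor_sandwich k L L H H (p\<^sub>L a) (\<zeta>' b) (p\<^sub>H d))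
        = tensor_sandwich k L H L H (p\<^sub>L a) (W (\<zeta>' b)) (p\<^sub>H d)"
      using c by (intro tensor_middle_sandwich mods W_linear p_closed linear_closed[OF \<zeta>'_linear])
    ultimately show "?F (pure_tensor k K ?K2 a (pure_tensor k K K b d)) = ?G (pure_tensor k K ?K2 a (pure_tensor k K K b d))"
      unfolding comp_apply[of _ ?S] comp_apply[of _ "?LH \<circ> ?S"] S by simp
  qed (rule mods)+
  have "smash_comult k L H W (\<zeta>' x)
    = tensor_middle k L L H H W (tensor_map k (tensor k L L) (tensor k H H) (comult L \<circ> p\<^sub>L) (comult H \<circ> p\<^sub>H) (comult K x))"
    by (simp add: smash_comult_def \<zeta>'_def tensor_map_comp[OF p_linear L.comult_linear H.comult_linear] mods \<Delta>x)
  also have "\<dots> = tensor_middle k L L H H W (tensor_map k (tensor k L L) (tensor k H H) (?L \<circ> comult K) (?H \<circ> comult K) (comult K x))"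
    by (subst tensor_map_cong[OF linear_comp[OF L \<Delta>] linear_comp[OF H \<Delta>]]) (simp_all add: mods p_comult \<Delta>x)
  also have "\<dots> = tensor_middle k L L H H W (?LH (tensor_map k ?K2 ?K2 (comult K) (comult K) (comult K x)))"
    by (simp add: tensor_map_comp[OF \<Delta> \<Delta> L H] mods \<Delta>x)
  also have "\<dots> = ?F ?y" by (simp add: K.comult_comult[OF x])
  also have "\<dots> = ?pp (tensor_map k ?K2 ?K2 (comult K) (comult K) (comult K x))"
    unfolding FG by (simp add: K.comult_comult[OF x])
  also have "\<dots> = tensor_map k ?T ?T \<zeta>' \<zeta>' (comult K x)"
    by (simp add: tensor_map_comp[OF \<Delta> \<Delta> p p] mods \<Delta>x \<zeta>'_def)
  finally show ?thesis by simp
qed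

text \<open>The projections preserve counits, so the claim reduces to
  \<open>(\<epsilon> \<otimes> \<epsilon>) \<Delta> = \<epsilon>\<close> in
  \<open>K\<close>.\<close>

lemma \<zeta>'_counit:
  assumes x: "x \<in> carrier K" shows "tensor_counit k L H (\<zeta>' x) = counit K x"
proof -
  have "tensor_map k (scalars k) (scalars k) (counit L) (counit H) (\<zeta>' x)
    = tensor_map k (scalars k) (scalars k) (counit L \<circ> p\<^sub>L) (counit H \<circ> p\<^sub>H) (comult K x)"
    by (simp add: \<zeta>'_def tensor_map_comp[OF p_linear L.counit_linear H.counit_linear] modules module_K K.comult_closed x)
  also have "\<dots> = tensor_map k (scalars k) (scalars k) (counit K) (counit K) (comult K x)"
    by (rule tensor_map_cong[OF K.counit_linear K.counit_linear])
      (simp_all add: modules module_K p_counit K.comult_closed x)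
  finally have "tensor_counit k L H (\<zeta>' x) = tensor_counit k K K (comult K x)"
    by (simp add: tensor_counit_def)
  then show ?thesis by (simp add: K.tensor_counit_comult x)
qed

text \<open>The bialgebra axioms come first, by transport along \<open>\<zeta>'\<close>. The smash
  product and smash coproduct conditions are then read off from the resulting bialgebra.\<close>

lemma smash_biproduct: "is_smash_biproduct k L H W R"
  and iso: "\<zeta>' \<in> bialgebra_isos k K (smash_biprod k L H W R)"
proof -
  let ?B = "smash_biprod k L H W R"
  have surj: "carrier (tensor k L H) = \<zeta>' ` carrier K"
  proof
    show "carrier (tensor k L H) \<subseteq> \<zeta>' ` carrier K"
    proof
      fix t assume t: "t \<in> carrier (tensor k L H)"
      show "t \<in> \<zeta>' ` carrier K"
        using \<zeta>'_\<zeta>[OF t] linear_closed[OF \<zeta>_linear t] by (metis imageI)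
    qed
  qed (auto intro: linear_closed[OF \<zeta>'_linear])
  have B: "bialgebra k ?B"
    by (rule bialgebra_surjective_image[OF K.bialgebra_axioms, of \<zeta>'])
      (simp_all add: \<zeta>'_linear surj linear_zero[OF module_K module_LH \<zeta>'_linear] \<zeta>'_one \<zeta>'_mult \<zeta>'_comult \<zeta>'_counit)
  interpret B: bialgebra k ?B by (rule B)
  have "monoid (smash_prod k L H R)"
    using ring.is_monoid[OF assoc_algebra.axioms(2)[OF B.assoc_algebra_axioms]] by (simp only: monoid_smash_biprod)
  then show "is_smash_biproduct k L H W R"
    using B B.coassociative B.counital
    by (simp add: is_smash_biproduct_def is_smash_product_def is_smash_coproduct_def
        smash_biprod_coassociative smash_biprod_counital)
  have "bij_betw \<zeta>' (carrier K) (carrier (tensor k L H))"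
    using surj by (auto simp: bij_betw_def intro!: inj_on_inverseI[of _ \<zeta>] \<zeta>_\<zeta>')
  moreover have "\<zeta>' \<in> ring_hom K ?B"
    by (rule ring_hom_memI)
      (simp_all add: linear_closed[OF \<zeta>'_linear] linear_add[OF \<zeta>'_linear] \<zeta>'_mult \<zeta>'_one)
  ultimately show "\<zeta>' \<in> bialgebra_isos k K ?B"
    by (simp add: bialgebra_isos_def algebra_maps_def coalgebra_maps_def \<zeta>'_linear \<zeta>'_comult \<zeta>'_counit)
qed

end

section \<open>From a smash biproduct to a factorisation\<close>

context algebra_coalgebra_pair
begin

lemmas LH_modules = module_L module_H module_LH module_tensor

lemmas module_HL = module_tensor[OF module_H module_L]

lemmas counits_closed = L.counit_closed H.counit_closed

abbreviation proj_L where "proj_L \<equiv> contract_right k L (counit H)"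

abbreviation proj_H where "proj_H \<equiv> contract_left k H (counit L)"

lemma proj_linear:
  "proj_L \<in> linear_maps k (tensor k L H) L" "proj_H \<in> linear_maps k (tensor k L H) H"
  by (rule contract_right_linear contract_left_linear module_L module_H L.counit_linear H.counit_linear)+

lemmas proj_pure = contract_right_pure[OF module_L module_H H.counit_linear]
  contract_left_pure[OF module_H module_L L.counit_linear]

lemma HL_contract_linear:
  "contract_left k L (counit H) \<in> linear_maps k (tensor k H L) L"
  "contract_right k H (counit L) \<in> linear_maps k (tensor k H L) H"
  by (rule contract_right_linear contract_left_linear module_L module_H L.counit_linear H.counit_linear)+

lemmas HL_contract_pure = contract_left_pure[OF module_L module_H H.counit_linear]
  contract_right_pure[OF module_H module_L L.counit_linear]

lemma linear_scale:
  assumes "module k P" "module k M" and c: "c \<in> carrier k" and f: "f \<in> linear_maps k M P"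
  shows "(\<lambda>x. c \<odot>\<^bsub>P\<^esub> f x) \<in> linear_maps k M P"
proof -
  interpret P: module k P by fact
  show ?thesis using c linear_closed[OF f]
    by (intro linear_mapsI)
      (simp_all add: linear_add[OF f] linear_smult[OF f] P.smult_r_distr L.R.m_comm flip: P.smult_assoc1)
qed

text \<open>The counit half of the coalgebra map property of the projections. Its first part also
  evaluates the total counit of a value of \<open>W\<close> once one factor has been
  contracted.\<close>

lemma proj_counit:
  assumes t: "t \<in> carrier (tensor k L H)"
  shows "counit L (proj_L t) = tensor_counit k L H t" "counit H (proj_H t) = tensor_counit k L H t"
proof -
  have "(counit L \<circ> proj_L) t = tensor_counit k L H t"
    by (rule tensor_ext[OF module_L module_H L.scalars_module linear_comp[OF L.counit_linear proj_linear(1)] tensor_counit_linear _ t])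
      (simp add: proj_pure tensor_counit_pure linear_smult[OF L.counit_linear] H.counit_closed L.counit_closed,
        simp add: scalars_def L.R.m_comm H.counit_closed L.counit_closed)
  moreover have "(counit H \<circ> proj_H) t = tensor_counit k L H t"
    by (rule tensor_ext[OF module_L module_H L.scalars_module linear_comp[OF H.counit_linear proj_linear(2)] tensor_counit_linear _ t])
      (simp add: proj_pure tensor_counit_pure linear_smult[OF H.counit_linear] H.counit_closed L.counit_closed,
        simp add: scalars_def)
  ultimately show "counit L (proj_L t) = tensor_counit k L H t" "counit H (proj_H t) = tensor_counit k L H t"
    by simp_all
qed

section \<open>Counits and projections applied to a sandwiched tensor\<close>

context
  fixes a u d
  assumes a: "a \<in> carrier L" and d: "d \<in> carrier H" and u: "u \<in> carrier (tensor k H L)"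
begin

private abbreviation "sw \<equiv> (\<lambda>u. tensor_sandwich k L H L H a u d)"

private lemma sw: "sw \<in> linear_maps k (tensor k H L) (tensor k (tensor k L H) (tensor k L H))"
  by (rule tensor_sandwich_linear[OF module_L module_H module_L module_H a d])

private lemmas contractL = contract_left_linear[OF module_LH module_LH tensor_counit_linear]
private lemmas contractR = contract_right_linear[OF module_LH module_LH tensor_counit_linear]

text \<open>The contraction evaluates the whole first leg, that is \<open>a\<close> and the
  \<open>H\<close> factor of \<open>u\<close>, and \<open>proj_L\<close> evaluates \<open>d\<close>.
  What survives is the \<open>L\<close> factor of \<open>u\<close>, so a counit law of the smash
  coproduct turns into a statement about a contraction of \<open>W\<close>.\<close>

lemma proj_L_contract_sandwich:
  "proj_L (contract_left k (tensor k L H) (tensor_counit k L H) (tensor_sandwich k L H L H a u d))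
    = (counit L a \<otimes>\<^bsub>k\<^esub> counit H d) \<odot>\<^bsub>L\<^esub> contract_left k L (counit H) u"
proof -
  have "(proj_L \<circ> (contract_left k (tensor k L H) (tensor_counit k L H) \<circ> sw)) u
      = (counit L a \<otimes>\<^bsub>k\<^esub> counit H d) \<odot>\<^bsub>L\<^esub> contract_left k L (counit H) u"
  proof (rule tensor_ext[OF module_H module_L module_L _ linear_scale[OF module_L _ _ HL_contract_linear(1)] _ u])
    show "proj_L \<circ> (contract_left k (tensor k L H) (tensor_counit k L H) \<circ> sw) \<in> linear_maps k (tensor k H L) L"
      by (rule linear_comp proj_linear contractL sw)+
  qed (simp_all add: a d LH_modules pure_tensor_closed tensor_sandwich_pure tensor_counit_pure counits_closed proj_pure HL_contract_pure
      contract_left_pure[OF module_LH module_LH tensor_counit_linear] linear_smult[OF proj_linear(1)]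
      L.R.m_ac flip: L.smult_assoc1)
  then show ?thesis by simp
qed

text \<open>The mirror image: the second leg is evaluated, then \<open>a\<close>, leaving the
  \<open>H\<close> factor of \<open>u\<close>.\<close>

lemma proj_H_contract_sandwich:
  "proj_H (contract_right k (tensor k L H) (tensor_counit k L H) (tensor_sandwich k L H L H a u d))
    = (counit L a \<otimes>\<^bsub>k\<^esub> counit H d) \<odot>\<^bsub>H\<^esub> contract_right k H (counit L) u"
proof -
  have "(proj_H \<circ> (contract_right k (tensor k L H) (tensor_counit k L H) \<circ> sw)) u
      = (counit L a \<otimes>\<^bsub>k\<^esub> counit H d) \<odot>\<^bsub>H\<^esub> contract_right k H (counit L) u"
  proof (rule tensor_ext[OF module_H module_L module_H _ linear_scale[OF module_H _ _ HL_contract_linear(2)] _ u])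
    show "proj_H \<circ> (contract_right k (tensor k L H) (tensor_counit k L H) \<circ> sw) \<in> linear_maps k (tensor k H L) H"
      by (rule linear_comp proj_linear contractR sw)+
  qed (simp_all add: a d LH_modules pure_tensor_closed tensor_sandwich_pure tensor_counit_pure counits_closed proj_pure HL_contract_pure
      contract_right_pure[OF module_LH module_LH tensor_counit_linear] linear_smult[OF proj_linear(2)]
      L.R.m_ac flip: H.smult_assoc1)
  then show ?thesis by simp
qed

text \<open>Projecting both legs to \<open>L\<close> evaluates the \<open>H\<close> factor of
  \<open>u\<close> and \<open>d\<close>. Hence a value of \<open>W\<close> in the position of
  \<open>u\<close> matters only through its left contraction.\<close>

lemma tensor_map_proj_L_sandwich:
  "tensor_map k L L proj_L proj_L (tensor_sandwich k L H L H a u d)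
    = counit H d \<odot>\<^bsub>tensor k L L\<^esub> pure_tensor k L L a (contract_left k L (counit H) u)"
proof -
  interpret LL: module k "tensor k L L" by (intro LH_modules)
  have "(tensor_map k L L proj_L proj_L \<circ> sw) u
      = counit H d \<odot>\<^bsub>tensor k L L\<^esub> (pure_tensor k L L a \<circ> contract_left k L (counit H)) u"
  proof (rule tensor_ext[OF module_H module_L LL.module_axioms _ linear_scale[OF LL.module_axioms] _ u])
    show "tensor_map k L L proj_L proj_L \<circ> sw \<in> linear_maps k (tensor k H L) (tensor k L L)"
      by (rule linear_comp tensor_map_linear proj_linear sw LH_modules)+
    show "pure_tensor k L L a \<circ> contract_left k L (counit H) \<in> linear_maps k (tensor k H L) (tensor k L L)"
      by (rule linear_comp bilinear_right[OF pure_tensor_bilinear] HL_contract_linear module_L a)+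
  qed (simp_all add: a d LH_modules pure_tensor_closed tensor_sandwich_pure counits_closed proj_pure HL_contract_pure
      tensor_map_pure[OF proj_linear(1) proj_linear(1)] pure_tensor_smult L.R.m_ac flip: LL.smult_assoc1)
  then show ?thesis by simp
qed

lemma tensor_map_proj_H_sandwich:
  "tensor_map k H H proj_H proj_H (tensor_sandwich k L H L H a u d)
    = counit L a \<odot>\<^bsub>tensor k H H\<^esub> pure_tensor k H H (contract_right k H (counit L) u) d"
proof -
  interpret HH: module k "tensor k H H" by (intro LH_modules)
  have "(tensor_map k H H proj_H proj_H \<circ> sw) u
      = counit L a \<odot>\<^bsub>tensor k H H\<^esub> ((\<lambda>x. pure_tensor k H H x d) \<circ> contract_right k H (counit L)) u"
  proof (rule tensor_ext[OF module_H module_L HH.module_axioms _ linear_scale[OF HH.module_axioms] _ u])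
    show "tensor_map k H H proj_H proj_H \<circ> sw \<in> linear_maps k (tensor k H L) (tensor k H H)"
      by (rule linear_comp tensor_map_linear proj_linear sw LH_modules)+
    show "(\<lambda>x. pure_tensor k H H x d) \<circ> contract_right k H (counit L) \<in> linear_maps k (tensor k H L) (tensor k H H)"
      by (rule linear_comp bilinear_left[OF pure_tensor_bilinear] HL_contract_linear module_H d)+
  qed (simp_all add: a d LH_modules pure_tensor_closed tensor_sandwich_pure counits_closed proj_pure HL_contract_pure
      tensor_map_pure[OF proj_linear(2) proj_linear(2)] pure_tensor_smult L.R.m_ac flip: HH.smult_assoc1)
  then show ?thesis by simp
qed

text \<open>Here both factors of \<open>u\<close> are evaluated, the \<open>H\<close> factor by
  \<open>proj_L\<close> and the \<open>L\<close> factor by \<open>proj_H\<close>, and the outer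
  vectors remain.\<close>

lemma tensor_map_proj_sandwich:
  "tensor_map k L H proj_L proj_H (tensor_sandwich k L H L H a u d)
    = counit L (contract_left k L (counit H) u) \<odot>\<^bsub>tensor k L H\<^esub> pure_tensor k L H a d"
proof -
  interpret LH: module k "tensor k L H" by (intro LH_modules)
  have p: "pure_tensor k L H a d \<in> carrier (tensor k L H)" by (simp add: pure_tensor_closed LH_modules a d)
  have "(tensor_map k L H proj_L proj_H \<circ> sw) u
      = ((\<lambda>c. c \<odot>\<^bsub>tensor k L H\<^esub> pure_tensor k L H a d) \<circ> (counit L \<circ> contract_left k L (counit H))) u"
  proof (rule tensor_ext[OF module_H module_L LH.module_axioms _ _ _ u])
    show "tensor_map k L H proj_L proj_H \<circ> sw \<in> linear_maps k (tensor k H L) (tensor k L H)"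
      by (rule linear_comp tensor_map_linear proj_linear sw LH_modules)+
    show "(\<lambda>c. c \<odot>\<^bsub>tensor k L H\<^esub> pure_tensor k L H a d) \<circ> (counit L \<circ> contract_left k L (counit H))
      \<in> linear_maps k (tensor k H L) (tensor k L H)"
      by (rule linear_comp bilinear_left[OF bilinear_scalar] HL_contract_linear L.counit_linear LH.module_axioms p)+
    fix h l assume "h \<in> carrier H" "l \<in> carrier L"
    moreover from this have "counit L (counit H h \<odot>\<^bsub>L\<^esub> l) = counit H h \<otimes>\<^bsub>k\<^esub> counit L l"
      by (simp add: linear_smult[OF L.counit_linear] counits_closed) (simp add: scalars_def)
    ultimately show "(tensor_map k L H proj_L proj_H \<circ> sw) (pure_tensor k H L h l)
      = ((\<lambda>c. c \<odot>\<^bsub>tensor k L H\<^esub> pure_tensor k L H a d) \<circ> (counit L \<circ> contract_left k L (counit H))) (pure_tensor k H L h l)"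
      by (simp add: a d LH_modules pure_tensor_closed tensor_sandwich_pure counits_closed proj_pure HL_contract_pure p
        tensor_map_pure[OF proj_linear] pure_tensor_smult L.R.m_comm flip: LH.smult_assoc1)
  qed
  then show ?thesis by simp
qed

end

text \<open>Two choices of sides in the counit laws. For l1 \<otimes> l2 \<otimes> h1 \<otimes> h2
  the first evaluates the outer factors and keeps l2 \<otimes> h1, the argument of \<open>W\<close>
  in the smash coproduct. The second evaluates the inner factors and keeps l1 \<otimes> h2.\<close>

lemma contract_comult_comult:
  assumes t: "t \<in> carrier (tensor k L H)"
  defines "s \<equiv> tensor_map k (tensor k L L) (tensor k H H) (comult L) (comult H) t"
  shows "tensor_map k L H (contract_left k L (counit L)) (contract_right k H (counit H)) s = t"
    and "tensor_map k L H (contract_right k L (counit L)) (contract_left k H (counit H)) s = t"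
proof -
  note c = contract_left_linear[OF module_L module_L L.counit_linear] contract_right_linear[OF module_L module_L L.counit_linear]
    contract_left_linear[OF module_H module_H H.counit_linear] contract_right_linear[OF module_H module_H H.counit_linear]
  have "tensor_map k L H (contract_left k L (counit L)) (contract_right k H (counit H)) s
    = tensor_map k L H (contract_left k L (counit L) \<circ> comult L) (contract_right k H (counit H) \<circ> comult H) t"
    unfolding s_def by (rule tensor_map_comp[OF L.comult_linear H.comult_linear c(1,4)]) (intro LH_modules t)+
  also have "\<dots> = tensor_map k L H id id t"
    by (rule tensor_map_cong[OF linear_id linear_id])
      (simp_all add: LH_modules t L.counit_left_comult H.counit_right_comult)
  finally show "tensor_map k L H (contract_left k L (counit L)) (contract_right k H (counit H)) s = t"
    using t by (simp add: tensor_map_id LH_modules)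
  have "tensor_map k L H (contract_right k L (counit L)) (contract_left k H (counit H)) s
    = tensor_map k L H (contract_right k L (counit L) \<circ> comult L) (contract_left k H (counit H) \<circ> comult H) t"
    unfolding s_def by (rule tensor_map_comp[OF L.comult_linear H.comult_linear c(2,3)]) (intro LH_modules t)+
  also have "\<dots> = tensor_map k L H id id t"
    by (rule tensor_map_cong[OF linear_id linear_id])
      (simp_all add: LH_modules t L.counit_right_comult H.counit_left_comult)
  finally show "tensor_map k L H (contract_right k L (counit L)) (contract_left k H (counit H)) s = t"
    using t by (simp add: tensor_map_id LH_modules)
qed

section \<open>Consequences of the counit laws of a smash coproduct\<close>

context
  fixes W
  assumes W: "W \<in> linear_maps k (tensor k L H) (tensor k H L)"
    and counital: "counital k (tensor k L H) (smash_comult k L H W) (tensor_counit k L H)"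
begin

private abbreviation "LLHH \<equiv> tensor k (tensor k L L) (tensor k H H)"
private abbreviation "\<Delta>\<Delta> \<equiv> tensor_map k (tensor k L L) (tensor k H H) (comult L) (comult H)"
private abbreviation "mid \<equiv> tensor_middle k L L H H W"

private lemma \<Delta>\<Delta>: "\<Delta>\<Delta> \<in> linear_maps k (tensor k L H) LLHH"
  by (rule tensor_map_linear L.comult_linear H.comult_linear LH_modules)+

private lemma mid: "mid \<in> linear_maps k LLHH (tensor k (tensor k L H) (tensor k L H))"
  by (rule tensor_middle_linear LH_modules W)+

private lemma mid_pure:
  "l \<in> carrier L \<Longrightarrow> l' \<in> carrier L \<Longrightarrow> h \<in> carrier H \<Longrightarrow> h' \<in> carrier H \<Longrightarrow>
    mid (pure_tensor k (tensor k L L) (tensor k H H) (pure_tensor k L L l l') (pure_tensor k H H h h'))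
      = tensor_sandwich k L H L H l (W (pure_tensor k L H l' h)) h'"
  by (rule tensor_middle_pure[OF module_L module_L module_H module_H W])

private lemma W_closed: "l \<in> carrier L \<Longrightarrow> h \<in> carrier H \<Longrightarrow> W (pure_tensor k L H l h) \<in> carrier (tensor k H L)"
  using linear_closed[OF W] by (simp add: pure_tensor_closed LH_modules)

private lemmas contract_linear =
  contract_left_linear[OF module_L module_L L.counit_linear] contract_right_linear[OF module_L module_L L.counit_linear]
  contract_left_linear[OF module_H module_H H.counit_linear] contract_right_linear[OF module_H module_H H.counit_linear]

private lemmas contract_pure =
  contract_left_pure[OF module_L module_L L.counit_linear] contract_right_pure[OF module_L module_L L.counit_linear]
  contract_left_pure[OF module_H module_H H.counit_linear] contract_right_pure[OF module_H module_H H.counit_linear]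

text \<open>Apply \<open>proj_L\<close> to the left counit law of the smash coproduct. The counits
  evaluate l1 and h2, so the left side becomes the contraction of \<open>W\<close> at l2 \<otimes>
  h1 with all other factors evaluated, that is, at \<open>t\<close>.\<close>

lemma contract_left_W:
  assumes t: "t \<in> carrier (tensor k L H)" shows "contract_left k L (counit H) (W t) = proj_L t"
proof -
  let ?F = "proj_L \<circ> (contract_left k (tensor k L H) (tensor_counit k L H) \<circ> mid)"
  let ?c = "tensor_map k L H (contract_left k L (counit L)) (contract_right k H (counit H))"
  let ?G = "contract_left k L (counit H) \<circ> (W \<circ> ?c)"
  \<comment> \<open>The two maps agree on the entire four-fold tensor product. Its pure elements
    supply \<open>W\<close> with a pure argument, which the coproducts of \<open>t\<close> alone
    would not.\<close>
  have "?F (\<Delta>\<Delta> t) = ?G (\<Delta>\<Delta> t)"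
  proof (rule tensor_ext_four[OF module_L module_L module_H module_H module_L _ _ _ linear_closed[OF \<Delta>\<Delta> t]])
    show "?F \<in> linear_maps k LLHH L"
      by (rule linear_comp proj_linear contract_left_linear tensor_counit_linear mid LH_modules)+
    show "?G \<in> linear_maps k LLHH L"
      by (rule linear_comp HL_contract_linear W tensor_map_linear contract_linear LH_modules)+
  qed (simp_all add: mid_pure proj_L_contract_sandwich W_closed tensor_map_pure[OF contract_linear(1,4)] contract_pure
      LH_modules pure_tensor_closed pure_tensor_smult counits_closed linear_smult[OF W] linear_smult[OF HL_contract_linear(1)]
      linear_closed[OF HL_contract_linear(1)] linear_closed[OF W]
      module.smult_closed[OF module_LH] module.smult_closed[OF module_HL] L.R.m_comm flip: L.smult_assoc1)
  moreover have "contract_left k (tensor k L H) (tensor_counit k L H) (mid (\<Delta>\<Delta> t)) = t"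
    using counital t by (simp add: counital_def contract_left_def smash_comult_def)
  ultimately show ?thesis using contract_comult_comult(1)[OF t] by simp
qed

text \<open>The mirror image, obtained by applying \<open>proj_H\<close> to the right counit
  law.\<close>

lemma contract_right_W:
  assumes t: "t \<in> carrier (tensor k L H)" shows "contract_right k H (counit L) (W t) = proj_H t"
proof -
  let ?F = "proj_H \<circ> (contract_right k (tensor k L H) (tensor_counit k L H) \<circ> mid)"
  let ?c = "tensor_map k L H (contract_left k L (counit L)) (contract_right k H (counit H))"
  let ?G = "contract_right k H (counit L) \<circ> (W \<circ> ?c)"
  have "?F (\<Delta>\<Delta> t) = ?G (\<Delta>\<Delta> t)"
  proof (rule tensor_ext_four[OF module_L module_L module_H module_H module_H _ _ _ linear_closed[OF \<Delta>\<Delta> t]])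
    show "?F \<in> linear_maps k LLHH H"
      by (rule linear_comp proj_linear contract_right_linear tensor_counit_linear mid LH_modules)+
    show "?G \<in> linear_maps k LLHH H"
      by (rule linear_comp HL_contract_linear W tensor_map_linear contract_linear LH_modules)+
  qed (simp_all add: mid_pure proj_H_contract_sandwich W_closed tensor_map_pure[OF contract_linear(1,4)] contract_pure
      LH_modules pure_tensor_closed pure_tensor_smult counits_closed linear_smult[OF W] linear_smult[OF HL_contract_linear(2)]
      linear_closed[OF HL_contract_linear(2)] linear_closed[OF W]
      module.smult_closed[OF module_LH] module.smult_closed[OF module_HL] L.R.m_comm flip: H.smult_assoc1)
  moreover have "contract_right k (tensor k L H) (tensor_counit k L H) (mid (\<Delta>\<Delta> t)) = t"
    using counital t by (simp add: counital_def contract_right_def smash_comult_def)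
  ultimately show ?thesis using contract_comult_comult(1)[OF t] by simp
qed

text \<open>Projecting both legs to \<open>L\<close> leaves l1 and the left contraction of
  \<open>W\<close> at l2 \<otimes> h1, scaled by the counit of h2. By \<open>contract_left_W\<close>
  this is l1 \<otimes> l2 scaled by the counits of h1 and h2, that is, the coproduct of l scaled by
  the counit of h.\<close>

lemma proj_L_comult:
  assumes t: "t \<in> carrier (tensor k L H)"
  shows "tensor_map k L L proj_L proj_L (smash_comult k L H W t) = comult L (proj_L t)"
proof -
  \<comment> \<open>The pair (\<open>H\<close>, \<open>H\<close>) provides the counit on
    \<open>H \<otimes> H\<close>, against which both copies of \<open>H\<close> are evaluated at
    once.\<close>
  have HH: "algebra_coalgebra_pair k H H"
    by (intro algebra_coalgebra_pair.intro H_algebra H_coalgebra)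
  note HH_counit = algebra_coalgebra_pair.tensor_counit_linear[OF HH] algebra_coalgebra_pair.tensor_counit_pure[OF HH]
  interpret LL: module k "tensor k L L" by (intro LH_modules)
  let ?F = "tensor_map k L L proj_L proj_L \<circ> mid"
  let ?G = "contract_right k (tensor k L L) (tensor_counit k H H)"
  note G = contract_right_linear[OF LL.module_axioms module_tensor[OF module_H module_H] HH_counit(1)]
  note G_pure = contract_right_pure[OF LL.module_axioms module_tensor[OF module_H module_H] HH_counit(1)]
  have "?F (\<Delta>\<Delta> t) = ?G (\<Delta>\<Delta> t)"
  proof (rule tensor_ext_four[OF module_L module_L module_H module_H LL.module_axioms _ G _ linear_closed[OF \<Delta>\<Delta> t]])
    show "?F \<in> linear_maps k LLHH (tensor k L L)"
      by (rule linear_comp tensor_map_linear proj_linear mid LH_modules)+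
  qed (simp_all add: mid_pure tensor_map_proj_L_sandwich W_closed contract_left_W proj_pure G_pure HH_counit(2)
      LH_modules pure_tensor_closed pure_tensor_smult counits_closed L.R.m_comm flip: LL.smult_assoc1)
  moreover have "(?G \<circ> \<Delta>\<Delta>) t = (comult L \<circ> proj_L) t"
    by (rule tensor_ext[OF module_L module_H LL.module_axioms linear_comp[OF G \<Delta>\<Delta>]
          linear_comp[OF L.comult_linear proj_linear(1)] _ t])
      (simp add: tensor_map_pure[OF L.comult_linear H.comult_linear] LH_modules G_pure L.comult_closed H.comult_closed
        proj_pure H.tensor_counit_comult linear_smult[OF L.comult_linear] counits_closed)
  ultimately show ?thesis by (simp add: smash_comult_def)
qed

lemma proj_H_comult:
  assumes t: "t \<in> carrier (tensor k L H)"
  shows "tensor_map k H H proj_H proj_H (smash_comult k L H W t) = comult H (proj_H t)"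
proof -
  have LL: "algebra_coalgebra_pair k L L"
    by (intro algebra_coalgebra_pair.intro L_algebra L_coalgebra)
  note LL_counit = algebra_coalgebra_pair.tensor_counit_linear[OF LL] algebra_coalgebra_pair.tensor_counit_pure[OF LL]
  interpret HH: module k "tensor k H H" by (intro LH_modules)
  let ?F = "tensor_map k H H proj_H proj_H \<circ> mid"
  let ?G = "contract_left k (tensor k H H) (tensor_counit k L L)"
  note G = contract_left_linear[OF HH.module_axioms module_tensor[OF module_L module_L] LL_counit(1)]
  note G_pure = contract_left_pure[OF HH.module_axioms module_tensor[OF module_L module_L] LL_counit(1)]
  have "?F (\<Delta>\<Delta> t) = ?G (\<Delta>\<Delta> t)"
  proof (rule tensor_ext_four[OF module_L module_L module_H module_H HH.module_axioms _ G _ linear_closed[OF \<Delta>\<Delta> t]])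
    show "?F \<in> linear_maps k LLHH (tensor k H H)"
      by (rule linear_comp tensor_map_linear proj_linear mid LH_modules)+
  qed (simp_all add: mid_pure tensor_map_proj_H_sandwich W_closed contract_right_W proj_pure G_pure LL_counit(2)
      LH_modules pure_tensor_closed pure_tensor_smult counits_closed L.R.m_comm flip: HH.smult_assoc1)
  moreover have "(?G \<circ> \<Delta>\<Delta>) t = (comult H \<circ> proj_H) t"
    by (rule tensor_ext[OF module_L module_H HH.module_axioms linear_comp[OF G \<Delta>\<Delta>]
          linear_comp[OF H.comult_linear proj_linear(2)] _ t])
      (simp add: tensor_map_pure[OF L.comult_linear H.comult_linear] LH_modules G_pure L.comult_closed H.comult_closed
        proj_pure L.tensor_counit_comult linear_smult[OF H.comult_linear] counits_closed)
  ultimately show ?thesis by (simp add: smash_comult_def)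
qed

text \<open>The total counit of \<open>W\<close> at l2 \<otimes> h1 is the product of the counits of
  l2 and h1, by \<open>contract_left_W\<close> and \<open>proj_counit\<close>. So the inner factors
  disappear, and the second part of \<open>contract_comult_comult\<close> recovers \<open>t\<close>.
  After transport this gives the formula for the inverse of the factorisation map.\<close>

lemma tensor_map_proj_comult:
  assumes t: "t \<in> carrier (tensor k L H)"
  shows "tensor_map k L H proj_L proj_H (smash_comult k L H W t) = t"
proof -
  interpret LH: module k "tensor k L H" by (intro LH_modules)
  let ?F = "tensor_map k L H proj_L proj_H \<circ> mid"
  let ?G = "tensor_map k L H (contract_right k L (counit L)) (contract_left k H (counit H))"
  have "?F (\<Delta>\<Delta> t) = ?G (\<Delta>\<Delta> t)"
  proof (rule tensor_ext_four[OF module_L module_L module_H module_H LH.module_axioms _ _ _ linear_closed[OF \<Delta>\<Delta> t]])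
    show "?F \<in> linear_maps k LLHH (tensor k L H)"
      by (rule linear_comp tensor_map_linear proj_linear mid LH_modules)+
    show "?G \<in> linear_maps k LLHH (tensor k L H)"
      by (rule tensor_map_linear contract_linear LH_modules)+
  qed (simp_all add: mid_pure tensor_map_proj_sandwich W_closed contract_left_W proj_counit tensor_counit_pure
      tensor_map_pure[OF contract_linear(2,3)] contract_pure
      LH_modules pure_tensor_closed pure_tensor_smult counits_closed L.R.m_comm flip: LH.smult_assoc1)
  then show ?thesis using contract_comult_comult(2)[OF t] by (simp add: smash_comult_def)
qed

end

section \<open>Consequences of the unit laws of a smash product\<close>

context
  fixes R
  assumes R: "R \<in> linear_maps k (tensor k H L) (tensor k L H)"
    and monoid: "monoid (smash_prod k L H R)"
begin

private lemma one: "\<one>\<^bsub>L\<^esub> \<in> carrier L" "\<one>\<^bsub>H\<^esub> \<in> carrier H"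
  using assoc_algebra.axioms(2)[OF L_algebra] assoc_algebra.axioms(2)[OF H_algebra]
  by (auto intro: monoid.one_closed ring.is_monoid)

private lemma mult_one:
  "l \<in> carrier L \<Longrightarrow> l \<otimes>\<^bsub>L\<^esub> \<one>\<^bsub>L\<^esub> = l" "l \<in> carrier L \<Longrightarrow> \<one>\<^bsub>L\<^esub> \<otimes>\<^bsub>L\<^esub> l = l"
  "h \<in> carrier H \<Longrightarrow> h \<otimes>\<^bsub>H\<^esub> \<one>\<^bsub>H\<^esub> = h" "h \<in> carrier H \<Longrightarrow> \<one>\<^bsub>H\<^esub> \<otimes>\<^bsub>H\<^esub> h = h"
  using assoc_algebra.axioms(2)[OF L_algebra] assoc_algebra.axioms(2)[OF H_algebra]
  by (auto intro: monoid.r_one monoid.l_one ring.is_monoid)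

private lemma sandwich_one:
  assumes u: "u \<in> carrier (tensor k L H)"
  shows "tensor_map k L H (mult_map k L) (mult_map k H) (tensor_sandwich k L L H H \<one>\<^bsub>L\<^esub> u \<one>\<^bsub>H\<^esub>) = u"
proof -
  let ?F = "tensor_map k L H (mult_map k L) (mult_map k H) \<circ> (\<lambda>u. tensor_sandwich k L L H H \<one>\<^bsub>L\<^esub> u \<one>\<^bsub>H\<^esub>)"
  have "?F u = id u"
  proof (rule tensor_ext[OF module_L module_H module_LH _ linear_id _ u])
    show "?F \<in> linear_maps k (tensor k L H) (tensor k L H)"
      by (rule linear_comp tensor_map_linear mult_map_linear tensor_sandwich_linear
          L_algebra H_algebra module_tensor module_L module_H one)+
  qed (simp add: tensor_map_mult_sandwich_pure[OF L_algebra H_algebra] one mult_one)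
  then show ?thesis by simp
qed

text \<open>The product of 1 \<otimes> 1 and l \<otimes> 1 is \<open>R\<close> at 1 \<otimes> l
  multiplied by units on the outside, hence that value of \<open>R\<close> itself, while the left
  unit law says that it is l \<otimes> 1. The second equation uses the right unit law in the same
  way.\<close>

lemma R_one:
  "l \<in> carrier L \<Longrightarrow> R (pure_tensor k H L \<one>\<^bsub>H\<^esub> l) = pure_tensor k L H l \<one>\<^bsub>H\<^esub>"
  "h \<in> carrier H \<Longrightarrow> R (pure_tensor k H L h \<one>\<^bsub>L\<^esub>) = pure_tensor k L H \<one>\<^bsub>L\<^esub> h"
proof -
  have c: "R (pure_tensor k H L h l) \<in> carrier (tensor k L H)" if "h \<in> carrier H" "l \<in> carrier L" for h l
    using that linear_closed[OF R] by (simp add: pure_tensor_closed module_L module_H)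
  show "R (pure_tensor k H L \<one>\<^bsub>H\<^esub> l) = pure_tensor k L H l \<one>\<^bsub>H\<^esub>" if l: "l \<in> carrier L"
    using monoid.l_one[OF monoid, of "pure_tensor k L H l \<one>\<^bsub>H\<^esub>"] l c
    by (simp add: smash_prod_mult_pure[OF L_algebra H_algebra R] one sandwich_one pure_tensor_closed module_L module_H)
  show "R (pure_tensor k H L h \<one>\<^bsub>L\<^esub>) = pure_tensor k L H \<one>\<^bsub>L\<^esub> h" if h: "h \<in> carrier H"
    using monoid.r_one[OF monoid, of "pure_tensor k L H \<one>\<^bsub>L\<^esub> h"] h c
    by (simp add: smash_prod_mult_pure[OF L_algebra H_algebra R] one sandwich_one pure_tensor_closed module_L module_H)
qed

text \<open>In all three products the argument of \<open>R\<close> contains a unit, so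
  \<open>R_one\<close> makes its value pure. The first two equations make the inclusions
  multiplicative; the third splits a pure tensor into a product of two included elements.\<close>

lemma incl_mult:
  "l \<in> carrier L \<Longrightarrow> l' \<in> carrier L \<Longrightarrow> pure_tensor k L H l \<one>\<^bsub>H\<^esub> \<otimes>\<^bsub>smash_prod k L H R\<^esub> pure_tensor k L H l' \<one>\<^bsub>H\<^esub>
    = pure_tensor k L H (l \<otimes>\<^bsub>L\<^esub> l') \<one>\<^bsub>H\<^esub>"
  "h \<in> carrier H \<Longrightarrow> h' \<in> carrier H \<Longrightarrow> pure_tensor k L H \<one>\<^bsub>L\<^esub> h \<otimes>\<^bsub>smash_prod k L H R\<^esub> pure_tensor k L H \<one>\<^bsub>L\<^esub> h'
    = pure_tensor k L H \<one>\<^bsub>L\<^esub> (h \<otimes>\<^bsub>H\<^esub> h')"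
  "l \<in> carrier L \<Longrightarrow> h \<in> carrier H \<Longrightarrow> pure_tensor k L H l \<one>\<^bsub>H\<^esub> \<otimes>\<^bsub>smash_prod k L H R\<^esub> pure_tensor k L H \<one>\<^bsub>L\<^esub> h
    = pure_tensor k L H l h"
  by (simp_all add: smash_prod_mult_pure[OF L_algebra H_algebra R] one R_one mult_one
      tensor_map_mult_sandwich_pure[OF L_algebra H_algebra])

end

section \<open>The factorisation carried by an isomorphism with a smash biproduct\<close>

lemma factorises_if_smash_biproduct:
  assumes K: "bialgebra k K"
    and R: "R \<in> linear_maps k (tensor k H L) (tensor k L H)" and W: "W \<in> linear_maps k (tensor k L H) (tensor k H L)"
    and biproduct: "is_smash_biproduct k L H W R" and f: "f \<in> bialgebra_isos k K (smash_biprod k L H W R)"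
  shows "factorises k K L H"
proof -
  interpret K: bialgebra k K by fact
  let ?T = "tensor k L H" and ?P = "smash_prod k L H R"
  have aK: "assoc_algebra k K" by (rule K.assoc_algebra_axioms)
  have mK: "module k K" by (rule K.module_axioms)
  interpret P: monoid ?P using biproduct by (simp add: is_smash_biproduct_def is_smash_product_def)
  have counital: "counital k ?T (smash_comult k L H W) (tensor_counit k L H)"
    using biproduct by (simp add: is_smash_biproduct_def is_smash_coproduct_def)
  have one: "\<one>\<^bsub>L\<^esub> \<in> carrier L" "\<one>\<^bsub>H\<^esub> \<in> carrier H"
    using assoc_algebra.axioms(2)[OF L_algebra] assoc_algebra.axioms(2)[OF H_algebra]
    by (auto intro: monoid.one_closed ring.is_monoid)
  have f_lin: "f \<in> linear_maps k K ?T" and f_bij: "bij_betw f (carrier K) (carrier ?T)"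
    and f_hom: "f \<in> ring_hom K (smash_biprod k L H W R)"
    using f by (auto simp: bialgebra_isos_def algebra_maps_def)
  have f_mult: "f (x \<otimes>\<^bsub>K\<^esub> y) = f x \<otimes>\<^bsub>?P\<^esub> f y" if "x \<in> carrier K" "y \<in> carrier K" for x y
    using ring_hom_mult[OF f_hom that] by simp
  have f_one: "f \<one>\<^bsub>K\<^esub> = pure_tensor k L H \<one>\<^bsub>L\<^esub> \<one>\<^bsub>H\<^esub>"
    using ring_hom_one[OF f_hom] by simp
  have f_comult: "tensor_map k ?T ?T f f (comult K x) = smash_comult k L H W (f x)"
    and f_counit: "tensor_counit k L H (f x) = counit K x" if "x \<in> carrier K" for x
    using f that by (auto simp: bialgebra_isos_def coalgebra_maps_def)
  define g where "g = inv_into (carrier K) f"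
  have g_lin: "g \<in> linear_maps k ?T K"
    unfolding g_def by (rule linear_inverse[OF mK module_LH f_lin f_bij])
  have gf: "g (f x) = x" if "x \<in> carrier K" for x
    using f_bij that by (auto simp: g_def bij_betw_def)
  have fg: "f (g t) = t" if "t \<in> carrier ?T" for t
    using f_bij that by (auto simp: g_def bij_betw_def f_inv_into_f)
  have g_mult: "g (s \<otimes>\<^bsub>?P\<^esub> t) = g s \<otimes>\<^bsub>K\<^esub> g t" if "s \<in> carrier ?T" "t \<in> carrier ?T" for s t
  proof -
    note c = linear_closed[OF g_lin that(1)] linear_closed[OF g_lin that(2)]
    have "g (f (g s \<otimes>\<^bsub>K\<^esub> g t)) = g s \<otimes>\<^bsub>K\<^esub> g t"
      by (intro gf bilinear_closed[OF mult_bilinear[OF aK]] c)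
    then show ?thesis using c that by (simp add: f_mult fg)
  qed
  have g_one: "g (pure_tensor k L H \<one>\<^bsub>L\<^esub> \<one>\<^bsub>H\<^esub>) = \<one>\<^bsub>K\<^esub>"
    using gf[of "\<one>\<^bsub>K\<^esub>"] ring.is_monoid[OF assoc_algebra.axioms(2)[OF aK]]
    by (simp add: f_one monoid.one_closed)
  let ?i\<^sub>L = "g \<circ> (\<lambda>l. pure_tensor k L H l \<one>\<^bsub>H\<^esub>)" and ?i\<^sub>H = "g \<circ> pure_tensor k L H \<one>\<^bsub>L\<^esub>"
  let ?p\<^sub>L = "proj_L \<circ> f" and ?p\<^sub>H = "proj_H \<circ> f"
  note p = pure_tensor_closed[OF module_L module_H]
  note incl = incl_mult[OF R P.monoid_axioms]
  have i\<^sub>L_lin: "?i\<^sub>L \<in> linear_maps k L K"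
    by (rule linear_comp[OF g_lin bilinear_left[OF pure_tensor_bilinear[OF module_L module_H] one(2)]])
  have i\<^sub>H_lin: "?i\<^sub>H \<in> linear_maps k H K"
    by (rule linear_comp[OF g_lin bilinear_right[OF pure_tensor_bilinear[OF module_L module_H] one(1)]])
  have i\<^sub>L: "?i\<^sub>L \<in> algebra_maps k L K"
    unfolding algebra_maps_def
    by (intro IntI i\<^sub>L_lin ring_hom_memI)
      (simp_all add: linear_closed[OF g_lin] p one linear_add[OF i\<^sub>L_lin, simplified] g_one flip: g_mult incl(1))
  have i\<^sub>H: "?i\<^sub>H \<in> algebra_maps k H K"
    unfolding algebra_maps_def
    by (intro IntI i\<^sub>H_lin ring_hom_memI)
      (simp_all add: linear_closed[OF g_lin] p one linear_add[OF i\<^sub>H_lin, simplified] g_one flip: g_mult incl(2))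
  note f_closed = linear_closed[OF f_lin]
  have p\<^sub>L: "?p\<^sub>L \<in> coalgebra_maps k K L"
    unfolding coalgebra_maps_def
    by (auto simp: linear_comp[OF proj_linear(1) f_lin] proj_counit f_closed f_counit module_L module_LH mK K.comult_closed
        proj_L_comult[OF W counital] f_comult tensor_map_comp[OF f_lin f_lin proj_linear(1) proj_linear(1), symmetric])
  have p\<^sub>H: "?p\<^sub>H \<in> coalgebra_maps k K H"
    unfolding coalgebra_maps_def
    by (auto simp: linear_comp[OF proj_linear(2) f_lin] proj_counit f_closed f_counit module_H module_LH mK K.comult_closed
        proj_H_comult[OF W counital] f_comult tensor_map_comp[OF f_lin f_lin proj_linear(2) proj_linear(2), symmetric])
  let ?\<zeta> = "mult_map k K \<circ> tensor_map k K K ?i\<^sub>L ?i\<^sub>H" and ?\<zeta>' = "tensor_map k L H ?p\<^sub>L ?p\<^sub>H \<circ> comult K"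
  \<comment> \<open>As \<open>g\<close> is multiplicative and l \<otimes> h is the product of l
    \<otimes> 1 and 1 \<otimes> h, the factorisation map agrees with \<open>g\<close> on pure
    tensors.\<close>
  have \<zeta>: "?\<zeta> t = g t" if t: "t \<in> carrier ?T" for t
  proof (rule tensor_ext[OF module_L module_H mK _ g_lin _ t])
    show "?\<zeta> \<in> linear_maps k ?T K"
      by (rule linear_comp[OF mult_map_linear[OF aK] tensor_map_linear[OF i\<^sub>L_lin i\<^sub>H_lin module_L module_H mK mK]])
    fix l h assume c: "l \<in> carrier L" "h \<in> carrier H"
    have "?\<zeta> (pure_tensor k L H l h) = mult_map k K (pure_tensor k K K (?i\<^sub>L l) (?i\<^sub>H h))"
      using tensor_map_pure[OF i\<^sub>L_lin i\<^sub>H_lin module_L module_H mK mK c] by (simp only: comp_apply[of "mult_map k K"])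
    also have "\<dots> = ?i\<^sub>L l \<otimes>\<^bsub>K\<^esub> ?i\<^sub>H h"
      by (rule mult_map_pure[OF aK linear_closed[OF i\<^sub>L_lin c(1)] linear_closed[OF i\<^sub>H_lin c(2)]])
    also have "\<dots> = g (pure_tensor k L H l h)"
      using c by (simp add: p one incl(3) flip: g_mult)
    finally show "?\<zeta> (pure_tensor k L H l h) = g (pure_tensor k L H l h)" .
  qed
  \<comment> \<open>Compatibility of \<open>f\<close> with the comultiplications replaces the
    coproduct in \<open>K\<close> by the smash coproduct of \<open>f x\<close>, on which the two
    projections act as the identity.\<close>
  have \<zeta>': "?\<zeta>' x = f x" if x: "x \<in> carrier K" for x
    using x by (simp add: tensor_map_comp[OF f_lin f_lin proj_linear, symmetric] module_L module_H module_LH mK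
        K.comult_closed f_comult tensor_map_proj_comult[OF W counital] f_closed)
  have "bij_betw g (carrier ?T) (carrier K)"
    using f_bij unfolding g_def by (rule bij_betw_inv_into)
  \<comment> \<open>The agreement with \<open>g\<close> holds on the carrier only, which is all that
    bijectivity between carriers depends on.\<close>
  then have "bij_betw ?\<zeta> (carrier ?T) (carrier K)"
    using \<zeta> by (simp cong: bij_betw_cong)
  moreover have "\<forall>t\<in>carrier ?T. ?\<zeta>' (?\<zeta> t) = t"
    using \<zeta> \<zeta>' fg linear_closed[OF g_lin] by metis
  moreover have "\<forall>x\<in>carrier K. ?\<zeta> (?\<zeta>' x) = x"
    using \<zeta> \<zeta>' gf f_closed by metis
  ultimately show ?thesis
    unfolding factorises_def Let_def using i\<^sub>L p\<^sub>L i\<^sub>H p\<^sub>H by blast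
qed

end

theorem theorem4p4:
  fixes k :: "'k ring"
    and K :: "('k, 'a) alg_coalg"
    and L :: "('k, 'l) alg_coalg"
    and H :: "('k, 'h) alg_coalg"
  assumes "field k"
    and "bialgebra k K"
    and "assoc_algebra k L" and "coalgebra k L"
    and "assoc_algebra k H" and "coalgebra k H"
  shows "(\<exists>R \<in> linear_maps k (tensor k H L) (tensor k L H).
          \<exists>W \<in> linear_maps k (tensor k L H) (tensor k H L).
            is_smash_biproduct k L H W R \<and>
            bialgebra_isos k K (smash_biprod k L H W R) \<noteq> {})
         \<longleftrightarrow> factorises k K L H"
proof -
  interpret algebra_coalgebra_pair k L H
    by (intro algebra_coalgebra_pair.intro assms)
  show ?thesis
  proof
    assume "\<exists>R \<in> linear_maps k (tensor k H L) (tensor k L H).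
      \<exists>W \<in> linear_maps k (tensor k L H) (tensor k H L).
        is_smash_biproduct k L H W R \<and> bialgebra_isos k K (smash_biprod k L H W R) \<noteq> {}"
    then obtain R W f where "R \<in> linear_maps k (tensor k H L) (tensor k L H)"
        "W \<in> linear_maps k (tensor k L H) (tensor k H L)"
        "is_smash_biproduct k L H W R" "f \<in> bialgebra_isos k K (smash_biprod k L H W R)"
      by auto
    then show "factorises k K L H" by (rule factorises_if_smash_biproduct[OF assms(2)])
  next
    assume "factorises k K L H"
    then obtain i\<^sub>L p\<^sub>L i\<^sub>H p\<^sub>H where F: "i\<^sub>L \<in> algebra_maps k L K" "i\<^sub>H \<in> algebra_maps k H K"
        "p\<^sub>L \<in> coalgebra_maps k K L" "p\<^sub>H \<in> coalgebra_maps k K H"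
      and inverse: "\<forall>t\<in>carrier (tensor k L H).
          (tensor_map k L H p\<^sub>L p\<^sub>H \<circ> comult K) ((mult_map k K \<circ> tensor_map k K K i\<^sub>L i\<^sub>H) t) = t"
        "\<forall>x\<in>carrier K.
          (mult_map k K \<circ> tensor_map k K K i\<^sub>L i\<^sub>H) ((tensor_map k L H p\<^sub>L p\<^sub>H \<circ> comult K) x) = x"
      unfolding factorises_def Let_def by (elim bexE conjE)
    interpret K: bialgebra k K by fact
    interpret F: bialgebra_factorisation k L H K i\<^sub>L i\<^sub>H p\<^sub>L p\<^sub>H
      by (intro bialgebra_factorisation.intro bialgebra_factorisation_axioms.intro
          algebra_coalgebra_pair_axioms K.bialgebra_axioms F inverse)
    show "\<exists>R \<in> linear_maps k (tensor k H L) (tensor k L H).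
      \<exists>W \<in> linear_maps k (tensor k L H) (tensor k H L).
        is_smash_biproduct k L H W R \<and> bialgebra_isos k K (smash_biprod k L H W R) \<noteq> {}"
      using F.smash_biproduct F.iso by (intro bexI[OF _ F.R_linear] bexI[OF _ F.W_linear]) auto
  qed
qed

end
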